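(* Let $p,q\in[1,\infty]$, $x_0\in\mathbb{R}^d$, $f\in L^p_{\mathrm{loc}}(\mathbb{R}^d)$, and let $\sigma=(\sigma_j)_j$ be an admissible sequence such that $2^{-jd/p}\sigma_j^{-1}\to0$ as $j\to\infty$ and $\underline{\sigma}_1>2^{-d/p}$. Let a compactly supported wavelet basis of regularity $R>\overline{s}(\sigma)$ be given. If $f$ belongs to the Xu space $\dot{X}^\eta_{p,q}(x_0)$ for some $\eta>0$, then \[ (\sigma_j\,d^p_j(x_0))_j\in\ell^q \] implies $f\in T^{\sigma}_{p,q,\log}(x_0)$.
   Context: $\mathbb{N}_0=\{0,1,2,\dots\}$. If $p=\infty$, then $d/p=0$ and $\ell^p$-type sums are replaced by suprema. Admissible sequences. A sequence $\sigma=(\sigma_j)_{j\in\mathbb{N}_0}$ of positive reals is admissible if there is $C>0$ with $C^{-1}\sigma_j\le\sigma_{j+1}\le C\sigma_j$ for all $j$. Put $\underline{\sigma}_j=\inf_{k\in\mathbb{N}_0}\sigma_{j+k}/\sigma_k$, $\overline{\sigma}_j=\sup_{k\in\mathbb{N}_0}\sigma_{j+k}/\sigma_k$; the lower and upper Boyd indices are $\underline{s}(\sigma)=\lim_j \frac{\log_2\underline{\sigma}_j}{j}$ and $\overline{s}(\sigma)=\lim_j\frac{\log_2\overline{\sigma}_j}{j}$. The space $T^{\sigma}_{p,q,\log}(x_0)$. Let $m=\lfloor\overline{s}(\sigma)\rfloor+1$, $\Delta_h^1f(x)=f(x+h)-f(x)$, $\Delta_h^{k+1}f=\Delta_h^1\Delta_h^kf$,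 $B(x_0,r)$ the open ball, $B_h(x_0,r)=\{x:[x,x+mh]\subset B(x_0,r)\}$; if $m\le 0$, one puts $\Delta_h^mf=f$ and $B_h(x_0,r)=B(x_0,r)$. When $2^{-jd/p}\sigma_j^{-1}\to0$, $f\in L^p_{\mathrm{loc}}$ belongs to $T^{\sigma}_{p,q,\log}(x_0)$ if there exists $J\in\mathbb{N}_0$ such that \[\Big(\frac{2^{jd/p}\sigma_j}{\log_2(2^{-jd/p}\sigma_j^{-1})}\sup_{|h|\le2^{-j}}\|\Delta_h^mf\|_{L^p(B_h(x_0,2^{-j}))}\Big)_{j\ge J}\in\ell^q.\] Wavelets. $\varphi$ and $\psi^{(i)}$ ($1\le i<2^d$) are functions such that $\{\varphi(x-k):k\in\mathbb{Z}^d\}\cup\{\psi^{(i)}(2^jx-k):1\le i<2^d,k\in\mathbb{Z}^d,j\in\mathbb{N}_0\}$ is an orthogonal basis of $L^2(\mathbb{R}^d)$. The basis is compactly supported of regularity $R\in\mathbb{N}_0$ if $\varphi,\psi^{(i)}$ are compactly supported, of class $C^R$, with $\int x^\alpha\psi^{(i)}(x)\,dx=0$ for $|\alpha|\le R$. The wavelet coefficients of $f$ are $c^{(i)}_{j,k}=2^{dj}\int f(x)\psi^{(i)}(2^jx-k)\,dx$. Xu space. $f\in\dot X^u_{p,q}(x_0)$ ($u\in\mathbb{R}$) if there is $C_*>0$ such that the sequence (indexed by $j\in\mathbb{N}_0$) $\big(\sum_{i,\ |k-2^jx_0|<C_*2^j}(2^{(u-d/p)j}|c^{(i)}_{j,k}|)^p\big)^{1/p}$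 belongs to $\ell^q$. Leaders. Identify $i\in\{1,\dots,2^d-1\}$ with an element of $\{0,1\}^d\setminus\{0\}$ and set $\lambda^{(i)}_{j,k}=\frac{i}{2^{j+1}}+\frac{k}{2^j}+[0,\frac1{2^{j+1}})^d$. For a dyadic cube $\lambda$ of side length $2^{-j}$ put \[d^p_\lambda=\sup_{j'\ge j}\Big(\sum_{(i,k'):\ \lambda^{(i)}_{j',k'}\subset\lambda}(2^{(j-j')d/p}|c^{(i)}_{j',k'}|)^p\Big)^{1/p}.\] $\lambda_j(x_0)$ is the dyadic cube of side $2^{-j}$ containing $x_0$, $3\lambda_j(x_0)$ is the set of the $3^d$ dyadic cubes of side $2^{-j}$ at distance $0$ from it (itself included), and $d^p_j(x_0)=\sup_{\lambda\in3\lambda_j(x_0)}d^p_\lambda$. *)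

theory Defs
  imports "HOL-Analysis.Analysis" "HOL-Probability.Essential_Supremum"
begin

section \<open>Lebesgue norms\<close>

text \<open>Exponents are elements of \<^typ>\<open>ennreal\<close>, and all norms take values in \<^typ>\<open>ennreal\<close>;
  belonging to a space means having a finite norm. The power below is only meant for \<open>r > 0\<close>.\<close>

definition ennpowr :: "ennreal \<Rightarrow> real \<Rightarrow> ennreal" where
  "ennpowr x r = (if x = \<infinity> then \<infinity> else ennreal (enn2real x powr r))"

definition lp_norm :: "ennreal \<Rightarrow> 'i set \<Rightarrow> ('i \<Rightarrow> ennreal) \<Rightarrow> ennreal" where
  "lp_norm p I a =
     (if p = \<infinity> then (SUP i\<in>I. a i)
      else ennpowr (\<Sum>\<^sub>\<infinity>i\<in>I. ennpowr (a i) (enn2real p)) (1 / enn2real p))"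

definition Lp_norm :: "ennreal \<Rightarrow> (real ^ 'd) set \<Rightarrow> (real ^ 'd \<Rightarrow> complex) \<Rightarrow> ennreal" where
  "Lp_norm p A f =
     (if p = \<infinity> then esssup (restrict_space lebesgue A) (\<lambda>x. ennreal (norm (f x)))
      else ennpowr (\<integral>\<^sup>+x. ennpowr (ennreal (norm (f x))) (enn2real p) \<partial>restrict_space lebesgue A)
             (1 / enn2real p))"

definition Lp :: "ennreal \<Rightarrow> (real ^ 'd \<Rightarrow> complex) set" where
  "Lp p = {f \<in> borel_measurable lebesgue. Lp_norm p UNIV f < \<infinity>}"

definition Lp_loc :: "ennreal \<Rightarrow> (real ^ 'd \<Rightarrow> complex) set" where
  "Lp_loc p = {f \<in> borel_measurable lebesgue. \<forall>K. compact K \<longrightarrow> Lp_norm p K f < \<infinity>}"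

text \<open>\<open>d/p\<close>, where \<open>d\<close> is the cardinality of the index type; it is \<open>0\<close> for \<open>p = \<infinity>\<close>
  by the conventions of \<^typ>\<open>ennreal\<close>.\<close>

definition dim_over :: "'d::finite itself \<Rightarrow> ennreal \<Rightarrow> real" where
  "dim_over _ p = enn2real (of_nat CARD('d) / p)"

section \<open>Admissible sequences\<close>

definition admissible :: "(nat \<Rightarrow> real) \<Rightarrow> bool" where
  "admissible \<sigma> \<longleftrightarrow> (\<forall>j. 0 < \<sigma> j) \<and>
     (\<exists>C>0. \<forall>j. inverse C * \<sigma> j \<le> \<sigma> (Suc j) \<and> \<sigma> (Suc j) \<le> C * \<sigma> j)"

definition lower_seq :: "(nat \<Rightarrow> real) \<Rightarrow> nat \<Rightarrow> real" where
  "lower_seq \<sigma> j = (INF k. \<sigma> (j + k) / \<sigma> k)"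

definition upper_seq :: "(nat \<Rightarrow> real) \<Rightarrow> nat \<Rightarrow> real" where
  "upper_seq \<sigma> j = (SUP k. \<sigma> (j + k) / \<sigma> k)"

definition upper_Boyd :: "(nat \<Rightarrow> real) \<Rightarrow> real" where
  "upper_Boyd \<sigma> = lim (\<lambda>j. log 2 (upper_seq \<sigma> j) / real j)"

section \<open>The spaces with logarithmic correction\<close>

definition finite_diff :: "nat \<Rightarrow> real ^ 'd \<Rightarrow> (real ^ 'd \<Rightarrow> complex) \<Rightarrow> real ^ 'd \<Rightarrow> complex" where
  "finite_diff m h = (\<lambda>f x. f (x + h) - f x) ^^ m"

definition inner_ball :: "nat \<Rightarrow> real ^ 'd \<Rightarrow> real ^ 'd \<Rightarrow> real \<Rightarrow> (real ^ 'd) set" where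
  "inner_ball m h x0 r = {x. closed_segment x (x + real m *\<^sub>R h) \<subseteq> ball x0 r}"

text \<open>Truncating the order \<open>\<lfloor>s\<rfloor> + 1\<close> at \<open>0\<close> realises the convention for nonpositive orders:
  for order \<open>0\<close> the difference is \<open>f\<close> itself and the inner ball is the whole ball.\<close>

definition diff_order :: "(nat \<Rightarrow> real) \<Rightarrow> nat" where
  "diff_order \<sigma> = nat (\<lfloor>upper_Boyd \<sigma>\<rfloor> + 1)"

text \<open>The argument of the logarithm tends to \<open>0\<close>, so the logarithm is eventually negative;
  membership in \<open>\<ell>\<^sup>q\<close> only involves the absolute value of the entries. The finitely many
  \<open>j\<close> where the logarithm may vanish are excluded by the choice of \<open>J\<close>.\<close>

definition T_log ::
  "(nat \<Rightarrow> real) \<Rightarrow> ennreal \<Rightarrow> ennreal \<Rightarrow> real ^ 'd \<Rightarrow> (real ^ 'd \<Rightarrow> complex) set" where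
  "T_log \<sigma> p q x0 = {f \<in> Lp_loc p. \<exists>J. lp_norm q {J..} (\<lambda>j.
       ennreal \<bar>2 powr (real j * dim_over TYPE('d) p) * \<sigma> j /
                log 2 (2 powr (- real j * dim_over TYPE('d) p) * inverse (\<sigma> j))\<bar> *
       (SUP h\<in>{h. norm h \<le> 2 powr (- real j)}.
          Lp_norm p (inner_ball (diff_order \<sigma>) h x0 (2 powr (- real j)))
            (finite_diff (diff_order \<sigma>) h f))) < \<infinity>}"

section \<open>Wavelet bases\<close>

definition int_vec :: "int ^ 'd \<Rightarrow> real ^ 'd" where
  "int_vec k = (\<chi> a. real_of_int (k $ a))"

text \<open>The \<open>2\<^sup>d - 1\<close> wavelets are indexed by \<open>{0,1}\<^sup>d - {0}\<close> from the outset.\<close>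

definition wtypes :: "(int ^ 'd) set" where
  "wtypes = {i. (\<forall>a. i $ a \<in> {0, 1}) \<and> i \<noteq> 0}"

text \<open>Orthogonal basis of the complex Hilbert space \<open>L\<^sup>2\<close>: a family of nonzero, pairwise
  orthogonal elements whose linear span is dense.\<close>

definition orthogonal_basis_L2 :: "'i set \<Rightarrow> ('i \<Rightarrow> real ^ 'd \<Rightarrow> complex) \<Rightarrow> bool" where
  "orthogonal_basis_L2 I w \<longleftrightarrow>
     (\<forall>a\<in>I. w a \<in> Lp 2 \<and> Lp_norm 2 UNIV (w a) \<noteq> 0) \<and>
     (\<forall>a\<in>I. \<forall>b\<in>I. a \<noteq> b \<longrightarrow> (LINT x|lebesgue. w a x * cnj (w b x)) = 0) \<and>
     (\<forall>g\<in>Lp 2. \<forall>\<epsilon>>0. \<exists>F c. finite F \<and> F \<subseteq> I \<and>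
        Lp_norm 2 UNIV (\<lambda>x. g x - (\<Sum>a\<in>F. c a * w a x)) < ennreal \<epsilon>)"

datatype ('d::finite) windex =
    Scaling "int ^ 'd"
  | Wavelet "int ^ 'd" nat "int ^ 'd"  \<comment> \<open>type \<open>i\<close>, scale \<open>j\<close>, position \<open>k\<close>\<close>

definition windices :: "'d::finite windex set" where
  "windices = range Scaling \<union> {Wavelet i j k |i j k. i \<in> wtypes}"

fun wfamily ::
  "(real ^ 'd \<Rightarrow> complex) \<Rightarrow> (int ^ 'd \<Rightarrow> real ^ 'd \<Rightarrow> complex) \<Rightarrow> 'd::finite windex \<Rightarrow> real ^ 'd \<Rightarrow> complex"
where
  "wfamily \<phi> \<psi> (Scaling k) = (\<lambda>x. \<phi> (x - int_vec k))"
| "wfamily \<phi> \<psi> (Wavelet i j k) = (\<lambda>x. \<psi> i (2 ^ j *\<^sub>R x - int_vec k))"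

definition wavelet_basis ::
  "(real ^ 'd \<Rightarrow> complex) \<Rightarrow> (int ^ 'd \<Rightarrow> real ^ 'd \<Rightarrow> complex) \<Rightarrow> bool" where
  "wavelet_basis \<phi> \<psi> \<longleftrightarrow> orthogonal_basis_L2 windices (wfamily \<phi> \<psi>)"

fun class_C :: "nat \<Rightarrow> (real ^ 'd \<Rightarrow> complex) \<Rightarrow> bool" where
  "class_C 0 f \<longleftrightarrow> continuous_on UNIV f"
| "class_C (Suc n) f \<longleftrightarrow>
     f differentiable_on UNIV \<and> (\<forall>v. class_C n (\<lambda>x. frechet_derivative f (at x) v))"

definition compactly_supported :: "(real ^ 'd \<Rightarrow> complex) \<Rightarrow> bool" where
  "compactly_supported f \<longleftrightarrow> compact (closure {x. f x \<noteq> 0})"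

definition regular_wavelet_basis ::
  "nat \<Rightarrow> (real ^ 'd \<Rightarrow> complex) \<Rightarrow> (int ^ 'd \<Rightarrow> real ^ 'd \<Rightarrow> complex) \<Rightarrow> bool" where
  "regular_wavelet_basis R \<phi> \<psi> \<longleftrightarrow>
     wavelet_basis \<phi> \<psi> \<and>
     compactly_supported \<phi> \<and> class_C R \<phi> \<and>
     (\<forall>i\<in>wtypes. compactly_supported (\<psi> i) \<and> class_C R (\<psi> i) \<and>
        (\<forall>\<alpha> :: nat ^ 'd. (\<Sum>a\<in>UNIV. \<alpha> $ a) \<le> R \<longrightarrow>
           (LINT x|lebesgue. complex_of_real (\<Prod>a\<in>UNIV. (x $ a) ^ (\<alpha> $ a)) * \<psi> i x) = 0))"

definition wcoeff ::
  "(int ^ 'd \<Rightarrow> real ^ 'd \<Rightarrow> complex) \<Rightarrow> (real ^ 'd \<Rightarrow> complex) \<Rightarrow> int ^ 'd \<Rightarrow> nat \<Rightarrow> int ^ 'd \<Rightarrow> complex"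
where
  "wcoeff \<psi> f i j k =
     2 ^ (CARD('d) * j) * (LINT x|lebesgue. f x * \<psi> i (2 ^ j *\<^sub>R x - int_vec k))"

section \<open>Xu spaces\<close>

definition Xu_space ::
  "(int ^ 'd \<Rightarrow> real ^ 'd \<Rightarrow> complex) \<Rightarrow> real \<Rightarrow> ennreal \<Rightarrow> ennreal \<Rightarrow> real ^ 'd
     \<Rightarrow> (real ^ 'd \<Rightarrow> complex) set" where
  "Xu_space \<psi> u p q x0 = {f. \<exists>C>0. lp_norm q UNIV (\<lambda>j.
       lp_norm p {(i, k). i \<in> wtypes \<and> norm (int_vec k - 2 ^ j *\<^sub>R x0) < C * 2 ^ j}
         (\<lambda>(i, k). ennreal (2 powr ((u - dim_over TYPE('d) p) * real j) * norm (wcoeff \<psi> f i j k)))) < \<infinity>}"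

section \<open>Wavelet leaders\<close>

definition dyadic_cube :: "nat \<Rightarrow> int ^ 'd \<Rightarrow> (real ^ 'd) set" where
  "dyadic_cube j k = {x. \<forall>a. real_of_int (k $ a) / 2 ^ j \<le> x $ a \<and> x $ a < (real_of_int (k $ a) + 1) / 2 ^ j}"

definition dyadic_cubes :: "nat \<Rightarrow> (real ^ 'd) set set" where
  "dyadic_cubes j = range (dyadic_cube j)"

definition wcube :: "int ^ 'd \<Rightarrow> nat \<Rightarrow> int ^ 'd \<Rightarrow> (real ^ 'd) set" where
  "wcube i j k =
     (+) ((1 / 2 ^ (j + 1)) *\<^sub>R int_vec i + (1 / 2 ^ j) *\<^sub>R int_vec k) `
       {y. \<forall>a. 0 \<le> y $ a \<and> y $ a < 1 / 2 ^ (j + 1)}"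

text \<open>\<open>Q\<close> is a dyadic cube of side length \<open>2\<^sup>-\<^sup>j\<close>.\<close>

definition leader ::
  "(int ^ 'd \<Rightarrow> real ^ 'd \<Rightarrow> complex) \<Rightarrow> ennreal \<Rightarrow> (real ^ 'd \<Rightarrow> complex) \<Rightarrow> nat \<Rightarrow> (real ^ 'd) set \<Rightarrow> ennreal"
where
  "leader \<psi> p f j Q = (SUP j'\<in>{j..}.
     lp_norm p {(i, k). i \<in> wtypes \<and> wcube i j' k \<subseteq> Q}
       (\<lambda>(i, k). ennreal (2 powr ((real j - real j') * dim_over TYPE('d) p) * norm (wcoeff \<psi> f i j' k))))"

definition cube_at :: "nat \<Rightarrow> real ^ 'd \<Rightarrow> (real ^ 'd) set" where
  "cube_at j x0 = (THE Q. Q \<in> dyadic_cubes j \<and> x0 \<in> Q)"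

definition three_cubes :: "nat \<Rightarrow> real ^ 'd \<Rightarrow> (real ^ 'd) set set" where
  "three_cubes j x0 = {Q \<in> dyadic_cubes j. setdist Q (cube_at j x0) = 0}"

definition leader_at ::
  "(int ^ 'd \<Rightarrow> real ^ 'd \<Rightarrow> complex) \<Rightarrow> ennreal \<Rightarrow> (real ^ 'd \<Rightarrow> complex) \<Rightarrow> real ^ 'd \<Rightarrow> nat \<Rightarrow> ennreal"
where
  "leader_at \<psi> p f x0 j = (SUP Q\<in>three_cubes j x0. leader \<psi> p f j Q)"

end

theory Submission
  imports Defs
begin

text \<open>
Near \<open>x0\<close> the function \<open>f\<close> is written as the sum of its layers \<open>F\<^sub>j\<close>, which collect the wavelets of
scale \<open>j\<close>, and of a smooth part carried by the scaling function. Wavelet coefficients are formed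
without complex conjugation, so the expansion runs over the conjugate basis. On the ball of radius
\<open>2 powr (- J)\<close> around \<open>x0\<close> the \<open>m\<close>-th difference, where \<open>m\<close> exceeds the upper Boyd index of
\<open>\<sigma>\<close>, receives three kinds of contributions.

\<^item> For \<open>j < J\<close> the smoothness of the wavelets bounds the difference of \<open>F\<^sub>j\<close> by \<open>2 powr ((j - J) * m)\<close>
  times the leader of scale \<open>j\<close>, up to a constant shift of the scale (\<open>coarse_layer_bound\<close>).
  Passing from \<open>\<sigma> J\<close> to \<open>\<sigma> j\<close> costs less than \<open>2 powr (m * (J - j))\<close>, by a geometric factor (\<open>admissible_growth\<close>). What remains is a convolution
  of the weighted leaders with a summable kernel, to which Young's inequality applies
  (\<open>lp_norm_convolution_le\<close>).
\<^item> For \<open>J \<le> j < K * J\<close> each layer is bounded by the leader of scale \<open>J\<close>, uniformly in \<open>j\<close>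
  (\<open>fine_layer_bound\<close>). There are about \<open>K * J\<close> such layers, and this is what the logarithm
  compensates, because it is at least of order \<open>J\<close> (\<open>logarithm_grows_linearly\<close>).
\<^item> For \<open>j \<ge> K * J\<close> the Xu condition makes the layers decay like \<open>2 powr (- \<eta> * j)\<close>
  (\<open>Xu_layer_decay\<close>). The weight \<open>2 powr (J * d / p) * \<sigma> J\<close> grows at most exponentially in \<open>J\<close>, so
  for large \<open>K\<close> this tail decays geometrically even after multiplication by the weight.

That \<open>f\<close> is almost everywhere near \<open>x0\<close> the sum of its layers needs an argument of its own, since
\<open>f\<close> is only locally integrable and the Xu condition is local. The series converges absolutely by the
Xu condition, and its sum is identified by duality (\<open>expansion_AE\<close>): the layers of a Lipschitz test
function of scale \<open>j\<close> are uniformly \<open>O(2 powr (- j))\<close>, because wavelets have mean zero, so test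
functions are the uniform limits of their expansions, and the expansion can be moved from the test
function to \<open>f\<close>.
\<close>

section \<open>Powers and norms with extended nonnegative values\<close>

lemma ennpowr_mono:
  assumes "0 \<le> r" "x \<le> y"
  shows "ennpowr x r \<le> ennpowr y r"
proof (cases "y = \<infinity>")
  case True
  then show ?thesis by (simp add: ennpowr_def)
next
  case False
  then have "x \<noteq> \<infinity>" using assms(2) by (auto simp: top_unique)
  have "enn2real x powr r \<le> enn2real y powr r"
    using assms False by (intro powr_mono2 enn2real_mono) (auto simp: less_top)
  then show ?thesis using False \<open>x \<noteq> \<infinity>\<close> by (simp add: ennpowr_def ennreal_leI)
qed

lemma ennpowr_top [simp]: "ennpowr \<infinity> r = \<infinity>" "ennpowr top r = top"
  by (simp_all add: ennpowr_def)

lemma ennpowr_ennreal: "0 \<le> x \<Longrightarrow> ennpowr (ennreal x) r = ennreal (x powr r)"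
  by (simp add: ennpowr_def)

lemma ennpowr_ennpowr:
  "ennpowr (ennpowr x r) s = ennpowr x (r * s)"
  by (simp add: ennpowr_def powr_powr)

lemma ennpowr_1 [simp]: "ennpowr x 1 = x"
  by (cases x) (auto simp: ennpowr_def)

lemma ennpowr_0 [simp]: "ennpowr 0 r = 0"
  by (auto simp: ennpowr_def)

text \<open>This adjunction takes the place of continuity of powers: suprema, series and integrals inside
\<open>ennpowr\<close> are only ever compared with an upper bound.\<close>

lemma ennpowr_le_iff:
  assumes "0 < r"
  shows "ennpowr x r \<le> y \<longleftrightarrow> x \<le> ennpowr y (1 / r)"
proof
  assume "ennpowr x r \<le> y"
  from ennpowr_mono[OF _ this, of "1 / r"] assms show "x \<le> ennpowr y (1 / r)"
    by (simp add: ennpowr_ennpowr)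
next
  assume "x \<le> ennpowr y (1 / r)"
  from ennpowr_mono[OF _ this, of r] assms show "ennpowr x r \<le> y"
    by (simp add: ennpowr_ennpowr)
qed

lemma ennpowr_mult:
  assumes "0 < r"
  shows "ennpowr (x * y) r = ennpowr x r * ennpowr y r"
proof (cases "x = 0 \<or> y = 0")
  case True
  then show ?thesis by auto
next
  case False
  then have nz: "ennpowr x r \<noteq> 0" "ennpowr y r \<noteq> 0"
    by (auto simp: ennpowr_def enn2real_eq_0_iff)
  show ?thesis
  proof (cases "x = \<infinity> \<or> y = \<infinity>")
    case True
    then show ?thesis using False nz
      by (auto simp: ennreal_mult_top ennreal_top_mult)
  next
    case False
    then obtain a b where "x = ennreal a" "0 \<le> a" "y = ennreal b" "0 \<le> b"
      by (cases x; cases y) auto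
    then show ?thesis
      by (simp add: ennpowr_ennreal powr_mult flip: ennreal_mult)
  qed
qed

lemma ennpowr_less_top_iff: "ennpowr x r < \<infinity> \<longleftrightarrow> x < \<infinity>"
  by (auto simp: ennpowr_def less_top)

lemma borel_measurable_ennpowr [measurable]:
  assumes [measurable]: "g \<in> borel_measurable M"
  shows "(\<lambda>x. ennpowr (g x) r) \<in> borel_measurable M"
proof -
  have "g -` {\<infinity>} \<inter> space M \<in> sets M" by (rule measurable_sets[OF assms]) simp
  then have "Measurable.pred M (\<lambda>x. g x = \<infinity>)"
    by (simp add: pred_def vimage_def Int_def conj_commute)
  moreover have "(\<lambda>x. ennreal (enn2real (g x) powr r)) \<in> borel_measurable M"
    by measurable
  ultimately show ?thesis
    unfolding ennpowr_def by (intro measurable_If) auto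
qed

lemma convex_on_powr_nonneg:
  assumes "1 \<le> r"
  shows "convex_on {0..} (\<lambda>t::real. t powr r)"
proof (rule convex_onI)
  fix t x y :: real assume t: "0 < t" "t < 1" and xy: "x \<in> {0..}" "y \<in> {0..}"
  have small: "s powr r \<le> s" if "0 < s" "s < 1" for s :: real
    using powr_mono'[of 1 r s] assms that by simp
  show "((1 - t) *\<^sub>R x + t *\<^sub>R y) powr r \<le> (1 - t) * x powr r + t * y powr r"
  proof (cases "x = 0 \<or> y = 0")
    case True
    then show ?thesis
      using small[OF t] small[of "1 - t"] t xy by (auto simp: powr_mult intro!: mult_right_mono)
  next
    case False
    with xy have "x \<in> {0<..}" "y \<in> {0<..}" by auto
    then show ?thesis using convex_onD[OF powr_convex[OF assms], of t x y] t by simp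
  qed
qed simp

text \<open>Convexity of \<open>t powr r\<close> with the weights \<open>B i / sum B A\<close>; since \<open>r - 1 \<ge> 0\<close>, enlarging
\<open>sum B A\<close> to \<open>S\<close> only weakens the bound. With \<open>S\<close> the sum of an infinite series, this is a bound
for all partial sums at once.\<close>

lemma sum_powr_le_weighted:
  fixes x B :: "'i \<Rightarrow> real"
  assumes "finite A" and x: "\<And>i. i \<in> A \<Longrightarrow> 0 \<le> x i" and B: "\<And>i. i \<in> A \<Longrightarrow> 0 < B i"
    and S: "sum B A \<le> S" and "1 \<le> r" and "0 < S"
  shows "(\<Sum>i\<in>A. x i) powr r \<le> (\<Sum>i\<in>A. S powr (r - 1) * B i powr (1 - r) * x i powr r)"
proof (cases "A = {}")
  case True
  then show ?thesis by simp
next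
  case False
  define T where "T = sum B A"
  have T: "0 < T" "T \<le> S"
    unfolding T_def using assms False by (auto intro: sum_pos)
  have "(\<Sum>i\<in>A. (B i / T) *\<^sub>R (x i / B i)) powr r \<le> (\<Sum>i\<in>A. (B i / T) * (x i / B i) powr r)"
  proof (rule convex_on_sum[where C = "{0..}" and f = "\<lambda>t. t powr r"])
    show "convex_on {0..} (\<lambda>t::real. t powr r)"
      using assms(5) by (rule convex_on_powr_nonneg)
    show "(\<Sum>i\<in>A. B i / T) = 1" using T by (simp add: T_def flip: sum_divide_distrib)
    show "finite A" "A \<noteq> {}" by fact+
    show "0 \<le> B i / T" "x i / B i \<in> {0..}" if "i \<in> A" for i
      using x[OF that] B[OF that] T by auto
  qed
  also have "(\<Sum>i\<in>A. (B i / T) *\<^sub>R (x i / B i)) = (\<Sum>i\<in>A. x i) / T"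
    unfolding sum_divide_distrib using B by (intro sum.cong) (auto simp: less_imp_neq[symmetric])
  finally have "((\<Sum>i\<in>A. x i) / T) powr r \<le> (\<Sum>i\<in>A. (B i / T) * (x i / B i) powr r)" .
  then have "T powr r * ((\<Sum>i\<in>A. x i) / T) powr r
      \<le> T powr r * (\<Sum>i\<in>A. (B i / T) * (x i / B i) powr r)"
    by (rule mult_left_mono) simp
  also have "T powr r * ((\<Sum>i\<in>A. x i) / T) powr r = (\<Sum>i\<in>A. x i) powr r"
    using T x by (simp add: powr_divide sum_nonneg)
  also have "T powr r * (\<Sum>i\<in>A. (B i / T) * (x i / B i) powr r)
      = (\<Sum>i\<in>A. T powr (r - 1) * B i powr (1 - r) * x i powr r)"
    unfolding sum_distrib_left
    using T x B abs_of_pos[OF B]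
    by (intro sum.cong) (auto simp: powr_divide powr_diff less_imp_neq[symmetric])
  also have "\<dots> \<le> (\<Sum>i\<in>A. S powr (r - 1) * B i powr (1 - r) * x i powr r)"
    using T assms(5) by (intro sum_mono mult_right_mono powr_mono2) auto
  finally show ?thesis .
qed

text \<open>The common form of \<open>lp_norm\<close> over finite sets (counting measure) and of \<open>Lp_norm\<close> (restricted
Lebesgue measure), so that Minkowski's inequality is proved once for both.\<close>

definition Lnorm :: "ennreal \<Rightarrow> 'a measure \<Rightarrow> ('a \<Rightarrow> ennreal) \<Rightarrow> ennreal" where
  "Lnorm p M g =
     (if p = \<infinity> then esssup M g
      else ennpowr (\<integral>\<^sup>+x. ennpowr (g x) (enn2real p) \<partial>M) (1 / enn2real p))"

lemma enn2real_ge_1: "1 \<le> p \<Longrightarrow> p \<noteq> \<infinity> \<Longrightarrow> 1 \<le> enn2real p"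
  by (metis enn2real_1 enn2real_mono infinity_ennreal_def less_top)

lemma Lnorm_le_iff:
  assumes "1 \<le> p" "g \<in> borel_measurable M"
  shows "Lnorm p M g \<le> K \<longleftrightarrow>
    (if p = \<infinity> then AE x in M. g x \<le> K
     else (\<integral>\<^sup>+x. ennpowr (g x) (enn2real p) \<partial>M) \<le> ennpowr K (enn2real p))"
proof (cases "p = \<infinity>")
  case True
  have "AE x in M. g x \<le> K" if "esssup M g \<le> K"
    using esssup_AE[of g M] by eventually_elim (use that in auto)
  then show ?thesis using True assms by (auto simp: Lnorm_def)
next
  case False
  then show ?thesis using enn2real_ge_1[OF assms(1) False]
    by (simp add: Lnorm_def ennpowr_le_iff)
qed

lemma Lnorm_mono:
  assumes "1 \<le> p" and [measurable]: "g \<in> borel_measurable M" "g' \<in> borel_measurable M"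
    and le: "AE x in M. g x \<le> g' x"
  shows "Lnorm p M g \<le> Lnorm p M g'"
proof -
  have g': "Lnorm p M g' \<le> Lnorm p M g'" ..
  show ?thesis
  proof (cases "p = \<infinity>")
    case True
    have "AE x in M. g' x \<le> Lnorm p M g'"
      using g' True assms(1) unfolding Lnorm_le_iff[OF assms(1,3)] by simp
    with le have "AE x in M. g x \<le> Lnorm p M g'" by eventually_elim auto
    then show ?thesis unfolding Lnorm_le_iff[OF assms(1,2)] using True by simp
  next
    case False
    have "(\<integral>\<^sup>+x. ennpowr (g x) (enn2real p) \<partial>M) \<le> (\<integral>\<^sup>+x. ennpowr (g' x) (enn2real p) \<partial>M)"
      using le by (intro nn_integral_mono_AE) (auto elim!: eventually_mono intro: ennpowr_mono)
    then show ?thesis using False by (simp add: Lnorm_def ennpowr_mono)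
  qed
qed

lemma Lnorm_cmult_le:
  assumes p: "1 \<le> p" and [measurable]: "g \<in> borel_measurable M"
  shows "Lnorm p M (\<lambda>x. c * g x) \<le> c * Lnorm p M g"
proof -
  have g: "Lnorm p M g \<le> Lnorm p M g" ..
  show ?thesis
  proof (cases "p = \<infinity>")
    case True
    have "AE x in M. g x \<le> Lnorm p M g"
      using g True unfolding Lnorm_le_iff[OF p assms(2)] by simp
    then have "AE x in M. c * g x \<le> c * Lnorm p M g"
      by eventually_elim (rule mult_left_mono, auto)
    then show ?thesis using True by (subst Lnorm_le_iff[OF p]) auto
  next
    case False
    then have r: "0 < enn2real p" using enn2real_ge_1[OF p] by force
    have "(\<integral>\<^sup>+x. ennpowr (c * g x) (enn2real p) \<partial>M)
        = ennpowr c (enn2real p) * (\<integral>\<^sup>+x. ennpowr (g x) (enn2real p) \<partial>M)"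
      using r by (simp add: ennpowr_mult nn_integral_cmult)
    then show ?thesis using False r
      by (simp add: Lnorm_def ennpowr_mult ennpowr_ennpowr)
  qed
qed

lemma suminf_ennpowr_le_weighted:
  fixes g :: "nat \<Rightarrow> ennreal" and B :: "nat \<Rightarrow> real"
  assumes B: "\<And>n. 0 < B n" "summable B" and r: "1 \<le> r"
  shows "ennpowr (\<Sum>n. g n) r
    \<le> (\<Sum>n. ennreal (suminf B powr (r - 1) * B n powr (1 - r)) * ennpowr (g n) r)" (is "_ \<le> suminf ?R")
proof (cases "\<exists>n. g n = \<infinity>")
  case True
  then obtain n where n: "g n = \<infinity>" by auto
  have "0 < suminf B" using B by (intro suminf_pos) auto
  then have "?R n = \<infinity>" using n B(1)[of n] by (simp add: ennreal_mult_top)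
  moreover have "?R n \<le> suminf ?R" using sum_le_suminf[of ?R "{n}"] by simp
  ultimately show ?thesis by (simp add: top_unique)
next
  case False
  have S: "0 < suminf B" using B by (intro suminf_pos) auto
  define x where "x n = enn2real (g n)" for n
  have gx: "g n = ennreal (x n)" and x0: "0 \<le> x n" for n
    using False by (auto simp: x_def less_top)
  have "(\<Sum>n<N. g n) \<le> ennpowr (suminf ?R) (1 / r)" for N
  proof -
    have "ennpowr (\<Sum>n<N. g n) r = ennreal ((\<Sum>n<N. x n) powr r)"
      by (simp add: gx x0 ennpowr_ennreal sum_nonneg)
    also have "\<dots> \<le> ennreal (\<Sum>n<N. suminf B powr (r - 1) * B n powr (1 - r) * x n powr r)"
      using B S r x0 by (intro ennreal_leI sum_powr_le_weighted sum_le_suminf)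
        (auto intro: less_imp_le)
    also have "\<dots> = (\<Sum>n<N. ?R n)"
      by (simp add: gx x0 ennpowr_ennreal sum_nonneg flip: ennreal_mult sum_ennreal)
    also have "\<dots> \<le> suminf ?R" by (intro sum_le_suminf) auto
    finally show ?thesis using r by (subst ennpowr_le_iff[symmetric]) auto
  qed
  then have "(\<Sum>n. g n) \<le> ennpowr (suminf ?R) (1 / r)"
    by (intro suminf_le_const) auto
  then show ?thesis using r by (subst ennpowr_le_iff) auto
qed

text \<open>Countable form of Minkowski's inequality. Convexity with weights proportional to upper
  bounds of the individual norms reduces it to exchanging sum and integral.\<close>

lemma Lnorm_suminf_le:
  fixes g :: "nat \<Rightarrow> 'a \<Rightarrow> ennreal"
  assumes p: "1 \<le> p" and g [measurable]: "\<And>n. g n \<in> borel_measurable M"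
  shows "Lnorm p M (\<lambda>x. \<Sum>n. g n x) \<le> (\<Sum>n. Lnorm p M (g n))"
proof (cases "(\<Sum>n. Lnorm p M (g n)) = \<infinity>")
  case True
  then show ?thesis by simp
next
  case fin: False
  define A where "A n = Lnorm p M (g n)" for n
  have A: "Lnorm p M (g n) \<le> A n" for n by (simp add: A_def)
  show ?thesis
  proof (cases "p = \<infinity>")
    case True
    have "AE x in M. g n x \<le> A n" for n
      using A[of n] True unfolding Lnorm_le_iff[OF p g] by simp
    then have "AE x in M. \<forall>n. g n x \<le> A n" by (simp add: AE_all_countable)
    then have "AE x in M. (\<Sum>n. g n x) \<le> (\<Sum>n. A n)"
      by eventually_elim (rule suminf_le, auto)
    then show ?thesis using True unfolding A_def
      by (subst Lnorm_le_iff[OF p]) auto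
  next
    case False
    define r where "r = enn2real p"
    have r: "1 \<le> r" using enn2real_ge_1[OF p False] by (simp add: r_def)
    have Afin: "A n \<noteq> \<infinity>" for n
      using fin sum_le_suminf[of A "{n}"] by (auto simp: A_def[abs_def] top_unique)
    define a where "a n = enn2real (A n)" for n
    have a: "A n = ennreal (a n)" "0 \<le> a n" for n
      using Afin[of n] by (auto simp: a_def less_top)
    have asum: "summable a" "(\<Sum>n. A n) = ennreal (suminf a)"
    proof -
      show "summable a"
        using fin a by (intro summable_suminf_not_top) (auto simp: A_def[symmetric])
      then show "(\<Sum>n. A n) = ennreal (suminf a)"
        using a by (simp add: suminf_ennreal2)
    qed
    show ?thesis unfolding A_def[symmetric]
    proof (rule ennreal_le_epsilon)
      fix e :: real assume e: "0 < e"
      \<comment> \<open>the weights must be positive, while some of the norms may vanish\<close>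
      define B where "B n = a n + e / 2 ^ Suc n" for n
      have es: "(\<lambda>n. e / 2 ^ Suc n) sums e"
        using sums_mult[OF power_half_series, of e] by (simp add: power_one_over divide_simps)
      have B: "0 < B n" for n using a(2)[of n] e by (simp add: B_def add_nonneg_pos)
      have Bs: "summable B" "suminf B = suminf a + e"
        using sums_add[OF summable_sums[OF asum(1)] es]
        by (auto simp: B_def[abs_def] sums_iff)
      have S: "0 < suminf B" using B Bs by (intro suminf_pos) auto
      have gB: "(\<integral>\<^sup>+x. ennpowr (g n x) r \<partial>M) \<le> ennreal (B n powr r)" for n
      proof -
        have "Lnorm p M (g n) \<le> ennreal (B n)"
          using A[of n] e by (simp add: a B_def order_trans ennreal_leI)
        then show ?thesis using False B[of n]
          unfolding Lnorm_le_iff[OF p g] by (simp add: r_def ennpowr_ennreal)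
      qed
      have "(\<integral>\<^sup>+x. ennpowr (\<Sum>n. g n x) r \<partial>M)
          \<le> (\<integral>\<^sup>+x. (\<Sum>n. ennreal (suminf B powr (r - 1) * B n powr (1 - r)) * ennpowr (g n x) r) \<partial>M)"
        using B Bs r by (intro nn_integral_mono suminf_ennpowr_le_weighted) auto
      also have "\<dots> = (\<Sum>n. ennreal (suminf B powr (r - 1) * B n powr (1 - r)) * (\<integral>\<^sup>+x. ennpowr (g n x) r \<partial>M))"
        by (simp add: nn_integral_suminf nn_integral_cmult)
      also have "\<dots> \<le> (\<Sum>n. ennreal (suminf B powr (r - 1) * B n powr (1 - r)) * ennreal (B n powr r))"
        using gB by (intro suminf_le mult_left_mono) auto
      also have "\<dots> = (\<Sum>n. ennreal (suminf B powr (r - 1) * B n))"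
        using abs_of_pos[OF B] by (intro suminf_cong) (simp add: mult.assoc flip: ennreal_mult powr_add)
      also have "\<dots> = ennreal (suminf B powr r)"
      proof -
        have "(\<lambda>n. suminf B powr (r - 1) * B n) sums (suminf B powr (r - 1) * suminf B)"
          using Bs by (intro sums_mult summable_sums)
        moreover have "suminf B powr (r - 1) * suminf B = suminf B powr r"
          using S by (simp add: powr_diff)
        ultimately show ?thesis using B
          using less_imp_le[OF B] by (intro sums_unique[symmetric], subst sums_ennreal) auto
      qed
      finally have "Lnorm p M (\<lambda>x. \<Sum>n. g n x) \<le> ennreal (suminf B)"
        using False S by (subst Lnorm_le_iff[OF p]) (auto simp: r_def ennpowr_ennreal)
      then show "Lnorm p M (\<lambda>x. \<Sum>n. g n x) \<le> (\<Sum>n. A n) + ennreal e"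
        using Bs asum a e by (simp add: suminf_nonneg)
    qed
  qed
qed

lemma Lnorm_sum_le:
  assumes "1 \<le> p" and "finite I" and "\<And>i. i \<in> I \<Longrightarrow> g i \<in> borel_measurable M"
  shows "Lnorm p M (\<lambda>x. \<Sum>i\<in>I. g i x) \<le> (\<Sum>i\<in>I. Lnorm p M (g i))"
proof -
  have zero: "Lnorm p M (\<lambda>x. 0) \<le> 0"
    using assms(1) by (subst Lnorm_le_iff) auto
  obtain n f where f: "bij_betw f {..<n::nat} I"
    using ex_bij_betw_nat_finite[OF assms(2)] by (auto simp: atLeast0LessThan)
  have fI: "k < n \<Longrightarrow> f k \<in> I" for k using f by (auto simp: bij_betw_def)
  have meas: "(\<lambda>x. if k < n then g (f k) x else 0) \<in> borel_measurable M" for k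
    using assms fI by (cases "k < n") auto
  have eq: "(\<lambda>x. \<Sum>i\<in>I. g i x) = (\<lambda>x. \<Sum>k. if k < n then g (f k) x else 0)"
  proof
    fix x
    have "(\<Sum>i\<in>I. g i x) = (\<Sum>k<n. g (f k) x)"
      using sum.reindex_bij_betw[OF f, of "\<lambda>i. g i x"] by simp
    also have "\<dots> = (\<Sum>k. if k < n then g (f k) x else 0)"
      by (subst suminf_finite[of "{..<n}"]) auto
    finally show "(\<Sum>i\<in>I. g i x) = (\<Sum>k. if k < n then g (f k) x else 0)" .
  qed
  have "Lnorm p M (\<lambda>x. \<Sum>i\<in>I. g i x) \<le> (\<Sum>k. Lnorm p M (\<lambda>x. if k < n then g (f k) x else 0))"
    unfolding eq using assms(1) meas by (rule Lnorm_suminf_le)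
  also have "\<dots> = (\<Sum>k<n. Lnorm p M (\<lambda>x. if k < n then g (f k) x else 0))"
    using zero by (intro suminf_finite) auto
  also have "\<dots> = (\<Sum>k<n. Lnorm p M (g (f k)))" by (intro sum.cong) auto
  also have "\<dots> = (\<Sum>i\<in>I. Lnorm p M (g i))"
    using sum.reindex_bij_betw[OF f, of "\<lambda>i. Lnorm p M (g i)"] by simp
  finally show ?thesis .
qed

text \<open>On a finite measure space the elementary bound \<open>t \<le> 1 + t powr r\<close> is enough to pass from a finite
norm to a finite integral.\<close>

lemma Lnorm_finite_imp_nn_integral:
  assumes p: "1 \<le> p" and g: "g \<in> borel_measurable M"
    and M: "emeasure M (space M) < \<infinity>" and fin: "Lnorm p M g < \<infinity>"
  shows "(\<integral>\<^sup>+x. g x \<partial>M) < \<infinity>"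
proof -
  have K: "Lnorm p M g \<le> Lnorm p M g" ..
  show ?thesis
  proof (cases "p = \<infinity>")
    case True
    then have "AE x in M. g x \<le> Lnorm p M g" using iffD1[OF Lnorm_le_iff[OF p g] K] by simp
    then have "(\<integral>\<^sup>+x. g x \<partial>M) \<le> (\<integral>\<^sup>+x. Lnorm p M g \<partial>M)" by (rule nn_integral_mono_AE)
    also have "\<dots> < \<infinity>" using M fin by (simp add: ennreal_mult_less_top)
    finally show ?thesis .
  next
    case False
    define r where "r = enn2real p"
    have r: "1 \<le> r" using enn2real_ge_1[OF p False] by (simp add: r_def)
    have le: "t \<le> 1 + ennpowr t r" for t :: ennreal
    proof (cases t)
      case (real s)
      have "s \<le> 1 + s powr r"
      proof (cases "s \<le> 1")
        case True
        then show ?thesis by (simp add: add_increasing2)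
      next
        case False
        then show ?thesis using powr_mono[OF r, of s] by simp
      qed
      then have "ennreal s \<le> ennreal (1 + s powr r)" by (rule ennreal_leI)
      then show ?thesis using real by (simp add: ennpowr_ennreal)
    qed simp
    have "(\<integral>\<^sup>+x. g x \<partial>M) \<le> (\<integral>\<^sup>+x. 1 + ennpowr (g x) r \<partial>M)" by (intro nn_integral_mono le)
    also have "\<dots> = emeasure M (space M) + (\<integral>\<^sup>+x. ennpowr (g x) r \<partial>M)"
      using g by (subst nn_integral_add) auto
    also have "\<dots> \<le> emeasure M (space M) + ennpowr (Lnorm p M g) r"
      using iffD1[OF Lnorm_le_iff[OF p g] K] False by (intro add_left_mono) (simp add: r_def)
    also have "\<dots> < \<infinity>" using M fin by (simp add: ennpowr_less_top_iff[simplified])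
    finally show ?thesis .
  qed
qed

section \<open>Sequence norms\<close>

lemma lp_norm_le_iff:
  assumes "1 \<le> p"
  shows "lp_norm p I a \<le> K \<longleftrightarrow>
    (if p = \<infinity> then \<forall>i\<in>I. a i \<le> K
     else \<forall>F. finite F \<and> F \<subseteq> I \<longrightarrow> (\<Sum>i\<in>F. ennpowr (a i) (enn2real p)) \<le> ennpowr K (enn2real p))"
proof (cases "p = \<infinity>")
  case True
  then show ?thesis by (simp add: lp_norm_def SUP_le_iff)
next
  case False
  have "(\<Sum>\<^sub>\<infinity>i\<in>I. ennpowr (a i) (enn2real p)) =
      (SUP F\<in>{F. finite F \<and> F \<subseteq> I}. \<Sum>i\<in>F. ennpowr (a i) (enn2real p))"
    by (rule nonneg_infsum_complete) simp
  then show ?thesis using False enn2real_ge_1[OF assms False]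
    by (simp add: lp_norm_def ennpowr_le_iff SUP_le_iff)
qed

lemma lp_norm_mono:
  assumes p: "1 \<le> p" and "I \<subseteq> I'" "\<And>i. i \<in> I \<Longrightarrow> a i \<le> a' i"
  shows "lp_norm p I a \<le> lp_norm p I' a'"
proof -
  have K: "lp_norm p I' a' \<le> lp_norm p I' a'" ..
  show ?thesis
  proof (cases "p = \<infinity>")
    case True
    then show ?thesis using K assms(2,3) unfolding lp_norm_le_iff[OF p]
      by (auto intro: order_trans)
  next
    case False
    have "(\<Sum>i\<in>F. ennpowr (a i) (enn2real p)) \<le> ennpowr (lp_norm p I' a') (enn2real p)"
      if F: "finite F" "F \<subseteq> I" for F
    proof -
      have "(\<Sum>i\<in>F. ennpowr (a i) (enn2real p)) \<le> (\<Sum>i\<in>F. ennpowr (a' i) (enn2real p))"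
        using F assms(3) by (intro sum_mono ennpowr_mono) auto
      also have "\<dots> \<le> ennpowr (lp_norm p I' a') (enn2real p)"
        using K F assms(2) False unfolding lp_norm_le_iff[OF p] by auto
      finally show ?thesis .
    qed
    then show ?thesis using False unfolding lp_norm_le_iff[OF p, of I] by auto
  qed
qed

text \<open>Norms of infinite families are controlled through finite subfamilies, for which
\<open>lp_norm_eq_Lnorm\<close> makes the inequalities for \<open>Lnorm\<close> available.\<close>

lemma lp_norm_leI_finite:
  assumes p: "1 \<le> p" and "\<And>F. finite F \<Longrightarrow> F \<subseteq> I \<Longrightarrow> lp_norm p F a \<le> K"
  shows "lp_norm p I a \<le> K"
proof (cases "p = \<infinity>")
  case True
  have "a i \<le> K" if "i \<in> I" for i
    using assms(2)[of "{i}"] that True unfolding lp_norm_le_iff[OF p] by auto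
  then show ?thesis using True unfolding lp_norm_le_iff[OF p] by auto
next
  case False
  then show ?thesis using assms(2) unfolding lp_norm_le_iff[OF p] by auto
qed

lemma lp_norm_elem:
  assumes p: "1 \<le> p" and "i \<in> I"
  shows "a i \<le> lp_norm p I a"
proof -
  have "a i = lp_norm p {i} a"
    using enn2real_ge_1[OF p] by (auto simp: lp_norm_def ennpowr_ennpowr)
  also have "\<dots> \<le> lp_norm p I a" using assms by (intro lp_norm_mono) auto
  finally show ?thesis .
qed

lemma lp_norm_eq_Lnorm:
  assumes p: "1 \<le> p" and F: "finite F"
  shows "lp_norm p F a = Lnorm p (count_space F) a"
proof (rule antisym)
  have L: "Lnorm p (count_space F) a \<le> Lnorm p (count_space F) a" ..
  have l: "lp_norm p F a \<le> lp_norm p F a" ..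
  have eq: "(\<integral>\<^sup>+x. ennpowr (a x) (enn2real p) \<partial>count_space F) = (\<Sum>i\<in>F. ennpowr (a i) (enn2real p))"
    using F by (simp add: nn_integral_count_space_finite)
  have mono: "(\<Sum>i\<in>G. ennpowr (a i) (enn2real p)) \<le> (\<Sum>i\<in>F. ennpowr (a i) (enn2real p))" if "G \<subseteq> F" for G
    using F that by (intro sum_mono2) auto
  show "lp_norm p F a \<le> Lnorm p (count_space F) a"
  proof (cases "p = \<infinity>")
    case True
    have "\<forall>i\<in>F. a i \<le> Lnorm p (count_space F) a"
      using iffD1[OF Lnorm_le_iff[OF p] L] True by (simp add: AE_count_space)
    then show ?thesis using True unfolding lp_norm_le_iff[OF p] by simp
  next
    case False
    then have "(\<Sum>i\<in>F. ennpowr (a i) (enn2real p)) \<le> ennpowr (Lnorm p (count_space F) a) (enn2real p)"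
      using iffD1[OF Lnorm_le_iff[OF p] L] eq by simp
    then show ?thesis using False mono unfolding lp_norm_le_iff[OF p] by (auto intro: order_trans)
  qed
  show "Lnorm p (count_space F) a \<le> lp_norm p F a"
  proof (cases "p = \<infinity>")
    case True
    then have "\<forall>i\<in>F. a i \<le> lp_norm p F a" using iffD1[OF lp_norm_le_iff[OF p] l] by simp
    then show ?thesis using True by (subst Lnorm_le_iff[OF p]) (auto simp: AE_count_space)
  next
    case False
    then have "(\<Sum>i\<in>F. ennpowr (a i) (enn2real p)) \<le> ennpowr (lp_norm p F a) (enn2real p)"
      using iffD1[OF lp_norm_le_iff[OF p] l] F by simp
    then show ?thesis using False by (subst Lnorm_le_iff[OF p]) (auto simp: eq)
  qed
qed

lemma lp_norm_cmult_le:
  assumes p: "1 \<le> p"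
  shows "lp_norm p I (\<lambda>i. c * a i) \<le> c * lp_norm p I a"
proof (rule lp_norm_leI_finite[OF p])
  fix F assume F: "finite F" "F \<subseteq> I"
  have "lp_norm p F (\<lambda>i. c * a i) \<le> c * lp_norm p F a"
    using Lnorm_cmult_le[OF p, of a "count_space F" c] F by (simp add: lp_norm_eq_Lnorm[OF p])
  also have "\<dots> \<le> c * lp_norm p I a"
    using F by (intro mult_left_mono lp_norm_mono[OF p]) auto
  finally show "lp_norm p F (\<lambda>i. c * a i) \<le> c * lp_norm p I a" .
qed

text \<open>On \<open>S\<close>, the family is dominated by the sum of its restrictions to the sets \<open>I k\<close>, and Minkowski's
inequality applies to the latter.\<close>

lemma lp_norm_cover:
  assumes p: "1 \<le> p" and "finite K" "finite S" "S \<subseteq> (\<Union>k\<in>K. I k)"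
  shows "lp_norm p S a \<le> (\<Sum>k\<in>K. lp_norm p (I k) a)"
proof -
  have "lp_norm p S a \<le> lp_norm p S (\<lambda>i. \<Sum>k\<in>K. if i \<in> I k then a i else 0)"
  proof (rule lp_norm_mono[OF p])
    fix i assume "i \<in> S"
    then obtain k where k: "k \<in> K" "i \<in> I k" using assms(4) by auto
    then show "a i \<le> (\<Sum>k\<in>K. if i \<in> I k then a i else 0)"
      using member_le_sum[of k K "\<lambda>k. if i \<in> I k then a i else 0"] assms(2) by simp
  qed simp
  also have "\<dots> \<le> (\<Sum>k\<in>K. lp_norm p S (\<lambda>i. if i \<in> I k then a i else 0))"
    using Lnorm_sum_le[OF p assms(2), of "\<lambda>k i. if i \<in> I k then a i else 0" "count_space S"] assms(3)
    by (simp add: lp_norm_eq_Lnorm[OF p])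
  also have "\<dots> \<le> (\<Sum>k\<in>K. lp_norm p (I k) a)"
  proof (rule sum_mono)
    fix k
    have r: "0 \<le> enn2real p" by simp
    have K: "lp_norm p (I k) a \<le> lp_norm p (I k) a" ..
    have "(\<Sum>i\<in>F. ennpowr (if i \<in> I k then a i else 0) (enn2real p))
        = (\<Sum>i\<in>F \<inter> I k. ennpowr (a i) (enn2real p))" if "finite F" for F
      using that by (intro sum.mono_neutral_cong_right) auto
    then show "lp_norm p S (\<lambda>i. if i \<in> I k then a i else 0) \<le> lp_norm p (I k) a"
      using K unfolding lp_norm_le_iff[OF p] by (auto split: if_splits)
  qed
  finally show ?thesis .
qed

lemma lp_norm_add_le:
  assumes q: "1 \<le> q"
  shows "lp_norm q I (\<lambda>i. a i + b i) \<le> lp_norm q I a + lp_norm q I b"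
proof (rule lp_norm_leI_finite[OF q])
  fix F assume F: "finite F" "F \<subseteq> I"
  have "lp_norm q F (\<lambda>i. a i + b i) = Lnorm q (count_space F) (\<lambda>i. \<Sum>c\<in>{True, False}. if c then a i else b i)"
    using F by (simp add: lp_norm_eq_Lnorm[OF q])
  also have "\<dots> \<le> (\<Sum>c\<in>{True, False}. Lnorm q (count_space F) (\<lambda>i. if c then a i else b i))"
    by (rule Lnorm_sum_le[OF q]) auto
  also have "\<dots> = lp_norm q F a + lp_norm q F b" using F by (simp add: lp_norm_eq_Lnorm[OF q])
  also have "\<dots> \<le> lp_norm q I a + lp_norm q I b" using F by (intro add_mono lp_norm_mono[OF q]) auto
  finally show "lp_norm q F (\<lambda>i. a i + b i) \<le> lp_norm q I a + lp_norm q I b" .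
qed

lemma lp_norm_unit_le:
  assumes q: "1 \<le> q"
  shows "lp_norm q I (\<lambda>i. if i = i0 then 1 else 0) \<le> 1"
proof -
  have one: "ennpowr 1 r = 1" for r by (simp add: ennpowr_def)
  have "(\<Sum>i\<in>F. ennpowr (if i = i0 then 1 else 0) (enn2real q)) \<le> 1" if "finite F" for F
  proof -
    have "(\<Sum>i\<in>F. ennpowr (if i = i0 then 1 else 0) (enn2real q)) = (\<Sum>i\<in>F. if i = i0 then 1 else 0)"
      by (intro sum.cong) (auto simp: one)
    also have "\<dots> \<le> 1" using that by simp
    finally show ?thesis .
  qed
  then show ?thesis unfolding lp_norm_le_iff[OF q] by (auto simp: one)
qed

text \<open>Young's inequality for convolution with a summable one-sided kernel: a convolution is a
  superposition of shifts, and shifting does not increase the norm.\<close>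

lemma lp_norm_convolution_le:
  fixes \<kappa> \<tau> :: "nat \<Rightarrow> ennreal"
  assumes q: "1 \<le> q"
  shows "lp_norm q UNIV (\<lambda>J. \<Sum>n\<le>J. \<kappa> (J - n) * \<tau> n) \<le> (\<Sum>l. \<kappa> l) * lp_norm q UNIV \<tau>"
proof (rule lp_norm_leI_finite[OF q])
  fix F :: "nat set" assume F: "finite F"
  define s where "s l J = (if l \<le> J then \<tau> (J - l) else 0)" for l J
  have "(\<Sum>n\<le>J. \<kappa> (J - n) * \<tau> n) = (\<Sum>l. \<kappa> l * s l J)" for J
  proof -
    have "(\<Sum>n\<le>J. \<kappa> (J - n) * \<tau> n) = (\<Sum>l\<le>J. \<kappa> l * \<tau> (J - l))"
      by (rule sum.reindex_bij_witness[of _ "\<lambda>l. J - l" "\<lambda>n. J - n"]) auto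
    also have "\<dots> = (\<Sum>l\<le>J. \<kappa> l * s l J)" by (simp add: s_def)
    also have "\<dots> = (\<Sum>l. \<kappa> l * s l J)" by (rule suminf_finite[symmetric]) (auto simp: s_def)
    finally show ?thesis .
  qed
  then have "lp_norm q F (\<lambda>J. \<Sum>n\<le>J. \<kappa> (J - n) * \<tau> n) = Lnorm q (count_space F) (\<lambda>J. \<Sum>l. \<kappa> l * s l J)"
    using F by (simp add: lp_norm_eq_Lnorm[OF q])
  also have "\<dots> \<le> (\<Sum>l. Lnorm q (count_space F) (\<lambda>J. \<kappa> l * s l J))"
    by (rule Lnorm_suminf_le[OF q]) simp
  also have "\<dots> \<le> (\<Sum>l. \<kappa> l * lp_norm q UNIV \<tau>)"
  proof (rule suminf_le)
    fix l
    have shift: "lp_norm q F (s l) \<le> lp_norm q UNIV \<tau>"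
    proof -
      have K: "lp_norm q UNIV \<tau> \<le> lp_norm q UNIV \<tau>" ..
      have "(\<Sum>J\<in>G. ennpowr (s l J) (enn2real q))
          = (\<Sum>n\<in>(\<lambda>J. J - l) ` (G \<inter> {l..}). ennpowr (\<tau> n) (enn2real q))" if "finite G" for G
      proof -
        have "(\<Sum>J\<in>G. ennpowr (s l J) (enn2real q)) = (\<Sum>J\<in>G \<inter> {l..}. ennpowr (\<tau> (J - l)) (enn2real q))"
          using that by (intro sum.mono_neutral_cong_right) (auto simp: s_def)
        also have "\<dots> = (\<Sum>n\<in>(\<lambda>J. J - l) ` (G \<inter> {l..}). ennpowr (\<tau> n) (enn2real q))"
          by (subst sum.reindex) (auto simp: inj_on_def)
        finally show ?thesis .
      qed
      moreover have "(\<Sum>n\<in>(\<lambda>J. J - l) ` (G \<inter> {l..}). ennpowr (\<tau> n) (enn2real q))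
          \<le> ennpowr (lp_norm q UNIV \<tau>) (enn2real q)" if "finite G" "q \<noteq> \<infinity>" for G
        using K that unfolding lp_norm_le_iff[OF q] by auto
      ultimately show ?thesis using K
        unfolding lp_norm_le_iff[OF q, of F] by (auto simp: s_def intro: lp_norm_elem q)
    qed
    have "Lnorm q (count_space F) (\<lambda>J. \<kappa> l * s l J) \<le> \<kappa> l * lp_norm q F (s l)"
      using Lnorm_cmult_le[OF q, of "s l" "count_space F" "\<kappa> l"] F by (simp add: lp_norm_eq_Lnorm[OF q])
    also have "\<dots> \<le> \<kappa> l * lp_norm q UNIV \<tau>" by (intro mult_left_mono shift) simp
    finally show "Lnorm q (count_space F) (\<lambda>J. \<kappa> l * s l J) \<le> \<kappa> l * lp_norm q UNIV \<tau>" .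
  qed auto
  also have "\<dots> = (\<Sum>l. \<kappa> l) * lp_norm q UNIV \<tau>" by simp
  finally show "lp_norm q F (\<lambda>J. \<Sum>n\<le>J. \<kappa> (J - n) * \<tau> n) \<le> (\<Sum>l. \<kappa> l) * lp_norm q UNIV \<tau>" .
qed

section \<open>Lebesgue norms of functions\<close>

text \<open>For \<open>p = \<infinity>\<close> both sides vanish because \<open>enn2real \<infinity> = 0\<close>; this lets the exponent \<open>1 / enn2real p\<close>
be used for all \<open>p\<close>.\<close>

lemma dim_over_eq:
  assumes "1 \<le> p"
  shows "dim_over TYPE('d::finite) p = real CARD('d) * (1 / enn2real p)"
proof (cases "p = \<infinity>")
  case True
  then show ?thesis by (simp add: dim_over_def)
next
  case False
  then obtain r where r: "p = ennreal r" "1 \<le> r"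
    using assms by (cases p) (auto simp: ennreal_1[symmetric] simp del: ennreal_1)
  then have "of_nat CARD('d) / p = ennreal (real CARD('d) / r)"
    by (simp add: ennreal_of_nat_eq_real_of_nat divide_ennreal)
  then show ?thesis using r by (simp add: dim_over_def)
qed

lemma Lp_norm_eq_Lnorm: "Lp_norm p A f = Lnorm p (lebesgue_on A) (\<lambda>x. ennreal (norm (f x)))"
  by (simp add: Lp_norm_def Lnorm_def)

lemma borel_measurable_ennreal_norm_on:
  fixes f :: "'a::euclidean_space \<Rightarrow> 'b::{second_countable_topology,real_normed_vector}"
  assumes "f \<in> borel_measurable lebesgue"
  shows "(\<lambda>x. ennreal (norm (f x))) \<in> borel_measurable (lebesgue_on A)"
  using assms by (intro measurable_restrict_space1) measurable

text \<open>Most properties of \<open>Lp_norm\<close> below follow from this description of its upper bounds, which refers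
to Lebesgue measure on the whole space.\<close>

lemma Lp_norm_le_iff:
  fixes f :: "real ^ 'd \<Rightarrow> complex"
  assumes "1 \<le> p" "A \<in> sets lebesgue" "f \<in> borel_measurable lebesgue"
  shows "Lp_norm p A f \<le> K \<longleftrightarrow>
    (if p = \<infinity> then AE x in lebesgue. x \<in> A \<longrightarrow> ennreal (norm (f x)) \<le> K
     else (\<integral>\<^sup>+x. ennreal (norm (f x) powr enn2real p) * indicator A x \<partial>lebesgue)
       \<le> ennpowr K (enn2real p))"
  using assms unfolding Lp_norm_eq_Lnorm
  by (subst Lnorm_le_iff[OF assms(1) borel_measurable_ennreal_norm_on[OF assms(3)]])
    (auto simp: AE_restrict_space_iff nn_integral_restrict_space ennpowr_ennreal)

lemma Lp_norm_mono:
  fixes f g :: "real ^ 'd \<Rightarrow> complex"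
  assumes p: "1 \<le> p" and A: "A \<in> sets lebesgue" "B \<in> sets lebesgue" "A \<subseteq> B"
    and f: "f \<in> borel_measurable lebesgue" "g \<in> borel_measurable lebesgue"
    and le: "AE x in lebesgue. x \<in> A \<longrightarrow> norm (f x) \<le> norm (g x)"
  shows "Lp_norm p A f \<le> Lp_norm p B g"
proof -
  have K: "Lp_norm p B g \<le> Lp_norm p B g" ..
  show ?thesis
  proof (cases "p = \<infinity>")
    case True
    have "AE x in lebesgue. x \<in> B \<longrightarrow> ennreal (norm (g x)) \<le> Lp_norm p B g"
      using iffD1[OF Lp_norm_le_iff[OF p A(2) f(2)] K] True by simp
    with le have "AE x in lebesgue. x \<in> A \<longrightarrow> ennreal (norm (f x)) \<le> Lp_norm p B g"
      by eventually_elim (use A(3) in \<open>auto intro: order_trans ennreal_leI\<close>)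
    then show ?thesis using True unfolding Lp_norm_le_iff[OF p A(1) f(1)] by simp
  next
    case False
    have "(\<integral>\<^sup>+x. ennreal (norm (f x) powr enn2real p) * indicator A x \<partial>lebesgue)
       \<le> (\<integral>\<^sup>+x. ennreal (norm (g x) powr enn2real p) * indicator B x \<partial>lebesgue)"
      using le A(3) by (intro nn_integral_mono_AE)
        (auto elim!: eventually_mono simp: indicator_def intro!: ennreal_leI powr_mono2)
    also have "\<dots> \<le> ennpowr (Lp_norm p B g) (enn2real p)"
      using iffD1[OF Lp_norm_le_iff[OF p A(2) f(2)] K] False by simp
    finally show ?thesis using False unfolding Lp_norm_le_iff[OF p A(1) f(1)] by simp
  qed
qed

lemma Lp_norm_le_suminf:
  fixes f :: "real ^ 'd \<Rightarrow> complex"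
  assumes p: "1 \<le> p" and A: "A \<in> sets lebesgue"
    and f: "f \<in> borel_measurable lebesgue" "\<And>n. g n \<in> borel_measurable lebesgue"
    and le: "AE x in lebesgue. x \<in> A \<longrightarrow> ennreal (norm (f x)) \<le> (\<Sum>n. ennreal (norm (g n x)))"
  shows "Lp_norm p A f \<le> (\<Sum>n. Lp_norm p A (g n))"
proof -
  have "Lp_norm p A f \<le> Lnorm p (lebesgue_on A) (\<lambda>x. \<Sum>n. ennreal (norm (g n x)))"
    unfolding Lp_norm_eq_Lnorm using p A f le
    by (intro Lnorm_mono borel_measurable_suminf_order borel_measurable_ennreal_norm_on)
      (auto simp: AE_restrict_space_iff)
  also have "\<dots> \<le> (\<Sum>n. Lp_norm p A (g n))"
    unfolding Lp_norm_eq_Lnorm using p f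
    by (intro Lnorm_suminf_le borel_measurable_ennreal_norm_on)
  finally show ?thesis .
qed

lemma Lp_norm_le_sum:
  fixes f :: "real ^ 'd \<Rightarrow> complex"
  assumes p: "1 \<le> p" and A: "A \<in> sets lebesgue" and "finite I"
    and f: "f \<in> borel_measurable lebesgue" "\<And>n. n \<in> I \<Longrightarrow> g n \<in> borel_measurable lebesgue"
    and le: "AE x in lebesgue. x \<in> A \<longrightarrow> norm (f x) \<le> (\<Sum>n\<in>I. norm (g n x))"
  shows "Lp_norm p A f \<le> (\<Sum>n\<in>I. Lp_norm p A (g n))"
proof -
  have "Lp_norm p A f \<le> Lnorm p (lebesgue_on A) (\<lambda>x. \<Sum>n\<in>I. ennreal (norm (g n x)))"
    unfolding Lp_norm_eq_Lnorm using p A f le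
    by (intro Lnorm_mono borel_measurable_sum borel_measurable_ennreal_norm_on)
      (auto simp: AE_restrict_space_iff elim!: eventually_mono intro!: ennreal_leI)
  also have "\<dots> \<le> (\<Sum>n\<in>I. Lp_norm p A (g n))"
    unfolding Lp_norm_eq_Lnorm using p f assms(3)
    by (intro Lnorm_sum_le borel_measurable_ennreal_norm_on) auto
  finally show ?thesis .
qed

lemma Lp_norm_add_le:
  fixes f g h :: "real ^ 'd \<Rightarrow> complex"
  assumes p: "1 \<le> p" and A: "A \<in> sets lebesgue"
    and f: "f \<in> borel_measurable lebesgue" "g \<in> borel_measurable lebesgue" "h \<in> borel_measurable lebesgue"
    and le: "\<And>x. x \<in> A \<Longrightarrow> norm (f x) \<le> norm (g x) + norm (h x)"
  shows "Lp_norm p A f \<le> Lp_norm p A g + Lp_norm p A h"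
proof -
  let ?F = "\<lambda>b x. if b then g x else h x"
  have "Lp_norm p A f \<le> (\<Sum>b\<in>{True, False}. Lp_norm p A (?F b))"
    using f le by (intro Lp_norm_le_sum[OF p A]) auto
  then show ?thesis by simp
qed

text \<open>For \<open>p = \<infinity>\<close> the factor \<open>v powr (1 / enn2real p)\<close> equals \<open>v powr 0 = 1\<close>.\<close>

lemma Lp_norm_bounded:
  fixes f :: "real ^ 'd \<Rightarrow> complex"
  assumes p: "1 \<le> p" and A: "A \<in> sets lebesgue" "f \<in> borel_measurable lebesgue"
    and le: "\<And>x. x \<in> A \<Longrightarrow> norm (f x) \<le> c"
    and v: "emeasure lebesgue A \<le> ennreal v" "0 < v" and "0 \<le> c"
  shows "Lp_norm p A f \<le> ennreal (c * v powr (1 / enn2real p))"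
proof (cases "p = \<infinity>")
  case True
  then show ?thesis using v le by (subst Lp_norm_le_iff[OF p A]) (auto intro: ennreal_leI)
next
  case False
  define r where "r = enn2real p"
  have r: "1 \<le> r" using enn2real_ge_1[OF p False] by (simp add: r_def)
  have "(\<integral>\<^sup>+x. ennreal (norm (f x) powr r) * indicator A x \<partial>lebesgue)
     \<le> (\<integral>\<^sup>+x. ennreal (c powr r) * indicator A x \<partial>lebesgue)"
    using le r by (intro nn_integral_mono) (auto simp: indicator_def intro!: ennreal_leI powr_mono2)
  also have "\<dots> = ennreal (c powr r) * emeasure lebesgue A" using A by (simp add: nn_integral_cmult)
  also have "\<dots> \<le> ennreal (c powr r) * ennreal v" using v by (intro mult_left_mono) auto
  also have "\<dots> = ennpowr (ennreal (c * v powr (1 / r))) r"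
    using v r assms(7) by (simp add: ennpowr_ennreal powr_mult powr_powr flip: ennreal_mult)
  finally show ?thesis using False by (subst Lp_norm_le_iff[OF p A]) (auto simp: r_def)
qed

lemma nn_integral_lebesgue_affine:
  fixes f :: "'a::euclidean_space \<Rightarrow> ennreal"
  assumes f: "f \<in> borel_measurable lebesgue" and c: "c \<noteq> 0"
  shows "(\<integral>\<^sup>+x. f x \<partial>lebesgue) = ennreal (\<bar>c\<bar> ^ DIM('a)) * (\<integral>\<^sup>+x. f (t + c *\<^sub>R x) \<partial>lebesgue)"
    and "(\<lambda>x. t + c *\<^sub>R x) \<in> lebesgue \<rightarrow>\<^sub>M lebesgue"
    and "lebesgue = density (distr lebesgue lebesgue (\<lambda>x::'a. t + c *\<^sub>R x)) (\<lambda>_. ennreal (\<bar>c\<bar> ^ DIM('a)))"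
proof -
  have T: "(\<lambda>x. t + (\<Sum>j\<in>Basis. (c * (x \<bullet> j)) *\<^sub>R j)) = (\<lambda>x::'a. t + c *\<^sub>R x)"
    by (auto simp: scaleR_sum_right[symmetric] euclidean_representation simp flip: scaleR_scaleR)
  show m: "(\<lambda>x. t + c *\<^sub>R x) \<in> lebesgue \<rightarrow>\<^sub>M lebesgue"
    using lebesgue_affine_measurable[of "\<lambda>_. c" t] c unfolding T by simp
  show D: "lebesgue = density (distr lebesgue lebesgue (\<lambda>x::'a. t + c *\<^sub>R x)) (\<lambda>_. ennreal (\<bar>c\<bar> ^ DIM('a)))"
    using lebesgue_affine_euclidean[of "\<lambda>_. c" t] c unfolding T by simp
  have "(\<integral>\<^sup>+x. f x \<partial>lebesgue) = (\<integral>\<^sup>+x. f x \<partial>density (distr lebesgue lebesgue (\<lambda>x. t + c *\<^sub>R x)) (\<lambda>_. ennreal (\<bar>c\<bar> ^ DIM('a))))"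
    using D by simp
  also have "\<dots> = ennreal (\<bar>c\<bar> ^ DIM('a)) * (\<integral>\<^sup>+x. f (t + c *\<^sub>R x) \<partial>lebesgue)"
    using f m by (simp add: nn_integral_density nn_integral_distr nn_integral_cmult measurable_compose[OF m f])
  finally show "(\<integral>\<^sup>+x. f x \<partial>lebesgue) = ennreal (\<bar>c\<bar> ^ DIM('a)) * (\<integral>\<^sup>+x. f (t + c *\<^sub>R x) \<partial>lebesgue)" .
qed

lemma integral_lebesgue_affine:
  fixes f :: "'a::euclidean_space \<Rightarrow> complex"
  assumes f: "f \<in> borel_measurable lebesgue" and c: "0 < c"
  shows "(LINT x|lebesgue. f (c *\<^sub>R x - t)) = (1 / c ^ DIM('a)) *\<^sub>R (LINT x|lebesgue. f x)"
proof -
  have m: "(\<lambda>x. - t + c *\<^sub>R x) \<in> lebesgue \<rightarrow>\<^sub>M (lebesgue :: 'a measure)"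
    using nn_integral_lebesgue_affine(2)[of "\<lambda>_. 0" c "- t"] c by simp
  have D: "lebesgue = density (distr lebesgue lebesgue (\<lambda>x::'a. - t + c *\<^sub>R x)) (\<lambda>_. ennreal (\<bar>c\<bar> ^ DIM('a)))"
    using nn_integral_lebesgue_affine(3)[of "\<lambda>_. 0" c "- t"] c by simp
  have "(LINT x|lebesgue. f x) = (LINT x|density (distr lebesgue lebesgue (\<lambda>x. - t + c *\<^sub>R x)) (\<lambda>_. ennreal (\<bar>c\<bar> ^ DIM('a))). f x)"
    using D by simp
  also have "\<dots> = (LINT x|lebesgue. (c ^ DIM('a)) *\<^sub>R f (- t + c *\<^sub>R x))"
    using f m c by (subst integral_density, simp, simp, simp, subst integral_distr) auto
  finally show ?thesis using c by simp
qed

lemma AE_lebesgue_translate: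
  fixes h :: "'a::euclidean_space"
  assumes "AE x in lebesgue. P x"
  shows "AE x in lebesgue. P (x + h)"
proof -
  have m: "(\<lambda>x. h + 1 *\<^sub>R x) \<in> lebesgue \<rightarrow>\<^sub>M (lebesgue :: 'a measure)"
    using nn_integral_lebesgue_affine(2)[of "\<lambda>_. 0" 1 h] by simp
  have D: "lebesgue = density (distr lebesgue lebesgue (\<lambda>x::'a. h + 1 *\<^sub>R x)) (\<lambda>_. ennreal (\<bar>1\<bar> ^ DIM('a)))"
    using nn_integral_lebesgue_affine(3)[of "\<lambda>_. 0" 1 h] by simp
  have D: "distr lebesgue lebesgue (\<lambda>x::'a. h + 1 *\<^sub>R x) = lebesgue"
    by (subst (3) D) (simp add: density_1)
  have "AE x in distr lebesgue lebesgue (\<lambda>x::'a. h + 1 *\<^sub>R x). P x" unfolding D using assms .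
  from AE_distrD[OF m this] show ?thesis by (simp add: add.commute)
qed

lemma Lp_norm_translate:
  fixes f :: "real ^ 'd \<Rightarrow> complex"
  assumes p: "1 \<le> p" and A: "A \<in> sets lebesgue" "B \<in> sets lebesgue" and AB: "\<And>x. x \<in> A \<Longrightarrow> x + h \<in> B"
    and f: "f \<in> borel_measurable lebesgue"
  shows "(\<lambda>x. f (x + h)) \<in> borel_measurable lebesgue" (is ?m)
    and "Lp_norm p A (\<lambda>x. f (x + h)) \<le> Lp_norm p B f" (is ?le)
proof -
  have m: "(\<lambda>x. x + h) \<in> lebesgue \<rightarrow>\<^sub>M (lebesgue :: (real ^ 'd) measure)"
    using nn_integral_lebesgue_affine(2)[of "\<lambda>_. 0" 1 h] by (simp add: add.commute)
  show ?m using measurable_compose[OF m f] .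
  note fm = this
  have K: "Lp_norm p B f \<le> Lp_norm p B f" ..
  show ?le
  proof (cases "p = \<infinity>")
    case True
    have "AE x in lebesgue. x \<in> B \<longrightarrow> ennreal (norm (f x)) \<le> Lp_norm p B f"
      using iffD1[OF Lp_norm_le_iff[OF p A(2) f] K] True by simp
    from AE_lebesgue_translate[OF this, of h]
    have "AE x in lebesgue. x \<in> A \<longrightarrow> ennreal (norm (f (x + h))) \<le> Lp_norm p B f"
      by eventually_elim (use AB in auto)
    then show ?thesis using True unfolding Lp_norm_le_iff[OF p A(1) fm] by simp
  next
    case False
    have g: "(\<lambda>x. ennreal (norm (f x) powr enn2real p) * indicator B x) \<in> borel_measurable lebesgue"
      using A(2) f by measurable
    have "(\<integral>\<^sup>+x. ennreal (norm (f (x + h)) powr enn2real p) * indicator A x \<partial>lebesgue)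
        \<le> (\<integral>\<^sup>+x. ennreal (norm (f (x + h)) powr enn2real p) * indicator B (x + h) \<partial>lebesgue)"
      using AB by (intro nn_integral_mono) (auto simp: indicator_def)
    also have "\<dots> = (\<integral>\<^sup>+x. ennreal (norm (f x) powr enn2real p) * indicator B x \<partial>lebesgue)"
      using nn_integral_lebesgue_affine(1)[OF g, of 1 h] by (simp add: add.commute)
    also have "\<dots> \<le> ennpowr (Lp_norm p B f) (enn2real p)"
      using iffD1[OF Lp_norm_le_iff[OF p A(2) f] K] False by simp
    finally show ?thesis using False unfolding Lp_norm_le_iff[OF p A(1) fm] by simp
  qed
qed

lemma Lp_norm_finite_imp_integrable:
  fixes f :: "real ^ 'd \<Rightarrow> complex"
  assumes p: "1 \<le> p" and A: "A \<in> lmeasurable" and f: "f \<in> borel_measurable lebesgue"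
    and fin: "Lp_norm p A f < \<infinity>"
  shows "integrable lebesgue (\<lambda>x. indicator A x *\<^sub>R f x)"
proof (rule integrableI_bounded)
  have As: "A \<in> sets lebesgue" using A by blast
  show "(\<lambda>x. indicator A x *\<^sub>R f x) \<in> borel_measurable lebesgue" using As f by measurable
  have "emeasure (lebesgue_on A) (space (lebesgue_on A)) < \<infinity>"
    using finite_measure.emeasure_finite[OF finite_measure_lebesgue_on[OF A]] by (simp add: less_top)
  then have "(\<integral>\<^sup>+x. ennreal (norm (f x)) \<partial>lebesgue_on A) < \<infinity>"
    using fin unfolding Lp_norm_eq_Lnorm
    by (intro Lnorm_finite_imp_nn_integral[OF p borel_measurable_ennreal_norm_on[OF f]])
  then show "(\<integral>\<^sup>+x. ennreal (norm (indicator A x *\<^sub>R f x)) \<partial>lebesgue) < \<infinity>"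
    using As by (simp add: nn_integral_restrict_space ennreal_mult ennreal_indicator mult.commute)
qed

section \<open>Lattice points and dyadic cubes\<close>

lemma int_vec_nth [simp]: "int_vec k $ a = real_of_int (k $ a)"
  by (simp add: int_vec_def)

lemma int_vec_diff: "int_vec (k - l) = int_vec k - int_vec l"
  by (simp add: vec_eq_iff)

lemma vec_box:
  fixes S :: "'d::finite \<Rightarrow> 'a set"
  assumes "\<And>a. finite (S a)"
  shows finite_vec_box: "finite {k :: 'a ^ 'd. \<forall>a. k $ a \<in> S a}"
    and card_vec_box: "card {k :: 'a ^ 'd. \<forall>a. k $ a \<in> S a} \<le> (\<Prod>a\<in>UNIV. card (S a))"
proof -
  have fin: "finite (PiE UNIV S)" using assms by (intro finite_PiE) auto
  have sub: "{k :: 'a ^ 'd. \<forall>a. k $ a \<in> S a} \<subseteq> vec_lambda ` PiE UNIV S"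
  proof
    fix k :: "'a ^ 'd" assume "k \<in> {k. \<forall>a. k $ a \<in> S a}"
    then have "k = vec_lambda (\<lambda>a. k $ a)" "(\<lambda>a. k $ a) \<in> PiE UNIV S" by auto
    then show "k \<in> vec_lambda ` PiE UNIV S" by blast
  qed
  show "finite {k :: 'a ^ 'd. \<forall>a. k $ a \<in> S a}" using sub fin finite_subset by blast
  have "card {k :: 'a ^ 'd. \<forall>a. k $ a \<in> S a} \<le> card (vec_lambda ` PiE UNIV S)"
    using sub fin by (intro card_mono) auto
  also have "\<dots> \<le> card (PiE UNIV S)" using fin by (rule card_image_le)
  also have "\<dots> = (\<Prod>a\<in>UNIV. card (S a))" by (simp add: card_PiE)
  finally show "card {k :: 'a ^ 'd. \<forall>a. k $ a \<in> S a} \<le> (\<Prod>a\<in>UNIV. card (S a))" .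
qed

lemma finite_wtypes [simp]: "finite (wtypes :: (int ^ 'd) set)"
  and card_wtypes: "card (wtypes :: (int ^ 'd) set) \<le> 2 ^ CARD('d)"
proof -
  have sub: "(wtypes :: (int ^ 'd) set) \<subseteq> {k. \<forall>a. k $ a \<in> {0, 1}}" by (auto simp: wtypes_def)
  have fin: "finite {k :: int ^ 'd. \<forall>a. k $ a \<in> {0, 1}}" by (rule finite_vec_box) simp
  show "finite (wtypes :: (int ^ 'd) set)" using sub fin by (rule finite_subset)
  have "card (wtypes :: (int ^ 'd) set) \<le> card {k :: int ^ 'd. \<forall>a. k $ a \<in> {0, 1}}"
    using fin sub by (rule card_mono)
  also have "\<dots> \<le> (\<Prod>a\<in>(UNIV :: 'd set). card {0, 1 :: int})" by (rule card_vec_box) simp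
  finally show "card (wtypes :: (int ^ 'd) set) \<le> 2 ^ CARD('d)" by (simp add: numeral_2_eq_2)
qed

lemma lattice_ball_subset_box:
  "{k :: int ^ 'd. norm (int_vec k - y) < r} \<subseteq> {k. \<forall>a. k $ a \<in> {\<lfloor>y $ a - r\<rfloor>..\<lceil>y $ a + r\<rceil>}}"
proof safe
  fix k :: "int ^ 'd" and a assume "norm (int_vec k - y) < r"
  then have "\<bar>real_of_int (k $ a) - y $ a\<bar> < r"
    using component_le_norm_cart[of "int_vec k - y" a] by simp
  then show "k $ a \<in> {\<lfloor>y $ a - r\<rfloor>..\<lceil>y $ a + r\<rceil>}" by (auto; linarith)
qed

lemma finite_lattice_ball: "finite {k :: int ^ 'd. norm (int_vec k - y) < r}"
  by (rule finite_subset[OF lattice_ball_subset_box finite_vec_box]) simp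

lemma card_lattice_ball:
  fixes y :: "real ^ 'd"
  assumes "0 \<le> r"
  shows "real (card {k :: int ^ 'd. norm (int_vec k - y) < r}) \<le> (2 * r + 3) ^ CARD('d)"
proof -
  have "card {k :: int ^ 'd. norm (int_vec k - y) < r}
      \<le> card {k :: int ^ 'd. \<forall>a. k $ a \<in> {\<lfloor>y $ a - r\<rfloor>..\<lceil>y $ a + r\<rceil>}}"
    by (intro card_mono lattice_ball_subset_box finite_vec_box) simp
  also have "\<dots> \<le> (\<Prod>a\<in>UNIV. card {\<lfloor>y $ a - r\<rfloor>..\<lceil>y $ a + r\<rceil>})" by (rule card_vec_box) simp
  finally have "real (card {k :: int ^ 'd. norm (int_vec k - y) < r})
      \<le> (\<Prod>a\<in>UNIV. real (card {\<lfloor>y $ a - r\<rfloor>..\<lceil>y $ a + r\<rceil>}))"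
    by (simp flip: of_nat_prod)
  also have "\<dots> \<le> (\<Prod>a\<in>(UNIV :: 'd set). 2 * r + 3)"
  proof (rule prod_mono)
    fix a :: 'd
    have "real (nat (\<lceil>y $ a + r\<rceil> - \<lfloor>y $ a - r\<rfloor> + 1)) \<le> 2 * r + 3" using assms by linarith
    then show "0 \<le> real (card {\<lfloor>y $ a - r\<rfloor>..\<lceil>y $ a + r\<rceil>}) \<and>
        real (card {\<lfloor>y $ a - r\<rfloor>..\<lceil>y $ a + r\<rceil>}) \<le> 2 * r + 3" by simp
  qed
  finally show ?thesis by simp
qed

lemma wcube_subset_dyadic_cube:
  assumes "i \<in> wtypes"
  shows "wcube i j k \<subseteq> dyadic_cube j k"
proof -
  have "k' + 0 \<le> real_of_int i' / (2 * 2 ^ j) + k' + t \<and> real_of_int i' / (2 * 2 ^ j) + k' + t < k' + 1 / 2 ^ j"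
    if "i' \<in> {0, 1}" "0 \<le> t" "t < 1 / (2 * 2 ^ j)" for i' :: int and t k' :: real
  proof -
    have "1 / 2 ^ j = 1 / (2 * 2 ^ j) + 1 / (2 * 2 ^ j :: real)" by (simp add: field_simps)
    moreover have "0 \<le> real_of_int i' / (2 * 2 ^ j)" "real_of_int i' / (2 * 2 ^ j) \<le> 1 / (2 * 2 ^ j)"
      using that by auto
    ultimately show ?thesis using that by linarith
  qed
  from this[of "i $ a" t "k $ a / 2 ^ j" for a t] show ?thesis using assms
    by (auto simp: wcube_def dyadic_cube_def wtypes_def add_divide_distrib)
qed

lemma dyadic_cube_subset:
  assumes "J \<le> j"
  shows "dyadic_cube j k \<subseteq> dyadic_cube J (\<chi> a. k $ a div 2 ^ (j - J))"
proof -
  have pow: "(2::real) ^ j = 2 ^ (j - J) * 2 ^ J" using assms by (simp flip: power_add)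
  have "real_of_int (m div 2 ^ (j - J)) / 2 ^ J \<le> real_of_int m / 2 ^ j"
    "(real_of_int m + 1) / 2 ^ j \<le> (real_of_int (m div 2 ^ (j - J)) + 1) / 2 ^ J" for m :: int
  proof -
    let ?n = "2 ^ (j - J) :: int"
    have "m div ?n * ?n + m mod ?n = m" "0 \<le> m mod ?n" "m mod ?n < ?n"
      by (rule div_mult_mod_eq) simp_all
    moreover have "(m div ?n + 1) * ?n = m div ?n * ?n + ?n" by (simp add: distrib_right)
    ultimately have "m div ?n * ?n \<le> m" "m + 1 \<le> (m div ?n + 1) * ?n" by linarith+
    then have "real_of_int (m div ?n * ?n) \<le> real_of_int m" "real_of_int (m + 1) \<le> real_of_int ((m div ?n + 1) * ?n)"
      by (simp_all only: of_int_le_iff)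
    moreover have "real_of_int (m div ?n) / 2 ^ J = real_of_int (m div ?n * ?n) / 2 ^ j"
      "(real_of_int (m div ?n) + 1) / 2 ^ J = real_of_int ((m div ?n + 1) * ?n) / 2 ^ j"
      unfolding pow by simp_all
    ultimately show "real_of_int (m div ?n) / 2 ^ J \<le> real_of_int m / 2 ^ j"
      "(real_of_int m + 1) / 2 ^ j \<le> (real_of_int (m div ?n) + 1) / 2 ^ J"
      by (simp_all only: divide_right_mono of_int_add of_int_1 zero_le_power zero_le_numeral)
  qed
  then show ?thesis by (auto simp: dyadic_cube_def intro: order_trans less_le_trans)
qed

text \<open>The index of the dyadic cube containing a given point; see \<open>mem_dyadic_cube_iff\<close>.\<close>

definition position :: "nat \<Rightarrow> real ^ 'd \<Rightarrow> int ^ 'd" where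
  "position j x = (\<chi> a. \<lfloor>2 ^ j * x $ a\<rfloor>)"

lemma mem_dyadic_cube_iff: "x \<in> dyadic_cube j k \<longleftrightarrow> k = position j x"
proof -
  have "real_of_int m / 2 ^ j \<le> t \<and> t < (real_of_int m + 1) / 2 ^ j \<longleftrightarrow> m = \<lfloor>2 ^ j * t\<rfloor>" for m t
    by (auto simp: field_simps floor_eq_iff eq_commute[of m])
  then show ?thesis by (auto simp: dyadic_cube_def position_def vec_eq_iff)
qed

lemma cube_at_eq: "cube_at j x = dyadic_cube j (position j x)"
  unfolding cube_at_def
  by (rule the_equality) (auto simp: dyadic_cubes_def mem_dyadic_cube_iff)

definition neighbours :: "nat \<Rightarrow> real ^ 'd \<Rightarrow> (int ^ 'd) set" where
  "neighbours j x = {k. \<forall>a. \<bar>k $ a - position j x $ a\<bar> \<le> 1}"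

text \<open>Dyadic cubes are half open, so distinct ones are disjoint; the distance of neighbours is \<open>0\<close>
because points of both may approach the common boundary.\<close>

lemma setdist_adjacent_cubes:
  fixes k l :: "int ^ 'd"
  assumes "\<And>a. \<bar>k $ a - l $ a\<bar> \<le> 1"
  shows "setdist (dyadic_cube j k) (dyadic_cube j l) = 0"
proof -
  have "setdist (dyadic_cube j k) (dyadic_cube j l) \<le> 0 + e" if e: "0 < e" for e
  proof -
    define t where "t = min (1/2) (e / real CARD('d))"
    have t: "0 < t" "t < 1" "t \<le> e / real CARD('d)" using e by (auto simp: t_def)
    \<comment> \<open>one coordinate of a point of the cube \<open>m\<close> chosen as close as possible to the cube
      \<open>n\<close>: just below the upper end if \<open>n\<close> lies above, the lower end
      otherwise\<close>
    define s where "s m n = (if m < n then real_of_int m + 1 - t else real_of_int m)" for m n :: int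
    have s: "real_of_int m \<le> s m n" "s m n < real_of_int m + 1" for m n using t by (auto simp: s_def)
    have st: "\<bar>s m n - s n m\<bar> \<le> t" if "\<bar>m - n\<bar> \<le> 1" for m n
    proof -
      have "m = n \<or> m = n + 1 \<or> n = m + 1" using that by linarith
      then show ?thesis using t by (auto simp: s_def)
    qed
    define x :: "real ^ 'd" where "x = (\<chi> a. s (k $ a) (l $ a) / 2 ^ j)"
    define y :: "real ^ 'd" where "y = (\<chi> a. s (l $ a) (k $ a) / 2 ^ j)"
    have xy: "x \<in> dyadic_cube j k" "y \<in> dyadic_cube j l"
      using s by (auto simp: x_def y_def dyadic_cube_def intro: divide_right_mono divide_strict_right_mono)
    have "dist x y \<le> (\<Sum>a\<in>UNIV. \<bar>(x - y) $ a\<bar>)" unfolding dist_norm by (rule norm_le_l1_cart)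
    also have "\<dots> \<le> (\<Sum>a\<in>(UNIV :: 'd set). t)"
    proof (rule sum_mono)
      fix a
      have "\<bar>(x - y) $ a\<bar> = \<bar>s (k $ a) (l $ a) - s (l $ a) (k $ a)\<bar> / 2 ^ j"
        by (simp add: x_def y_def flip: diff_divide_distrib)
      also have "\<dots> \<le> \<bar>s (k $ a) (l $ a) - s (l $ a) (k $ a)\<bar> / 1"
        by (intro divide_left_mono) auto
      also have "\<dots> \<le> t" using st[OF assms[of a]] by simp
      finally show "\<bar>(x - y) $ a\<bar> \<le> t" .
    qed
    also have "\<dots> \<le> e" using t by (simp add: field_simps)
    finally show ?thesis using setdist_le_dist[OF xy] by simp
  qed
  then have "setdist (dyadic_cube j k) (dyadic_cube j l) \<le> 0" by (rule field_le_epsilon)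
  then show ?thesis using setdist_pos_le by (metis antisym)
qed

lemma neighbours_three_cubes: "k \<in> neighbours j x \<Longrightarrow> dyadic_cube j k \<in> three_cubes j x"
  by (auto simp: three_cubes_def dyadic_cubes_def cube_at_eq neighbours_def setdist_adjacent_cubes)

lemma neighbours_finite_card:
  fixes x :: "real ^ 'd"
  shows "finite (neighbours j x)" "card (neighbours j x) \<le> 3 ^ CARD('d)"
proof -
  have eq: "neighbours j x = {k. \<forall>a. k $ a \<in> {position j x $ a - 1..position j x $ a + 1}}"
    by (auto simp: neighbours_def abs_le_iff algebra_simps)
  show "finite (neighbours j x)" unfolding eq by (rule finite_vec_box) simp
  have "card (neighbours j x) \<le> (\<Prod>a\<in>UNIV. card {position j x $ a - 1..position j x $ a + 1})"
    unfolding eq by (rule card_vec_box) simp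
  then show "card (neighbours j x) \<le> 3 ^ CARD('d)" by simp
qed

text \<open>After division by \<open>2 ^ (j - J)\<close> the index \<open>k\<close> differs from \<open>2 ^ J *\<^sub>R x\<close> by at most \<open>1\<close> in each
coordinate, so that the integer parts differ by at most \<open>1\<close> as well.\<close>

lemma wcube_subset_neighbour:
  assumes "i \<in> wtypes" "J \<le> j" and near: "norm (int_vec k - 2 ^ j *\<^sub>R x) \<le> 2 ^ (j - J)"
  shows "\<exists>l\<in>neighbours J x. wcube i j k \<subseteq> dyadic_cube J l"
proof
  show "wcube i j k \<subseteq> dyadic_cube J (\<chi> a. k $ a div 2 ^ (j - J))"
    using wcube_subset_dyadic_cube[OF assms(1)] dyadic_cube_subset[OF assms(2)] by blast
  have pow: "(2::real) ^ j = 2 ^ (j - J) * 2 ^ J" using assms by (simp flip: power_add)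
  have "\<bar>k $ a div 2 ^ (j - J) - \<lfloor>2 ^ J * x $ a\<rfloor>\<bar> \<le> 1" for a
  proof -
    have "\<bar>real_of_int (k $ a) - 2 ^ j * x $ a\<bar> \<le> 2 ^ (j - J)"
      using near component_le_norm_cart[of "int_vec k - 2 ^ j *\<^sub>R x" a] by simp
    then have "\<bar>real_of_int (k $ a) / 2 ^ (j - J) - 2 ^ J * x $ a\<bar> \<le> 1"
      unfolding pow abs_le_iff by (simp add: field_simps)
    moreover have "k $ a div 2 ^ (j - J) = \<lfloor>real_of_int (k $ a) / 2 ^ (j - J)\<rfloor>"
      using floor_divide_of_int_eq[of "k $ a" "2 ^ (j - J)", where ?'a = real] by simp
    ultimately show ?thesis by linarith
  qed
  then show "(\<chi> a. k $ a div 2 ^ (j - J)) \<in> neighbours J x"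
    by (simp add: neighbours_def position_def)
qed

text \<open>All coefficients of scale \<open>j\<close> whose position is within \<open>2 ^ (- J)\<close> of \<open>x\<close> belong to one of the
\<open>3 ^ CARD('d)\<close> cubes of scale \<open>J\<close> around \<open>x\<close>. This is the only way in which leaders are used.\<close>

lemma lp_norm_near_coefficients_le_leader_at:
  fixes x :: "real ^ 'd"
  assumes p: "1 \<le> p" and J: "J \<le> j"
    and S: "finite S" "S \<subseteq> {(i, k). i \<in> wtypes \<and> norm (int_vec k - 2 ^ j *\<^sub>R x) \<le> 2 ^ (j - J)}"
  shows "lp_norm p S (\<lambda>(i, k). ennreal (2 powr ((real J - real j) * dim_over TYPE('d) p) * norm (wcoeff \<psi> f i j k)))
      \<le> ennreal (3 ^ CARD('d)) * leader_at \<psi> p f x J"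
    (is "lp_norm p S ?c \<le> _")
proof -
  have "lp_norm p S ?c \<le> (\<Sum>l\<in>neighbours J x. lp_norm p {(i, k). i \<in> wtypes \<and> wcube i j k \<subseteq> dyadic_cube J l} ?c)"
  proof (rule lp_norm_cover[OF p neighbours_finite_card(1) S(1)])
    show "S \<subseteq> (\<Union>l\<in>neighbours J x. {(i, k). i \<in> wtypes \<and> wcube i j k \<subseteq> dyadic_cube J l})"
      using S(2) wcube_subset_neighbour[OF _ J, of _ _ x] by fastforce
  qed
  also have "\<dots> \<le> (\<Sum>l\<in>neighbours J x. leader_at \<psi> p f x J)"
  proof (rule sum_mono)
    fix l assume "l \<in> neighbours J x"
    then have "leader \<psi> p f J (dyadic_cube J l) \<le> leader_at \<psi> p f x J"
      unfolding leader_at_def by (intro SUP_upper neighbours_three_cubes)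
    moreover have "lp_norm p {(i, k). i \<in> wtypes \<and> wcube i j k \<subseteq> dyadic_cube J l} ?c \<le> leader \<psi> p f J (dyadic_cube J l)"
      unfolding leader_def using J by (intro SUP_upper2[of j]) auto
    ultimately show "lp_norm p {(i, k). i \<in> wtypes \<and> wcube i j k \<subseteq> dyadic_cube J l} ?c \<le> leader_at \<psi> p f x J"
      by simp
  qed
  also have "\<dots> = ennreal (real (card (neighbours J x))) * leader_at \<psi> p f x J"
    by (simp add: ennreal_of_nat_eq_real_of_nat)
  also have "\<dots> \<le> ennreal (3 ^ CARD('d)) * leader_at \<psi> p f x J"
  proof (intro mult_right_mono ennreal_leI)
    have "real (card (neighbours J x)) \<le> real (3 ^ CARD('d))" by (simp only: of_nat_le_iff neighbours_finite_card(2))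
    then show "real (card (neighbours J x)) \<le> 3 ^ CARD('d)" by simp
  qed simp
  finally show ?thesis .
qed

section \<open>Finite differences\<close>

lemma finite_diff_0 [simp]: "finite_diff 0 h f = f"
  by (simp add: finite_diff_def)

lemma finite_diff_Suc: "finite_diff (Suc m) h f x = finite_diff m h f (x + h) - finite_diff m h f x"
  by (simp add: finite_diff_def)

lemma finite_diff_cong:
  assumes "\<And>l. l \<le> m \<Longrightarrow> f (x + real l *\<^sub>R h) = g (x + real l *\<^sub>R h)"
  shows "finite_diff m h f x = finite_diff m h g x"
  using assms
proof (induction m arbitrary: x)
  case 0
  then show ?case by simp
next
  case (Suc m)
  have "finite_diff m h f (x + h) = finite_diff m h g (x + h)"
    using Suc.prems[of "Suc _"] by (intro Suc.IH) (simp add: algebra_simps)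
  moreover have "finite_diff m h f x = finite_diff m h g x"
    using Suc.prems by (intro Suc.IH) auto
  ultimately show ?case by (simp add: finite_diff_Suc)
qed

lemma finite_diff_zero [simp]: "finite_diff m h (\<lambda>x. 0) x = 0"
  by (induction m arbitrary: x) (auto simp: finite_diff_Suc)

lemma finite_diff_sum:
  "finite_diff m h (\<lambda>x. \<Sum>a\<in>A. c a * g a x) x = (\<Sum>a\<in>A. c a * finite_diff m h (g a) x)"
  by (induction m arbitrary: x) (auto simp: finite_diff_Suc algebra_simps sum_subtractf)

lemma finite_diff_diff:
  "finite_diff m h (\<lambda>x. f x - g x) x = finite_diff m h f x - finite_diff m h g x"
  by (induction m arbitrary: x) (auto simp: finite_diff_Suc)

lemma finite_diff_cnj: "finite_diff m h (\<lambda>x. cnj (g x)) x = cnj (finite_diff m h g x)"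
  by (induction m arbitrary: x) (auto simp: finite_diff_Suc)

lemma finite_diff_affine:
  "finite_diff m h (\<lambda>x. g (s *\<^sub>R x - t)) x = finite_diff m (s *\<^sub>R h) g (s *\<^sub>R x - t)"
  by (induction m arbitrary: x) (auto simp: finite_diff_Suc algebra_simps)

lemma finite_diff_has_derivative:
  assumes "\<And>y. (g has_derivative g' y) (at y)"
  shows "(finite_diff m h g has_derivative (\<lambda>v. finite_diff m h (\<lambda>y. g' y v) x)) (at x)"
proof (induction m arbitrary: x)
  case 0
  then show ?case using assms by simp
next
  case (Suc m)
  have "((\<lambda>x. finite_diff m h g (x + h)) has_derivative (\<lambda>v. finite_diff m h (\<lambda>y. g' y v) (x + h))) (at x)"
  proof (rule has_derivative_compose[of "\<lambda>x. x + h" "\<lambda>v. v" x UNIV, simplified])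
    show "((\<lambda>x. x + h) has_derivative (\<lambda>v. v)) (at x)" by (auto intro!: derivative_eq_intros)
  qed (rule Suc.IH)
  from has_derivative_diff[OF this Suc.IH[of x]] show ?case
    unfolding finite_diff_Suc[abs_def] .
qed

lemma class_C_continuous: "class_C m g \<Longrightarrow> continuous_on UNIV g"
  by (cases m) (auto intro: differentiable_imp_continuous_on)

lemma class_C_mono: "class_C n g \<Longrightarrow> m \<le> n \<Longrightarrow> class_C m g"
proof (induction n arbitrary: m g)
  case 0
  then show ?case by simp
next
  case (Suc n)
  show ?case
  proof (cases m)
    case 0
    then show ?thesis using class_C_continuous[OF Suc.prems(1)] by simp
  next
    case (Suc m')
    then show ?thesis using Suc.prems Suc.IH[of _ m'] by auto
  qed
qed

text \<open>Induction on the order: the mean value theorem is applied to \<open>finite_diff m h g\<close>, whose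
directional derivatives are differences of order \<open>m\<close> of the partial derivatives of \<open>g\<close>.\<close>

lemma finite_diff_bound:
  fixes g :: "real ^ 'd \<Rightarrow> complex"
  assumes "class_C m g" and "\<And>x. \<rho> \<le> norm x \<Longrightarrow> g x = 0"
  shows "\<exists>C\<ge>0. \<forall>h x. norm (finite_diff m h g x) \<le> C * norm h ^ m"
  using assms
proof (induction m arbitrary: g \<rho>)
  case 0
  have "compact (g ` cball 0 \<rho>)"
    using 0 by (intro compact_continuous_image) (auto intro: continuous_on_subset)
  then obtain C where C: "\<And>x. norm x \<le> \<rho> \<Longrightarrow> norm (g x) \<le> C"
    using compact_imp_bounded by (fastforce simp: bounded_iff)
  have "norm (g x) \<le> max C 0" for x
    using C[of x] 0(2)[of x] by (cases "norm x \<le> \<rho>") auto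
  then show ?case by (intro exI[of _ "max C 0"]) auto
next
  case (Suc m)
  define g' where "g' y = frechet_derivative g (at y)" for y
  have g': "(g has_derivative g' y) (at y)" for y
    using Suc.prems(1) unfolding g'_def
    by (auto simp: differentiable_on_def frechet_derivative_works[symmetric])
  have lin: "linear (g' y)" for y using g' has_derivative_linear by blast
  have zero: "g' y v = 0" if "\<rho> + 1 \<le> norm y" for y v
  proof -
    have "(g has_derivative (\<lambda>v. 0)) (at y)"
    proof (rule has_derivative_transform_within_open[of "\<lambda>_. 0"])
      show "open (- cball (0 :: real ^ 'd) \<rho>)" by (simp add: open_Compl)
      show "y \<in> - cball 0 \<rho>" using that by simp
      show "\<And>x. x \<in> - cball 0 \<rho> \<Longrightarrow> 0 = g x" using Suc.prems(2) by auto
    qed simp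
    then show ?thesis using has_derivative_unique[OF g'[of y]] by metis
  qed
  have "\<exists>C\<ge>0. \<forall>h x. norm (finite_diff m h (\<lambda>y. g' y v) x) \<le> C * norm h ^ m" for v
    using Suc.prems(1) zero by (intro Suc.IH[of _ "\<rho> + 1"]) (auto simp: g'_def)
  then obtain C where C: "\<And>v. 0 \<le> C v" "\<And>v h x. norm (finite_diff m h (\<lambda>y. g' y v) x) \<le> C v * norm h ^ m"
    by metis
  define K where "K = (\<Sum>b\<in>(Basis :: (real ^ 'd) set). C b)"
  have K: "0 \<le> K" unfolding K_def by (intro sum_nonneg C)
  have dir: "norm (finite_diff m h (\<lambda>y. g' y v) x) \<le> K * norm h ^ m * norm v" for h x v
  proof -
    have "g' y v = (\<Sum>b\<in>Basis. complex_of_real (v \<bullet> b) * g' y b)" for y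
    proof -
      have "g' y v = g' y (\<Sum>b\<in>Basis. (v \<bullet> b) *\<^sub>R b)" by (simp only: euclidean_representation)
      also have "\<dots> = (\<Sum>b\<in>Basis. (v \<bullet> b) *\<^sub>R g' y b)"
        by (simp only: linear_sum[OF lin] linear_cmul[OF lin])
      finally show ?thesis by (simp add: scaleR_conv_of_real)
    qed
    then have "finite_diff m h (\<lambda>y. g' y v) x
        = finite_diff m h (\<lambda>y. \<Sum>b\<in>Basis. complex_of_real (v \<bullet> b) * g' y b) x"
      by simp
    also have "\<dots> = (\<Sum>b\<in>Basis. complex_of_real (v \<bullet> b) * finite_diff m h (\<lambda>y. g' y b) x)"
      by (rule finite_diff_sum)
    also have "norm \<dots> \<le> (\<Sum>b\<in>(Basis :: (real ^ 'd) set). C b * norm h ^ m * norm v)"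
    proof (rule sum_norm_le)
      fix b :: "real ^ 'd" assume "b \<in> Basis"
      then have "\<bar>v \<bullet> b\<bar> \<le> norm v" by (rule Basis_le_norm)
      then have "\<bar>v \<bullet> b\<bar> * norm (finite_diff m h (\<lambda>y. g' y b) x) \<le> norm v * (C b * norm h ^ m)"
        using C by (intro mult_mono) auto
      then show "norm (complex_of_real (v \<bullet> b) * finite_diff m h (\<lambda>y. g' y b) x) \<le> C b * norm h ^ m * norm v"
        by (simp add: norm_mult mult_ac)
    qed
    also have "\<dots> = K * norm h ^ m * norm v" by (simp add: K_def sum_distrib_right)
    finally show ?thesis .
  qed
  have "norm (finite_diff (Suc m) h g x) \<le> K * norm h ^ Suc m" for h x
  proof -
    have "norm (finite_diff m h g (x + h) - finite_diff m h g x) \<le> (K * norm h ^ m) * norm ((x + h) - x)"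
    proof (rule differentiable_bound[of UNIV])
      fix y :: "real ^ 'd"
      show "(finite_diff m h g has_derivative (\<lambda>v. finite_diff m h (\<lambda>y. g' y v) y)) (at y within UNIV)"
        using finite_diff_has_derivative[OF g'] by simp
      show "onorm (\<lambda>v. finite_diff m h (\<lambda>y. g' y v) y) \<le> K * norm h ^ m"
        using dir by (intro onorm_le) auto
    qed auto
    then show ?thesis by (simp add: finite_diff_Suc mult_ac)
  qed
  then show ?case using K by blast
qed

lemma inner_ball_eq:
  "inner_ball m h x0 r = {x. x \<in> ball x0 r \<and> x + real m *\<^sub>R h \<in> ball x0 r}"
  using closed_segment_subset[OF _ _ convex_ball] by (fastforce simp: inner_ball_def)

lemma inner_ball_subset: "inner_ball m h x0 r \<subseteq> ball x0 r"
  by (auto simp: inner_ball_eq)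

lemma open_inner_ball: "open (inner_ball m h x0 r)"
proof -
  have "inner_ball m h x0 r = ball x0 r \<inter> (\<lambda>x. x + real m *\<^sub>R h) -` ball x0 r"
    by (auto simp: inner_ball_eq)
  then show ?thesis by (auto intro!: open_Int open_vimage continuous_intros)
qed

lemma sets_inner_ball [measurable, simp]: "inner_ball m h x0 r \<in> sets lebesgue"
  using borel_open[OF open_inner_ball, of m h x0 r] by (simp add: sets_completionI_sets)

lemma inner_ball_step:
  assumes "x \<in> inner_ball m h x0 r" "l \<le> m"
  shows "x + real l *\<^sub>R h \<in> ball x0 r"
proof (cases "m = 0")
  case True
  then show ?thesis using assms by (simp add: inner_ball_eq)
next
  case False
  have "x + real l *\<^sub>R h = (1 - real l / real m) *\<^sub>R x + (real l / real m) *\<^sub>R (x + real m *\<^sub>R h)"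
    using False by (simp add: algebra_simps)
  also have "\<dots> \<in> closed_segment x (x + real m *\<^sub>R h)"
    unfolding closed_segment_def using assms(2) False
    by (intro CollectI exI[of _ "real l / real m"]) auto
  finally show ?thesis using assms(1) by (auto simp: inner_ball_def)
qed

text \<open>Each difference is a combination of two functions, and translation by \<open>h\<close> maps the inner ball of
order \<open>Suc m\<close> into the one of order \<open>m\<close>.\<close>

lemma finite_diff_Lp_bound:
  fixes g :: "real ^ 'd \<Rightarrow> complex"
  assumes p: "1 \<le> p" and g: "g \<in> borel_measurable lebesgue"
  shows "finite_diff m h g \<in> borel_measurable lebesgue \<and>
    Lp_norm p (inner_ball m h x0 r) (finite_diff m h g) \<le> 2 ^ m * Lp_norm p (ball x0 r) g"
proof (induction m)
  case 0
  have "inner_ball 0 h x0 r = ball x0 r" by (auto simp: inner_ball_eq)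
  then show ?case using g by simp
next
  case (Suc m)
  let ?B = "\<lambda>m. inner_ball m h x0 r"
  have d: "finite_diff m h g \<in> borel_measurable lebesgue" using Suc by simp
  have step: "x + h \<in> ?B m" if "x \<in> ?B (Suc m)" for x
    using inner_ball_step[OF that, of 1] inner_ball_step[OF that, of "Suc m"]
    by (auto simp: inner_ball_eq algebra_simps)
  have sub: "?B (Suc m) \<subseteq> ?B m"
    using inner_ball_step[of _ "Suc m" h x0 r 0] inner_ball_step[of _ "Suc m" h x0 r m]
    by (auto simp: inner_ball_eq)
  note tr = Lp_norm_translate[OF p sets_inner_ball sets_inner_ball step d]
  have eq: "finite_diff (Suc m) h g = (\<lambda>x. finite_diff m h g (x + h) - finite_diff m h g x)"
    by (simp add: finite_diff_Suc fun_eq_iff)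
  have meas: "finite_diff (Suc m) h g \<in> borel_measurable lebesgue"
    unfolding eq using tr(1) d by (rule borel_measurable_diff)
  have "Lp_norm p (?B (Suc m)) (finite_diff (Suc m) h g)
      \<le> Lp_norm p (?B (Suc m)) (\<lambda>x. finite_diff m h g (x + h)) + Lp_norm p (?B (Suc m)) (finite_diff m h g)"
    using tr(1) d meas by (intro Lp_norm_add_le[OF p]) (auto simp: eq norm_triangle_ineq4)
  also have "\<dots> \<le> Lp_norm p (?B m) (finite_diff m h g) + Lp_norm p (?B m) (finite_diff m h g)"
    using tr(2) Lp_norm_mono[OF p sets_inner_ball sets_inner_ball sub d d] by (auto intro: add_mono)
  also have "\<dots> = 2 * Lp_norm p (?B m) (finite_diff m h g)" by (simp add: mult_2)
  also have "\<dots> \<le> 2 * (2 ^ m * Lp_norm p (ball x0 r) g)"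
    using Suc by (intro mult_left_mono) auto
  finally show ?case using meas by (simp add: mult.assoc)
qed

section \<open>Bounded functions of bounded support and test functions\<close>

text \<open>This class is closed under the algebraic operations, contains the wavelets and the test functions,
and may be integrated against any locally integrable function; so all pairings below exist.\<close>

definition tame :: "('a::euclidean_space \<Rightarrow> complex) \<Rightarrow> bool" where
  "tame g \<longleftrightarrow> g \<in> borel_measurable lebesgue \<and> (\<exists>K. \<forall>x. norm (g x) \<le> K) \<and> (\<exists>r. \<forall>x. r \<le> norm x \<longrightarrow> g x = 0)"

lemma tameI:
  "g \<in> borel_measurable lebesgue \<Longrightarrow> (\<And>x. norm (g x) \<le> K) \<Longrightarrow> (\<And>x. r \<le> norm x \<Longrightarrow> g x = 0) \<Longrightarrow> tame g"
  by (auto simp: tame_def)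

lemma tameE:
  assumes "tame g"
  obtains K r where "g \<in> borel_measurable lebesgue" "0 \<le> K" "\<And>x. norm (g x) \<le> K" "\<And>x. r \<le> norm x \<Longrightarrow> g x = 0"
proof -
  obtain K r where "g \<in> borel_measurable lebesgue" "\<And>x. norm (g x) \<le> K" "\<And>x. r \<le> norm x \<Longrightarrow> g x = 0"
    using assms by (auto simp: tame_def)
  moreover from this(2)[of 0] have "0 \<le> K" using norm_ge_zero order_trans by blast
  ultimately show ?thesis using that by blast
qed

lemma tame_measurable: "tame g \<Longrightarrow> g \<in> borel_measurable lebesgue"
  by (simp add: tame_def)

lemma tame_continuous:
  fixes g :: "'a::euclidean_space \<Rightarrow> complex"
  assumes "continuous_on UNIV g" "\<And>x. r \<le> norm x \<Longrightarrow> g x = 0"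
  shows "tame g"
proof -
  have "compact (g ` cball 0 r)"
    using assms by (intro compact_continuous_image) (auto intro: continuous_on_subset)
  then obtain C where C: "\<And>x. norm x \<le> r \<Longrightarrow> norm (g x) \<le> C"
    using compact_imp_bounded by (fastforce simp: bounded_iff)
  have "norm (g x) \<le> max C 0" for x
    using C[of x] assms(2)[of x] by (cases "norm x \<le> r") auto
  moreover have "g \<in> borel_measurable lebesgue"
    using borel_measurable_continuous_onI[OF assms(1)] by (simp add: measurable_completion)
  ultimately show ?thesis using assms(2) by (auto intro: tameI)
qed

lemma tame_times_bounded:
  assumes "tame g" and "f \<in> borel_measurable lebesgue" "\<And>x. norm (f x) \<le> K"
  shows "tame (\<lambda>x. f x * g x)"
proof -
  obtain K' r where g: "g \<in> borel_measurable lebesgue" "0 \<le> K'" "\<And>x. norm (g x) \<le> K'" "\<And>x. r \<le> norm x \<Longrightarrow> g x = 0"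
    using tameE[OF assms(1)] by blast
  have "norm (f x * g x) \<le> K * K'" for x
    using assms(3)[of x] g(3)[of x] by (auto simp: norm_mult intro!: mult_mono intro: order_trans[OF norm_ge_zero])
  then show ?thesis using g assms(2) by (intro tameI[of _ "K * K'" r]) auto
qed

lemma tame_mult: "tame f \<Longrightarrow> tame g \<Longrightarrow> tame (\<lambda>x. f x * g x)"
  by (auto elim!: tameE[of f] intro: tame_times_bounded)

lemma tame_cmult: "tame g \<Longrightarrow> tame (\<lambda>x. c * g x)"
  by (rule tame_times_bounded[of _ _ "norm c"]) auto

lemma tame_add:
  assumes "tame f" "tame g"
  shows "tame (\<lambda>x. f x + g x)"
proof -
  obtain K r where f: "f \<in> borel_measurable lebesgue" "0 \<le> K" "\<And>x. norm (f x) \<le> K" "\<And>x. r \<le> norm x \<Longrightarrow> f x = 0"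
    using tameE[OF assms(1)] by blast
  obtain K' r' where g: "g \<in> borel_measurable lebesgue" "0 \<le> K'" "\<And>x. norm (g x) \<le> K'" "\<And>x. r' \<le> norm x \<Longrightarrow> g x = 0"
    using tameE[OF assms(2)] by blast
  have "norm (f x + g x) \<le> K + K'" for x
    using f(3)[of x] g(3)[of x] norm_triangle_ineq[of "f x" "g x"] by simp
  then show ?thesis using f g by (intro tameI[of _ "K + K'" "max r r'"]) auto
qed

lemma tame_diff: "tame f \<Longrightarrow> tame g \<Longrightarrow> tame (\<lambda>x. f x - g x)"
  using tame_add[of f "\<lambda>x. - 1 * g x"] tame_cmult[of g "-1"] by simp

lemma borel_measurable_cnj:
  assumes "g \<in> borel_measurable M"
  shows "(\<lambda>x. cnj (g x)) \<in> borel_measurable M"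
  by (rule measurable_compose[OF assms borel_measurable_continuous_onI]) (intro continuous_intros)

lemma tame_cnj: "tame g \<Longrightarrow> tame (\<lambda>x. cnj (g x))"
  by (auto elim!: tameE[of g] intro!: tameI borel_measurable_cnj)

lemma tame_zero: "tame (\<lambda>x. 0)"
  by (rule tameI[of _ 0 0]) auto

lemma tame_sum: "(\<And>a. a \<in> A \<Longrightarrow> tame (g a)) \<Longrightarrow> tame (\<lambda>x. \<Sum>a\<in>A. g a x)"
  by (induction A rule: infinite_finite_induct) (auto intro: tame_zero tame_add)

lemma tame_lipschitz:
  fixes w :: "'a::euclidean_space \<Rightarrow> real"
  assumes L: "0 \<le> L" and lip: "\<And>x y. \<bar>w x - w y\<bar> \<le> L * dist x y"
    and w0: "\<And>x. x \<notin> B \<Longrightarrow> w x = 0" and B: "bounded B"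
  shows "tame (\<lambda>x. complex_of_real (w x))"
proof -
  obtain r where r: "B \<subseteq> ball 0 r" using B bounded_subset_ballD by blast
  have "L-lipschitz_on UNIV w" using L lip by (auto simp: lipschitz_on_def dist_real_def)
  then have "continuous_on UNIV (\<lambda>x. complex_of_real (w x))"
    by (intro continuous_on_of_real lipschitz_on_continuous_on)
  then show ?thesis
  proof (rule tame_continuous)
    fix x :: 'a assume "r \<le> norm x"
    then have "x \<notin> B" using r by auto
    then show "complex_of_real (w x) = 0" by (simp add: w0)
  qed
qed

definition locally_integrable :: "('a::euclidean_space \<Rightarrow> complex) \<Rightarrow> bool" where
  "locally_integrable f \<longleftrightarrow> f \<in> borel_measurable lebesgue \<and>
     (\<forall>r. integrable lebesgue (\<lambda>x. indicator (ball 0 r) x *\<^sub>R f x))"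

lemma integrable_times_tame:
  assumes "locally_integrable f" "tame g"
  shows "integrable lebesgue (\<lambda>x. f x * g x)"
proof -
  obtain K r where g: "g \<in> borel_measurable lebesgue" "0 \<le> K" "\<And>x. norm (g x) \<le> K" "\<And>x. r \<le> norm x \<Longrightarrow> g x = 0"
    using tameE[OF assms(2)] by blast
  show ?thesis
  proof (rule Bochner_Integration.integrable_bound)
    show "integrable lebesgue (\<lambda>x. K * norm (indicator (ball 0 r) x *\<^sub>R f x))"
      using assms(1) unfolding locally_integrable_def by (intro integrable_mult_right integrable_norm) auto
    show "(\<lambda>x. f x * g x) \<in> borel_measurable lebesgue"
      using assms(1) g(1) unfolding locally_integrable_def by (intro borel_measurable_times) auto
    have "norm (f x * g x) \<le> norm (K * norm (indicator (ball 0 r) x *\<^sub>R f x))" for x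
    proof (cases "norm x < r")
      case True
      then show ?thesis using mult_left_mono[OF g(3)[of x], of "norm (f x)"] g(2)
        by (simp add: norm_mult mult.commute)
    next
      case False
      then show ?thesis using g(2,4) by simp
    qed
    then show "AE x in lebesgue. norm (f x * g x) \<le> norm (K * norm (indicator (ball 0 r) x *\<^sub>R f x))"
      by simp
  qed
qed

lemma locally_integrable_const: "locally_integrable (\<lambda>x. 1)"
  unfolding locally_integrable_def
proof safe
  fix r :: real
  have "integrable lebesgue (indicator (ball (0 :: 'a) r) :: 'a \<Rightarrow> real)"
    using lmeasurable_ball[of "0 :: 'a" r] by (simp add: lmeasurable_iff_integrable)
  then show "integrable lebesgue (\<lambda>x :: 'a. indicator (ball 0 r) x *\<^sub>R (1 :: complex))"
    by (rule integrable_scaleR_left[rotated]) 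
qed simp

lemma tame_integrable: "tame g \<Longrightarrow> integrable lebesgue g"
  using integrable_times_tame[OF locally_integrable_const] by simp

text \<open>The open sets are an intersection-stable generator of the Borel sets, and a Lebesgue set differs
from a Borel set by a null set.\<close>

lemma AE_zero_of_open_integrals:
  fixes u :: "'a::euclidean_space \<Rightarrow> complex"
  assumes u: "integrable lebesgue u"
    and zero: "\<And>U. open U \<Longrightarrow> set_lebesgue_integral lebesgue U u = 0"
  shows "AE x in lebesgue. u x = 0"
proof -
  have si: "set_integrable lebesgue A u" if "A \<in> sets lebesgue" for A
    using that u unfolding set_integrable_def by (rule integrable_mult_indicator)
  have leb: "A \<in> sets borel \<Longrightarrow> A \<in> sets lebesgue" for A :: "'a set"
    by (simp add: sets_completionI_sets)
  have borel: "set_lebesgue_integral lebesgue A u = 0" if "A \<in> sets borel" for A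
  proof -
    have "Int_stable {S :: 'a set. open S}" by (auto simp: Int_stable_def)
    moreover have "{S :: 'a set. open S} \<subseteq> Pow UNIV" by simp
    moreover have "A \<in> sigma_sets UNIV {S. open S}" using that by (simp add: borel_def)
    ultimately show ?thesis
    proof (induction rule: sigma_sets_induct_disjoint)
      case (basic A)
      then show ?case using zero by simp
    next
      case empty
      then show ?case by (simp add: set_lebesgue_integral_def)
    next
      case (compl A)
      then have A: "A \<in> sets lebesgue" by (intro leb) (simp add: borel_def)
      have "set_lebesgue_integral lebesgue UNIV u
          = set_lebesgue_integral lebesgue (A \<union> (UNIV - A)) u" by simp
      also have "\<dots> = set_lebesgue_integral lebesgue A u + set_lebesgue_integral lebesgue (UNIV - A) u"
        using A by (intro set_integral_Un si) auto
      finally show ?case using compl zero[of UNIV] by simp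
    next
      case (union A)
      then have A: "range A \<subseteq> sets lebesgue" by (auto intro!: leb simp: borel_def)
      then have "set_lebesgue_integral lebesgue (\<Union>i. A i) u = (\<Sum>i. set_lebesgue_integral lebesgue (A i) u)"
        using union(1) by (intro lebesgue_integral_countable_add si) (auto simp: disjoint_family_on_def)
      then show ?case using union by simp
    qed
  qed
  have all: "set_lebesgue_integral lebesgue A u = 0" if A: "A \<in> sets lebesgue" for A
  proof -
    obtain S N N' where SN: "A = S \<union> N" "N \<subseteq> N'" "N' \<in> null_sets lborel" "S \<in> sets lborel"
      using A by (rule sets_completionE)
    have "AE x in lborel. x \<notin> N'" using SN(3) by (rule AE_not_in)
    then have ae: "AE x in lebesgue. x \<notin> N'" by (rule AE_completion)
    have "set_lebesgue_integral lebesgue A u = set_lebesgue_integral lebesgue S u"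
      unfolding set_lebesgue_integral_def
    proof (rule integral_cong_AE)
      show "AE x in lebesgue. indicator A x *\<^sub>R u x = indicator S x *\<^sub>R u x"
        using ae by eventually_elim (use SN in \<open>auto simp: indicator_def\<close>)
    qed (use si A leb SN(4) in \<open>auto simp: set_integrable_def intro!: borel_measurable_integrable\<close>)
    then show "set_lebesgue_integral lebesgue A u = 0" using borel SN(4) by simp
  qed
  have "AE x in lebesgue. Re (u x) = 0"
  proof (rule density_unique_real[where f' = "\<lambda>_. 0"])
    fix A :: "'a set" assume A: "A \<in> sets lebesgue"
    show "set_lebesgue_integral lebesgue A (\<lambda>x. Re (u x)) = set_lebesgue_integral lebesgue A (\<lambda>_. 0)"
      using all[OF A] integral_Re[OF si[OF A, unfolded set_integrable_def]]
      by (simp add: set_lebesgue_integral_def)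
  qed (use u in auto)
  moreover have "AE x in lebesgue. Im (u x) = 0"
  proof (rule density_unique_real[where f' = "\<lambda>_. 0"])
    fix A :: "'a set" assume A: "A \<in> sets lebesgue"
    show "set_lebesgue_integral lebesgue A (\<lambda>x. Im (u x)) = set_lebesgue_integral lebesgue A (\<lambda>_. 0)"
      using all[OF A] integral_Im[OF si[OF A, unfolded set_integrable_def]]
      by (simp add: set_lebesgue_integral_def)
  qed (use u in auto)
  ultimately show ?thesis by eventually_elim (simp add: complex_eq_iff)
qed

text \<open>The indicator of the open set \<open>U \<inter> B\<close> is the limit of the Lipschitz functions
\<open>min 1 (n * infdist x (- (U \<inter> B)))\<close>, which vanish off \<open>B\<close>.\<close>

lemma AE_zero_of_lipschitz_tests:
  fixes u :: "'a::euclidean_space \<Rightarrow> complex"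
  assumes u: "integrable lebesgue u" and B: "open B" "B \<noteq> UNIV" "\<And>x. x \<notin> B \<Longrightarrow> u x = 0"
    and test: "\<And>(w :: 'a \<Rightarrow> real) L. 0 \<le> L \<Longrightarrow> (\<And>x y. \<bar>w x - w y\<bar> \<le> L * dist x y) \<Longrightarrow> (\<And>x. x \<notin> B \<Longrightarrow> w x = 0)
      \<Longrightarrow> (LINT x|lebesgue. w x *\<^sub>R u x) = 0"
  shows "AE x in lebesgue. u x = 0"
proof (rule AE_zero_of_open_integrals[OF u])
  fix U :: "'a set" assume U: "open U"
  define A where "A = - (U \<inter> B)"
  have A: "closed A" "A \<noteq> {}" using U B by (auto simp: A_def closed_Compl)
  define w where "w n x = min 1 (real n * infdist x A)" for n x
  have lip: "\<bar>w n x - w n y\<bar> \<le> real n * dist x y" for n x y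
  proof -
    have "\<bar>w n x - w n y\<bar> \<le> \<bar>real n * infdist x A - real n * infdist y A\<bar>" by (auto simp: w_def)
    also have "\<dots> = real n * \<bar>infdist x A - infdist y A\<bar>"
      by (simp add: abs_mult flip: right_diff_distrib)
    also have "\<dots> \<le> real n * dist x y" by (intro mult_left_mono infdist_triangle_abs) auto
    finally show ?thesis .
  qed
  have w0: "w n x = 0" if "x \<notin> B" for n x
    using that by (simp add: w_def A_def)
  have wcont: "continuous_on UNIV (w n)" for n
    unfolding w_def by (intro continuous_intros)
  have wm: "w n \<in> borel_measurable lebesgue" for n
    using borel_measurable_continuous_onI[OF wcont] by (simp add: measurable_completion)
  have int0: "(LINT x|lebesgue. w n x *\<^sub>R u x) = 0" for n
    using lip w0 by (intro test[of "real n"]) auto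
  have lim: "(\<lambda>n. w n x) \<longlonglongrightarrow> indicator (U \<inter> B) x" for x
  proof (cases "x \<in> U \<inter> B")
    case True
    then have pos: "0 < infdist x A" using A by (simp add: infdist_pos_not_in_closed A_def)
    obtain n0 :: nat where n0: "1 < real n0 * infdist x A" using reals_Archimedean3[OF pos] by blast
    have "w n x = 1" if "n0 \<le> n" for n
    proof -
      have "real n0 * infdist x A \<le> real n * infdist x A" using that pos by (intro mult_right_mono) auto
      then show ?thesis using n0 by (simp add: w_def)
    qed
    then have "\<forall>\<^sub>F n in sequentially. w n x = 1" by (auto simp: eventually_sequentially)
    then show ?thesis using True by (simp add: tendsto_eventually)
  next
    case False
    then show ?thesis by (simp add: w_def A_def)
  qed
  have "(\<lambda>n. LINT x|lebesgue. w n x *\<^sub>R u x) \<longlonglongrightarrow> (LINT x|lebesgue. indicator (U \<inter> B) x *\<^sub>R u x)"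
  proof (rule integral_dominated_convergence[where w = "\<lambda>x. norm (u x)"])
    show "(\<lambda>x. indicator (U \<inter> B) x *\<^sub>R u x) \<in> borel_measurable lebesgue"
      using U B(1) u by (intro borel_measurable_scaleR borel_measurable_indicator) (auto simp: sets_completionI_sets)
    show "AE x in lebesgue. (\<lambda>n. w n x *\<^sub>R u x) \<longlonglongrightarrow> indicator (U \<inter> B) x *\<^sub>R u x"
      using lim by (intro AE_I2 tendsto_intros)
    show "AE x in lebesgue. norm (w n x *\<^sub>R u x) \<le> norm (u x)" for n
    proof (rule AE_I2)
      fix x
      have "\<bar>w n x\<bar> \<le> 1" by (simp add: w_def infdist_nonneg abs_le_iff)
      then show "norm (w n x *\<^sub>R u x) \<le> norm (u x)" using mult_right_mono[of "\<bar>w n x\<bar>" 1 "norm (u x)"] by simp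
    qed
  qed (use u wm in \<open>auto intro!: borel_measurable_scaleR\<close>)
  then have "(LINT x|lebesgue. indicator (U \<inter> B) x *\<^sub>R u x) = 0" using int0 by (simp add: LIMSEQ_const_iff)
  also have "(\<lambda>x. indicator (U \<inter> B) x *\<^sub>R u x) = (\<lambda>x. indicator U x *\<^sub>R u x)"
    using B(3) by (auto simp: indicator_def fun_eq_iff)
  finally show "set_lebesgue_integral lebesgue U u = 0" by (simp add: set_lebesgue_integral_def)
qed

lemma Lp_norm_2_less:
  assumes "f \<in> borel_measurable lebesgue"
  shows "Lp_norm 2 UNIV f \<le> ennreal e \<longleftrightarrow> (\<integral>\<^sup>+x. ennreal ((norm (f x))\<^sup>2) \<partial>lebesgue) \<le> (ennreal e)\<^sup>2"
proof -
  have "(1::ennreal) \<le> 2" by simp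
  have sq: "ennpowr (ennreal e) 2 = (ennreal e)\<^sup>2"
    by (cases "0 \<le> e") (auto simp: ennpowr_ennreal ennreal_power ennreal_neg)
  show ?thesis
    using assms by (subst Lp_norm_le_iff) (auto simp: sq)
qed

text \<open>If \<open>g\<close> is a finite combination of basis elements then \<open>D\<close> is orthogonal to \<open>g\<close>, whence
\<open>\<parallel>D\<parallel> \<le> \<parallel>D - g\<parallel>\<close>; and \<open>\<parallel>D - g\<parallel>\<close> can be made arbitrarily small.\<close>

lemma tame_orthogonal_imp_zero:
  fixes D :: "real ^ 'd \<Rightarrow> complex"
  assumes basis: "orthogonal_basis_L2 I e" and e: "\<And>a. a \<in> I \<Longrightarrow> tame (e a)"
    and D: "tame D" and orth: "\<And>a. a \<in> I \<Longrightarrow> (LINT x|lebesgue. D x * cnj (e a x)) = 0"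
  shows "AE x in lebesgue. D x = 0"
proof -
  have sq: "tame (\<lambda>x. g x * cnj (g x))" if "tame g" for g :: "real ^ 'd \<Rightarrow> complex"
    using that by (intro tame_mult tame_cnj)
  have int_sq: "integrable lebesgue (\<lambda>x. (norm (g x))\<^sup>2)" if "tame g" for g :: "real ^ 'd \<Rightarrow> complex"
    using integrable_Re[OF tame_integrable[OF sq[OF that]]] by (simp only: complex_norm_square[symmetric] Re_complex_of_real)
  have nn_sq: "(\<integral>\<^sup>+x. ennreal ((norm (g x))\<^sup>2) \<partial>lebesgue) = ennreal (LINT x|lebesgue. (norm (g x))\<^sup>2)"
    if "tame g" for g :: "real ^ 'd \<Rightarrow> complex"
    by (rule nn_integral_eq_integral[OF int_sq[OF that]]) simp
  have "(ennreal (sqrt (LINT x|lebesgue. (norm (D x))\<^sup>2)))\<^sup>2 = ennreal (LINT x|lebesgue. (norm (D x))\<^sup>2)"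
    by (subst ennreal_power) simp_all
  then have "Lp_norm 2 UNIV D \<le> ennreal (sqrt (LINT x|lebesgue. (norm (D x))\<^sup>2))"
    unfolding Lp_norm_2_less[OF tame_measurable[OF D]] nn_sq[OF D] by simp
  then have "Lp_norm 2 UNIV D < \<infinity>" by (rule le_less_trans) simp
  then have "D \<in> Lp 2" using tame_measurable[OF D] by (simp add: Lp_def)
  have small: "(LINT x|lebesgue. (norm (D x))\<^sup>2) \<le> \<epsilon>\<^sup>2" if \<epsilon>: "0 < \<epsilon>" for \<epsilon>
  proof -
    have dense: "\<forall>g\<in>Lp 2. \<forall>\<epsilon>>0. \<exists>F c. finite F \<and> F \<subseteq> I \<and>
        Lp_norm 2 UNIV (\<lambda>x. g x - (\<Sum>a\<in>F. c a * e a x)) < ennreal \<epsilon>"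
      using basis unfolding orthogonal_basis_L2_def by (elim conjE)
    obtain F c where F: "finite F" "F \<subseteq> I" and
      approx: "Lp_norm 2 UNIV (\<lambda>x. D x - (\<Sum>a\<in>F. c a * e a x)) < ennreal \<epsilon>"
      using dense[rule_format, OF \<open>D \<in> Lp 2\<close> \<epsilon>] by (elim exE conjE)
    define g where "g x = (\<Sum>a\<in>F. c a * e a x)" for x
    have g: "tame g" unfolding g_def using F e by (intro tame_sum tame_cmult) auto
    have Dg: "tame (\<lambda>x. D x - g x)" by (intro tame_diff D g)
    have cross: "tame (\<lambda>x. D x * cnj (g x))" by (intro tame_mult tame_cnj D g)
    have "(LINT x|lebesgue. D x * cnj (g x)) = (LINT x|lebesgue. (\<Sum>a\<in>F. cnj (c a) * (D x * cnj (e a x))))"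
      by (simp add: g_def sum_distrib_left mult_ac)
    also have "\<dots> = (\<Sum>a\<in>F. cnj (c a) * (LINT x|lebesgue. D x * cnj (e a x)))"
      using F e D by (subst Bochner_Integration.integral_sum)
        (auto intro!: tame_integrable tame_cmult tame_mult tame_cnj)
    also have "\<dots> = 0" using F orth by (auto intro!: sum.neutral)
    finally have cross0: "(LINT x|lebesgue. Re (D x * cnj (g x))) = 0"
      using integral_Re[OF tame_integrable[OF cross]] by simp
    have "(norm (D x - g x))\<^sup>2 = (norm (D x))\<^sup>2 + (norm (g x))\<^sup>2 - 2 * Re (D x * cnj (g x))" for x
      unfolding cmod_power2 by (simp add: power2_eq_square algebra_simps)
    then have "(LINT x|lebesgue. (norm (D x - g x))\<^sup>2)
        = (LINT x|lebesgue. (norm (D x))\<^sup>2 + (norm (g x))\<^sup>2 - 2 * Re (D x * cnj (g x)))"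
      by (simp only:)
    also have "\<dots> = (LINT x|lebesgue. (norm (D x))\<^sup>2) + (LINT x|lebesgue. (norm (g x))\<^sup>2)
        - 2 * (LINT x|lebesgue. Re (D x * cnj (g x)))"
      using int_sq[OF D] int_sq[OF g] integrable_Re[OF tame_integrable[OF cross]]
      by (simp del: times_complex.sel complex_cnj)
    finally have "(LINT x|lebesgue. (norm (D x - g x))\<^sup>2)
        = (LINT x|lebesgue. (norm (D x))\<^sup>2) + (LINT x|lebesgue. (norm (g x))\<^sup>2)"
      unfolding cross0 by simp
    moreover have "0 \<le> (LINT x|lebesgue. (norm (g x))\<^sup>2)" by simp
    moreover have "(LINT x|lebesgue. (norm (D x - g x))\<^sup>2) \<le> \<epsilon>\<^sup>2"
    proof -
      have "(\<integral>\<^sup>+x. ennreal ((norm (D x - g x))\<^sup>2) \<partial>lebesgue) \<le> (ennreal \<epsilon>)\<^sup>2"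
        using less_imp_le[OF approx] Lp_norm_2_less[OF tame_measurable[OF Dg], of \<epsilon>] by (simp add: g_def)
      then show ?thesis using \<epsilon> by (simp add: nn_sq[OF Dg] ennreal_power)
    qed
    ultimately show ?thesis by linarith
  qed
  have "(LINT x|lebesgue. (norm (D x))\<^sup>2) \<le> 0"
  proof (rule field_le_epsilon)
    fix \<epsilon> :: real assume "0 < \<epsilon>"
    then show "(LINT x|lebesgue. (norm (D x))\<^sup>2) \<le> 0 + \<epsilon>" using small[of "sqrt \<epsilon>"] by simp
  qed
  then have "(LINT x|lebesgue. (norm (D x))\<^sup>2) = 0" by (simp add: antisym)
  then show ?thesis using integral_nonneg_eq_0_iff_AE[OF int_sq[OF D]] by simp
qed

section \<open>Local expansion in an orthogonal basis\<close>

lemma basis_norm_pos: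
  fixes e :: "'i \<Rightarrow> real ^ 'd \<Rightarrow> complex"
  assumes basis: "orthogonal_basis_L2 I e" and "a \<in> I" and e: "tame (e a)"
  shows "(LINT x|lebesgue. e a x * cnj (e a x)) = complex_of_real (LINT x|lebesgue. (norm (e a x))\<^sup>2)"
    and "0 < (LINT x|lebesgue. (norm (e a x))\<^sup>2)"
proof -
  show eq: "(LINT x|lebesgue. e a x * cnj (e a x)) = complex_of_real (LINT x|lebesgue. (norm (e a x))\<^sup>2)"
    by (simp add: complex_norm_square[symmetric] flip: integral_complex_of_real)
  have int: "integrable lebesgue (\<lambda>x. (norm (e a x))\<^sup>2)"
    using integrable_Re[OF tame_integrable[OF tame_mult[OF e tame_cnj[OF e]]]]
    by (simp only: complex_norm_square[symmetric] Re_complex_of_real)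
  have "Lp_norm 2 UNIV (e a) \<noteq> 0" using basis assms(2) by (auto simp: orthogonal_basis_L2_def)
  then have "\<not> Lp_norm 2 UNIV (e a) \<le> ennreal 0" by simp
  then have "(\<integral>\<^sup>+x. ennreal ((norm (e a x))\<^sup>2) \<partial>lebesgue) \<noteq> 0"
    using Lp_norm_2_less[OF tame_measurable[OF e], of 0] by auto
  then have "(LINT x|lebesgue. (norm (e a x))\<^sup>2) \<noteq> 0"
    using nn_integral_eq_integral[OF int] by auto
  moreover have "0 \<le> (LINT x|lebesgue. (norm (e a x))\<^sup>2)" by simp
  ultimately show "0 < (LINT x|lebesgue. (norm (e a x))\<^sup>2)" by linarith
qed

lemma integral_sum_cmult:
  fixes g :: "'i \<Rightarrow> 'a \<Rightarrow> complex"
  assumes "\<And>a. a \<in> A \<Longrightarrow> integrable M (g a)"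
  shows "(LINT x|M. (\<Sum>a\<in>A. c a * g a x)) = (\<Sum>a\<in>A. c a * (LINT x|M. g a x))"
  using assms by (subst Bochner_Integration.integral_sum) auto

text \<open>The basis elements that do not vanish on \<open>B\<close> are distributed over finite levels \<open>\<Lambda> n\<close>, along
which the expansions are summed.\<close>

locale local_expansion =
  fixes I :: "'i set" and e :: "'i \<Rightarrow> real ^ 'd \<Rightarrow> complex" and \<Lambda> :: "nat \<Rightarrow> 'i set"
    and B :: "(real ^ 'd) set"
  assumes basis: "orthogonal_basis_L2 I e"
    and tame_e: "\<And>a. a \<in> I \<Longrightarrow> tame (e a)"
    and fin: "\<And>n. finite (\<Lambda> n)" and sub: "\<And>n. \<Lambda> n \<subseteq> I"
    and disj: "\<And>m n. m \<noteq> n \<Longrightarrow> \<Lambda> m \<inter> \<Lambda> n = {}"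
    and cover: "\<And>a x. a \<in> I \<Longrightarrow> x \<in> B \<Longrightarrow> e a x \<noteq> 0 \<Longrightarrow> \<exists>n. a \<in> \<Lambda> n"
begin

definition \<nu> :: "'i \<Rightarrow> real" where
  "\<nu> a = (LINT x|lebesgue. (norm (e a x))\<^sup>2)"

text \<open>\<open>Q w n\<close> is the part of the orthogonal expansion of a test function \<open>w\<close> that belongs to level \<open>n\<close>.
The layers \<open>F f n\<close> of a locally integrable function \<open>f\<close> are formed by the transposed operator, which
is the expansion in the conjugate basis: pairings with \<open>e a\<close> come without conjugation, as in the
definition of wavelet coefficients.\<close>

definition Q :: "(real ^ 'd \<Rightarrow> complex) \<Rightarrow> nat \<Rightarrow> real ^ 'd \<Rightarrow> complex" where
  "Q w n x = (\<Sum>a\<in>\<Lambda> n. (LINT y|lebesgue. w y * cnj (e a y)) / \<nu> a * e a x)"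

definition F :: "(real ^ 'd \<Rightarrow> complex) \<Rightarrow> nat \<Rightarrow> real ^ 'd \<Rightarrow> complex" where
  "F f n x = (\<Sum>a\<in>\<Lambda> n. (LINT y|lebesgue. f y * e a y) / \<nu> a * cnj (e a x))"

lemma \<nu>_pos: "a \<in> I \<Longrightarrow> 0 < \<nu> a"
  using basis_norm_pos(2)[OF basis _ tame_e] by (simp add: \<nu>_def)

lemma inner_eq:
  assumes "a \<in> I" "b \<in> I"
  shows "(LINT x|lebesgue. e a x * cnj (e b x)) = (if a = b then of_real (\<nu> a) else 0)"
  using basis_norm_pos(1)[OF basis assms(1) tame_e[OF assms(1)]] basis assms
  by (auto simp: \<nu>_def orthogonal_basis_L2_def)

lemma tame_Q: "tame (Q w n)"
  unfolding Q_def[abs_def] using sub tame_e by (intro tame_sum tame_cmult) auto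

lemma tame_F: "tame (F f n)"
  unfolding F_def[abs_def] using sub tame_e by (intro tame_sum tame_cmult tame_cnj) auto

lemma Q_coefficient:
  assumes "b \<in> I"
  shows "(LINT x|lebesgue. Q w n x * cnj (e b x)) =
    (if b \<in> \<Lambda> n then (LINT y|lebesgue. w y * cnj (e b y)) else 0)"
proof -
  have aI: "a \<in> \<Lambda> n \<Longrightarrow> a \<in> I" for a using sub by auto
  have "(LINT x|lebesgue. Q w n x * cnj (e b x))
      = (LINT x|lebesgue. (\<Sum>a\<in>\<Lambda> n. (LINT y|lebesgue. w y * cnj (e a y)) / \<nu> a * (e a x * cnj (e b x))))"
    by (simp only: Q_def sum_distrib_right mult.assoc)
  also have "\<dots> = (\<Sum>a\<in>\<Lambda> n. (LINT y|lebesgue. w y * cnj (e a y)) / \<nu> a * (LINT x|lebesgue. e a x * cnj (e b x)))"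
    by (intro integral_sum_cmult tame_integrable tame_mult tame_cnj tame_e aI assms)
  also have "\<dots> = (\<Sum>a\<in>\<Lambda> n. if a = b then (LINT y|lebesgue. w y * cnj (e b y)) else 0)"
  proof (rule sum.cong[OF refl])
    fix a assume "a \<in> \<Lambda> n"
    then have "\<nu> a \<noteq> 0" "a \<in> I" using \<nu>_pos[of a] aI by auto
    then show "(LINT y|lebesgue. w y * cnj (e a y)) / \<nu> a * (LINT x|lebesgue. e a x * cnj (e b x))
        = (if a = b then (LINT y|lebesgue. w y * cnj (e b y)) else 0)"
      using assms inner_eq[of a b] by (cases "a = b") auto
  qed
  also have "\<dots> = (if b \<in> \<Lambda> n then (LINT y|lebesgue. w y * cnj (e b y)) else 0)"
    using fin by simp
  finally show ?thesis .
qed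

text \<open>By uniform convergence, the sum of the series has the same basis coefficients as \<open>w\<close>; elements of
the basis that belong to no level vanish on \<open>B\<close> and are orthogonal to \<open>w\<close>. Completeness of the
basis does the rest.\<close>

lemma test_expansion:
  assumes w: "tame w" and w0: "\<And>x. x \<notin> B \<Longrightarrow> w x = 0"
    and q: "summable q" "\<And>n x. norm (Q w n x) \<le> q n" and \<rho>: "\<And>n x. \<rho> \<le> norm x \<Longrightarrow> Q w n x = 0"
  shows "AE x in lebesgue. w x = (\<Sum>n. Q w n x)"
proof -
  have q0: "0 \<le> q n" for n using order_trans[OF norm_ge_zero q(2)[of n 0]] .
  have sn: "summable (\<lambda>n. norm (Q w n x))" for x
    using q by (intro summable_comparison_test'[OF q(1)]) auto
  define W where "W x = (\<Sum>n. Q w n x)" for x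
  have W: "tame W"
  proof (rule tameI)
    show "W \<in> borel_measurable lebesgue" unfolding W_def
      using tame_Q by (intro borel_measurable_suminf tame_measurable)
    show "norm (W x) \<le> suminf q" for x
    proof -
      have "norm (W x) \<le> (\<Sum>n. norm (Q w n x))" unfolding W_def by (rule summable_norm[OF sn])
      also have "\<dots> \<le> suminf q" using q sn by (intro suminf_le) auto
      finally show ?thesis .
    qed
    show "W x = 0" if "\<rho> \<le> norm x" for x using \<rho>[OF that] by (simp add: W_def)
  qed
  have "AE x in lebesgue. w x - W x = 0"
  proof (rule tame_orthogonal_imp_zero[OF basis tame_e])
    show "tame (\<lambda>x. w x - W x)" by (intro tame_diff w W)
    fix b assume b: "b \<in> I"
    have eb: "tame (\<lambda>x. cnj (e b x))" using tame_e b by (intro tame_cnj)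
    have "(LINT x|lebesgue. W x * cnj (e b x)) = (LINT x|lebesgue. (\<Sum>n. Q w n x * cnj (e b x)))"
      unfolding W_def using summable_norm_cancel[OF sn] by (simp add: suminf_mult2)
    also have "\<dots> = (\<Sum>n. LINT x|lebesgue. Q w n x * cnj (e b x))"
    proof (rule integral_suminf)
      show int: "integrable lebesgue (\<lambda>x. Q w n x * cnj (e b x))" for n
        by (intro tame_integrable tame_mult tame_Q eb)
      show "AE x in lebesgue. summable (\<lambda>n. norm (Q w n x * cnj (e b x)))"
        using sn by (intro AE_I2) (simp add: norm_mult summable_mult2)
      have "norm (LINT x|lebesgue. norm (Q w n x * cnj (e b x))) \<le> q n * (LINT x|lebesgue. norm (cnj (e b x)))" for n
      proof -
        have "(LINT x|lebesgue. norm (Q w n x * cnj (e b x))) \<le> (LINT x|lebesgue. q n * norm (cnj (e b x)))"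
          using int q(2) tame_integrable[OF eb]
          by (intro integral_mono integrable_norm integrable_mult_right)
            (auto simp: norm_mult intro!: mult_right_mono)
        then show ?thesis by simp
      qed
      then show "summable (\<lambda>n. LINT x|lebesgue. norm (Q w n x * cnj (e b x)))"
        using q(1) by (intro summable_comparison_test'[OF summable_mult2[OF q(1)]])
    qed
    also have "\<dots> = (LINT x|lebesgue. w x * cnj (e b x))"
    proof (cases "\<exists>n. b \<in> \<Lambda> n")
      case True
      then obtain n where n: "b \<in> \<Lambda> n" by blast
      then have "b \<in> \<Lambda> m \<longleftrightarrow> m = n" for m using disj[of m n] by blast
      then have "(\<lambda>m. LINT x|lebesgue. Q w m x * cnj (e b x))
          = (\<lambda>m. if m = n then (LINT x|lebesgue. w x * cnj (e b x)) else 0)"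
        using b by (auto simp: Q_coefficient fun_eq_iff)
      then show ?thesis using sums_unique[OF sums_single[of n "\<lambda>_. LINT x|lebesgue. w x * cnj (e b x)"]] by simp
    next
      case False
      then have "(\<lambda>x. w x * cnj (e b x)) = (\<lambda>x. 0)" using cover[OF b] w0 by fastforce
      then have "(LINT x|lebesgue. w x * cnj (e b x)) = 0" by (simp only:) simp
      then show ?thesis using False b by (simp add: Q_coefficient)
    qed
    finally show "(LINT x|lebesgue. (w x - W x) * cnj (e b x)) = 0"
      using tame_integrable[OF tame_mult[OF w eb]] tame_integrable[OF tame_mult[OF W eb]]
      by (simp add: left_diff_distrib)
  qed
  then show ?thesis by eventually_elim (simp add: W_def)
qed

lemma integral_exchange:
  assumes f: "locally_integrable f" and w: "tame w"
  shows "(LINT x|lebesgue. f x * Q w n x) = (LINT x|lebesgue. F f n x * w x)"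
proof -
  have aI: "a \<in> \<Lambda> n \<Longrightarrow> a \<in> I" for a using sub by auto
  have "(LINT x|lebesgue. f x * Q w n x)
      = (LINT x|lebesgue. (\<Sum>a\<in>\<Lambda> n. (LINT y|lebesgue. w y * cnj (e a y)) / \<nu> a * (f x * e a x)))"
    by (simp add: Q_def sum_distrib_left mult_ac)
  also have "\<dots> = (\<Sum>a\<in>\<Lambda> n. (LINT y|lebesgue. w y * cnj (e a y)) / \<nu> a * (LINT x|lebesgue. f x * e a x))"
    by (intro integral_sum_cmult integrable_times_tame f tame_e aI)
  also have "\<dots> = (\<Sum>a\<in>\<Lambda> n. (LINT x|lebesgue. f x * e a x) / \<nu> a * (LINT y|lebesgue. w y * cnj (e a y)))"
    by (simp add: mult_ac)
  also have "\<dots> = (LINT x|lebesgue. (\<Sum>a\<in>\<Lambda> n. (LINT x|lebesgue. f x * e a x) / \<nu> a * (w x * cnj (e a x))))"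
    by (intro integral_sum_cmult[symmetric] tame_integrable tame_mult tame_cnj w tame_e aI)
  also have "\<dots> = (LINT x|lebesgue. F f n x * w x)"
    by (simp add: F_def sum_distrib_left sum_distrib_right mult_ac)
  finally show ?thesis .
qed

text \<open>The series of layers converges absolutely by assumption; what has to be shown is that its sum is
\<open>f\<close>. Paired with a Lipschitz function \<open>w\<close> supported in \<open>B\<close>, the sum gives
\<open>\<Sum>n. \<integral> F f n * w = \<Sum>n. \<integral> f * Q w n = \<integral> f * w\<close>, where the last step is the uniformly convergent
expansion of \<open>w\<close>. So regularity is required of the test functions only.\<close>

lemma expansion_AE:
  assumes B: "open B" "bounded B" and f: "locally_integrable f"
    and abs_conv: "(\<integral>\<^sup>+x. (\<Sum>n. ennreal (norm (F f n x))) * indicator B x \<partial>lebesgue) < \<infinity>"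
    and test: "\<And>(w :: real ^ 'd \<Rightarrow> real) L. 0 \<le> L \<Longrightarrow> (\<And>x y. \<bar>w x - w y\<bar> \<le> L * dist x y) \<Longrightarrow> (\<And>x. x \<notin> B \<Longrightarrow> w x = 0)
      \<Longrightarrow> \<exists>q \<rho>. summable q \<and> (\<forall>n x. norm (Q (\<lambda>x. of_real (w x)) n x) \<le> q n) \<and>
        (\<forall>n x. \<rho> \<le> norm x \<longrightarrow> Q (\<lambda>x. of_real (w x)) n x = 0)"
  shows "AE x in lebesgue. x \<in> B \<longrightarrow> summable (\<lambda>n. norm (F f n x)) \<and> f x = (\<Sum>n. F f n x)"
proof -
  have Bm: "B \<in> sets lebesgue" using borel_open[OF B(1)] by (simp add: sets_completionI_sets)
  have fm: "f \<in> borel_measurable lebesgue" using f by (simp add: locally_integrable_def)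
  have Fm: "F f n \<in> borel_measurable lebesgue" for n by (intro tame_measurable tame_F)
  obtain r where r: "B \<subseteq> ball 0 r" using B(2) bounded_subset_ballD by blast
  have "(\<lambda>x. (\<Sum>n. ennreal (norm (F f n x))) * indicator B x) \<in> borel_measurable lebesgue"
    using Fm Bm by (intro borel_measurable_times_ennreal borel_measurable_suminf_order borel_measurable_indicator) auto
  then have "AE x in lebesgue. (\<Sum>n. ennreal (norm (F f n x))) * indicator B x \<noteq> \<infinity>"
    using abs_conv by (intro nn_integral_noteq_infinite) auto
  then have summ: "AE x in lebesgue. x \<in> B \<longrightarrow> summable (\<lambda>n. norm (F f n x))"
    by eventually_elim (auto intro!: summable_suminf_not_top)
  define G where "G x = (\<Sum>n. F f n x)" for x
  have Gm: "G \<in> borel_measurable lebesgue" unfolding G_def using Fm by (rule borel_measurable_suminf)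
  define FB where "FB n x = indicator B x *\<^sub>R F f n x" for n x
  have FBi: "integrable lebesgue (FB n)" for n
    unfolding FB_def using Bm by (intro integrable_mult_indicator tame_integrable tame_F)
  have FBsumm: "AE x in lebesgue. summable (\<lambda>n. norm (FB n x))"
    using summ by eventually_elim (auto simp: FB_def indicator_def)
  have FBnorm: "summable (\<lambda>n. LINT x|lebesgue. norm (FB n x))"
  proof (rule summable_suminf_not_top)
    have "(\<Sum>n. ennreal (LINT x|lebesgue. norm (FB n x))) = (\<Sum>n. \<integral>\<^sup>+x. ennreal (norm (FB n x)) \<partial>lebesgue)"
      using FBi by (intro suminf_cong nn_integral_eq_integral[symmetric] integrable_norm) auto
    also have "\<dots> = (\<integral>\<^sup>+x. (\<Sum>n. ennreal (norm (FB n x))) \<partial>lebesgue)"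
      using FBi by (subst nn_integral_suminf) auto
    also have "\<dots> = (\<integral>\<^sup>+x. (\<Sum>n. ennreal (norm (F f n x))) * indicator B x \<partial>lebesgue)"
    proof (rule nn_integral_cong)
      fix x
      show "(\<Sum>n. ennreal (norm (FB n x))) = (\<Sum>n. ennreal (norm (F f n x))) * indicator B x"
        by (cases "x \<in> B") (simp_all add: FB_def)
    qed
    finally show "(\<Sum>n. ennreal (LINT x|lebesgue. norm (FB n x))) \<noteq> top" using abs_conv by simp
  qed simp
  have GB: "(\<lambda>x. \<Sum>n. FB n x) = (\<lambda>x. indicator B x *\<^sub>R G x)"
  proof
    fix x
    show "(\<Sum>n. FB n x) = indicator B x *\<^sub>R G x"
      by (cases "x \<in> B") (simp_all add: FB_def G_def)
  qed
  have GBi: "integrable lebesgue (\<lambda>x. indicator B x *\<^sub>R G x)"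
    using integrable_suminf[OF FBi FBsumm FBnorm] unfolding GB .
  have fBi: "integrable lebesgue (\<lambda>x. indicator B x *\<^sub>R f x)"
  proof (rule Bochner_Integration.integrable_bound)
    show "integrable lebesgue (\<lambda>x. indicator (ball 0 r) x *\<^sub>R f x)"
      using f by (simp add: locally_integrable_def)
    show "AE x in lebesgue. norm (indicator B x *\<^sub>R f x) \<le> norm (indicator (ball 0 r) x *\<^sub>R f x)"
      using r by (intro AE_I2) (auto simp: indicator_def)
  qed (use Bm fm in \<open>auto intro!: borel_measurable_scaleR borel_measurable_indicator\<close>)
  define u where "u x = indicator B x *\<^sub>R f x - indicator B x *\<^sub>R G x" for x
  have ui: "integrable lebesgue u" unfolding u_def using fBi GBi by (rule Bochner_Integration.integrable_diff)
  have "AE x in lebesgue. u x = 0"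
  proof (rule AE_zero_of_lipschitz_tests[OF ui B(1)])
    show "B \<noteq> UNIV" using B(2) not_bounded_UNIV by blast
    show "u x = 0" if "x \<notin> B" for x using that by (simp add: u_def)
    fix w :: "real ^ 'd \<Rightarrow> real" and L :: real
    assume L: "0 \<le> L" and lip: "\<And>x y. \<bar>w x - w y\<bar> \<le> L * dist x y" and w0: "\<And>x. x \<notin> B \<Longrightarrow> w x = 0"
    define v where "v x = complex_of_real (w x)" for x
    have v: "tame v" unfolding v_def using L lip w0 B(2) by (rule tame_lipschitz)
    obtain q \<rho> where q: "summable q" "\<And>n x. norm (Q v n x) \<le> q n" "\<And>n x. \<rho> \<le> norm x \<Longrightarrow> Q v n x = 0"
      using test[OF L lip w0] unfolding v_def by blast
    have q0: "0 \<le> q n" for n using order_trans[OF norm_ge_zero q(2)[of n 0]] .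
    have vB: "\<And>x. x \<notin> B \<Longrightarrow> v x = 0" using w0 by (simp add: v_def)
    have vexp: "AE x in lebesgue. v x = (\<Sum>n. Q v n x)"
      using test_expansion[OF v vB q(1,2,3)] by blast
    have sn: "summable (\<lambda>n. norm (Q v n x))" for x
      using q by (intro summable_comparison_test'[OF q(1)]) auto
    \<comment> \<open>\<open>f\<close> is only locally integrable, but all \<open>Q v n\<close> vanish off the same
      ball\<close>
    define f\<rho> where "f\<rho> x = indicator (ball 0 \<rho>) x *\<^sub>R f x" for x
    have f\<rho>i: "integrable lebesgue f\<rho>" using f by (simp add: f\<rho>_def[abs_def] locally_integrable_def)
    have fQ: "f x * Q v n x = f\<rho> x * Q v n x" for x n
      using q(3)[of x n] by (cases "norm x < \<rho>") (auto simp: f\<rho>_def)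
    have fQi: "integrable lebesgue (\<lambda>x. f x * Q v n x)" for n
      by (intro integrable_times_tame f tame_Q)
    have "(LINT x|lebesgue. f x * v x) = (LINT x|lebesgue. (\<Sum>n. f x * Q v n x))"
    proof (rule integral_cong_AE)
      show "AE x in lebesgue. f x * v x = (\<Sum>n. f x * Q v n x)"
        using vexp by eventually_elim (simp add: suminf_mult summable_norm_cancel[OF sn])
      show "(\<lambda>x. f x * v x) \<in> borel_measurable lebesgue"
        by (intro borel_measurable_times fm tame_measurable[OF v])
      show "(\<lambda>x. \<Sum>n. f x * Q v n x) \<in> borel_measurable lebesgue"
        using fQi by (intro borel_measurable_suminf borel_measurable_integrable)
    qed
    also have "\<dots> = (\<Sum>n. LINT x|lebesgue. f x * Q v n x)"
    proof (rule integral_suminf[OF fQi])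
      show "AE x in lebesgue. summable (\<lambda>n. norm (f x * Q v n x))"
        using sn by (intro AE_I2) (simp add: norm_mult summable_mult)
      have "norm (LINT x|lebesgue. norm (f x * Q v n x)) \<le> q n * (LINT x|lebesgue. norm (f\<rho> x))" for n
      proof -
        have "(LINT x|lebesgue. norm (f x * Q v n x)) \<le> (LINT x|lebesgue. q n * norm (f\<rho> x))"
        proof (rule integral_mono)
          show "norm (f x * Q v n x) \<le> q n * norm (f\<rho> x)" for x
            unfolding fQ norm_mult using q(2)[of n x] by (subst mult.commute) (rule mult_right_mono, auto)
        qed (use f\<rho>i fQi in auto)
        then show ?thesis by simp
      qed
      then show "summable (\<lambda>n. LINT x|lebesgue. norm (f x * Q v n x))"
        by (intro summable_comparison_test'[OF summable_mult2[OF q(1)]])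
    qed
    also have "\<dots> = (\<Sum>n. LINT x|lebesgue. F f n x * v x)" by (simp add: integral_exchange[OF f v])
    also have "\<dots> = (\<Sum>n. LINT x|lebesgue. FB n x * v x)"
      by (intro suminf_cong Bochner_Integration.integral_cong) (use vB in \<open>auto simp: FB_def indicator_def\<close>)
    also have "\<dots> = (LINT x|lebesgue. (\<Sum>n. FB n x * v x))"
    proof (rule integral_suminf[symmetric])
      obtain K where K: "0 \<le> K" "\<And>x. norm (v x) \<le> K" using tameE[OF v] by metis
      have eq: "(\<lambda>x. FB n x * v x) = (\<lambda>x. F f n x * v x)" for n
        using vB by (auto simp: FB_def indicator_def fun_eq_iff)
      show int: "integrable lebesgue (\<lambda>x. FB n x * v x)" for n
        unfolding eq by (intro tame_integrable tame_mult tame_F v)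
      show "AE x in lebesgue. summable (\<lambda>n. norm (FB n x * v x))"
        using FBsumm by eventually_elim (simp add: norm_mult summable_mult2)
      have "norm (LINT x|lebesgue. norm (FB n x * v x)) \<le> (LINT x|lebesgue. norm (FB n x)) * K" for n
      proof -
        have "(LINT x|lebesgue. norm (FB n x * v x)) \<le> (LINT x|lebesgue. norm (FB n x) * K)"
          using int FBi K by (intro integral_mono integrable_norm integrable_mult_left)
            (auto simp: norm_mult intro!: mult_left_mono)
        then show ?thesis by simp
      qed
      then show "summable (\<lambda>n. LINT x|lebesgue. norm (FB n x * v x))"
        by (intro summable_comparison_test'[OF summable_mult2[OF FBnorm]])
    qed
    also have "\<dots> = (LINT x|lebesgue. indicator B x *\<^sub>R G x * v x)"
    proof (rule integral_cong_AE)
      show "AE x in lebesgue. (\<Sum>n. FB n x * v x) = indicator B x *\<^sub>R G x * v x"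
        using FBsumm
      proof eventually_elim
        case (elim x)
        then show ?case using suminf_mult2[OF summable_norm_cancel[OF elim], of "v x"] fun_cong[OF GB, of x]
          by simp
      qed
      show "(\<lambda>x. \<Sum>n. FB n x * v x) \<in> borel_measurable lebesgue"
        by (intro borel_measurable_suminf borel_measurable_times tame_measurable[OF v] borel_measurable_integrable[OF FBi])
      show "(\<lambda>x. indicator B x *\<^sub>R G x * v x) \<in> borel_measurable lebesgue"
        by (intro borel_measurable_times tame_measurable[OF v] borel_measurable_integrable[OF GBi])
    qed
    finally have eq: "(LINT x|lebesgue. f x * v x) = (LINT x|lebesgue. indicator B x *\<^sub>R G x * v x)" .
    have fv: "f x * v x = indicator B x *\<^sub>R f x * v x" for x using vB by (auto simp: indicator_def)
    obtain K where K: "0 \<le> K" "\<And>x. norm (v x) \<le> K" using tameE[OF v] by metis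
    have int: "integrable lebesgue (\<lambda>x. indicator B x *\<^sub>R f x * v x)"
      using integrable_times_tame[OF f v] unfolding fv .
    have int': "integrable lebesgue (\<lambda>x. indicator B x *\<^sub>R G x * v x)"
    proof (rule Bochner_Integration.integrable_bound)
      show "integrable lebesgue (\<lambda>x. norm (indicator B x *\<^sub>R G x) * K)"
        using GBi by (intro integrable_mult_left integrable_norm)
      show "(\<lambda>x. indicator B x *\<^sub>R G x * v x) \<in> borel_measurable lebesgue"
        by (intro borel_measurable_times tame_measurable[OF v] borel_measurable_integrable[OF GBi])
      show "AE x in lebesgue. norm (indicator B x *\<^sub>R G x * v x) \<le> norm (norm (indicator B x *\<^sub>R G x) * K)"
      proof (rule AE_I2)
        fix x
        have "norm (indicator B x *\<^sub>R G x * v x) \<le> norm (indicator B x *\<^sub>R G x) * K"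
          unfolding norm_mult[of _ "v x"] using K by (intro mult_left_mono) auto
        then show "norm (indicator B x *\<^sub>R G x * v x) \<le> norm (norm (indicator B x *\<^sub>R G x) * K)"
          unfolding real_norm_def by linarith
      qed
    qed
    have "(LINT x|lebesgue. w x *\<^sub>R u x)
        = (LINT x|lebesgue. indicator B x *\<^sub>R f x * v x - indicator B x *\<^sub>R G x * v x)"
      by (intro Bochner_Integration.integral_cong) (auto simp: u_def v_def scaleR_conv_of_real algebra_simps)
    also have "\<dots> = 0" using int int' eq unfolding fv by simp
    finally show "(LINT x|lebesgue. w x *\<^sub>R u x) = 0" .
  qed
  then show ?thesis using summ by eventually_elim (auto simp: u_def G_def)
qed

end

section \<open>Growth of admissible sequences\<close>

text \<open>Fekete's lemma on subadditive sequences. If \<open>a N / N\<close> is close to the infimum \<open>L\<close> of all the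
quotients, then division with remainder by \<open>N\<close> bounds \<open>a n / n\<close> by \<open>a N / N + O(1 / n)\<close>.\<close>

lemma fekete:
  fixes a :: "nat \<Rightarrow> real"
  assumes subadd: "\<And>i j. a (i + j) \<le> a i + a j" and lower: "\<And>j. - K * real j \<le> a j"
  shows "convergent (\<lambda>j. a j / real j)"
proof -
  define L where "L = (INF j\<in>{1..}. a j / real j)"
  have bdd: "bdd_below ((\<lambda>j. a j / real j) ` {1..})"
  proof (rule bdd_belowI2)
    fix j :: nat assume "j \<in> {1..}"
    then show "- K \<le> a j / real j" using lower[of j] by (simp add: field_simps)
  qed
  have lim: "(\<lambda>j. a j / real j) \<longlonglongrightarrow> L"
  proof (rule LIMSEQ_I)
    fix \<epsilon> :: real assume \<epsilon>: "0 < \<epsilon>"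
    have "\<exists>N\<in>{1..}. a N / real N < L + \<epsilon> / 2"
    proof (rule ccontr)
      assume "\<not> ?thesis"
      then have "L + \<epsilon> / 2 \<le> L" unfolding L_def by (intro cINF_greatest) (auto simp: not_less)
      then show False using \<epsilon> by simp
    qed
    then obtain N where N: "1 \<le> N" "a N / real N < L + \<epsilon> / 2" by auto
    define M where "M = Max ((\<lambda>r. \<bar>a r\<bar>) ` {..<N})"
    have M: "\<bar>a r\<bar> \<le> M" if "r < N" for r unfolding M_def using that by (intro Max_ge) auto
    have M0: "0 \<le> M" using M[of 0] N by auto
    define K' where "K' = real N * \<bar>a N / real N\<bar> + M"
    have K'0: "0 \<le> K'" using M0 by (simp add: K'_def)
    have mult: "a (q * N + r) \<le> real q * a N + a r" for q r
    proof (induction q)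
      case 0
      then show ?case by simp
    next
      case (Suc q)
      have "a (Suc q * N + r) \<le> a N + a (q * N + r)" using subadd[of N "q * N + r"] by (simp add: add.assoc)
      then show ?case using Suc by (simp add: algebra_simps)
    qed
    have upper: "a n / real n \<le> a N / real N + K' / real n" if n: "1 \<le> n" for n
    proof -
      define q r where "q = n div N" and "r = n mod N"
      have qr: "n = q * N + r" "r < N" using N by (auto simp: q_def r_def)
      have "a n \<le> real q * a N + a r" using mult[of q r] qr by simp
      also have "real q * a N = (real n - real r) * (a N / real N)"
        using N qr by (simp add: field_simps)
      also have "\<dots> = real n * (a N / real N) - real r * (a N / real N)" by (rule left_diff_distrib)
      also have "- (real r * (a N / real N)) \<le> real N * \<bar>a N / real N\<bar>"
      proof -
        have "- (real r * (a N / real N)) \<le> real r * \<bar>a N / real N\<bar>"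
          by (metis abs_ge_minus_self abs_mult abs_of_nat)
        also have "\<dots> \<le> real N * \<bar>a N / real N\<bar>" using qr by (intro mult_right_mono) auto
        finally show ?thesis .
      qed
      then have "real n * (a N / real N) - real r * (a N / real N) + a r \<le> real n * (a N / real N) + K'"
        using M[OF qr(2)] unfolding K'_def by linarith
      finally have "a n \<le> real n * (a N / real N) + K'" by simp
      then have "a n / real n \<le> (real n * (a N / real N) + K') / real n" by (rule divide_right_mono) simp
      then show ?thesis using n by (simp add: add_divide_distrib)
    qed
    obtain n0 :: nat where n0: "2 * K' / \<epsilon> < real n0" using reals_Archimedean2 by blast
    show "\<exists>no. \<forall>n\<ge>no. norm (a n / real n - L) < \<epsilon>"
    proof (intro exI allI impI)
      fix n assume n: "max 1 n0 \<le> n"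
      have "2 * K' / \<epsilon> < real n" using n n0 by linarith
      then have "K' / real n < \<epsilon> / 2" using n \<epsilon> by (simp add: field_simps)
      moreover have "a n / real n \<le> a N / real N + K' / real n" using upper[of n] n by simp
      ultimately have "a n / real n < L + \<epsilon>" using N(2) by linarith
      moreover have "L \<le> a n / real n" unfolding L_def using n by (intro cINF_lower bdd) auto
      ultimately show "norm (a n / real n - L) < \<epsilon>" by simp
    qed
  qed
  then show ?thesis by (rule convergentI)
qed

lemma admissible_ratio:
  assumes "admissible \<sigma>"
  obtains C where "1 \<le> C" "\<And>j k. \<sigma> (j + k) \<le> C ^ j * \<sigma> k" "\<And>j k. \<sigma> k \<le> C ^ j * \<sigma> (j + k)" "\<And>j. 0 < \<sigma> j"
proof -
  obtain C where pos: "\<And>j. 0 < \<sigma> j" and C: "0 < C" "\<And>j. inverse C * \<sigma> j \<le> \<sigma> (Suc j)" "\<And>j. \<sigma> (Suc j) \<le> C * \<sigma> j"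
    using assms unfolding admissible_def by blast
  have C': "\<sigma> j \<le> C * \<sigma> (Suc j)" for j using C(2)[of j] C(1) by (simp add: field_simps)
  have "C * \<sigma> (Suc 0) \<le> C * (C * \<sigma> 0)" using C(3)[of 0] C(1) by (intro mult_left_mono) auto
  then have "\<sigma> 0 \<le> C * (C * \<sigma> 0)" using C'[of 0] by linarith
  then have "1 \<le> C * C" using pos[of 0] by (simp add: mult.assoc[symmetric])
  then have C1: "1 \<le> C" using C(1) by (metis abs_of_pos abs_square_less_1 linorder_not_le power2_eq_square)
  have "\<sigma> (j + k) \<le> C ^ j * \<sigma> k" for j k
  proof (induction j)
    case 0
    then show ?case by simp
  next
    case (Suc j)
    have "\<sigma> (Suc j + k) \<le> C * \<sigma> (j + k)" using C(3) by simp
    also have "\<dots> \<le> C * (C ^ j * \<sigma> k)" using Suc C(1) by (intro mult_left_mono) auto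
    finally show ?case by (simp add: mult.assoc)
  qed
  moreover have "\<sigma> k \<le> C ^ j * \<sigma> (j + k)" for j k
  proof (induction j)
    case 0
    then show ?case by simp
  next
    case (Suc j)
    have "C ^ j * \<sigma> (j + k) \<le> C ^ j * (C * \<sigma> (Suc j + k))" using C' C(1) by (intro mult_left_mono) auto
    then show ?case using Suc by (simp add: mult_ac)
  qed
  ultimately show ?thesis using that C1 pos by blast
qed

text \<open>\<open>upper_seq \<sigma>\<close> is submultiplicative, so by Fekete's lemma the limit in the definition of the Boyd
index exists. Hence \<open>upper_seq \<sigma> j \<le> 2 powr ((m - \<epsilon>) * j)\<close> for all large \<open>j\<close>, and the finitely many
other \<open>j\<close> are accounted for by the constant \<open>A\<close>.\<close>

lemma admissible_growth:
  assumes adm: "admissible \<sigma>" and m: "upper_Boyd \<sigma> < m"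
  obtains A \<epsilon> where "0 < A" "0 < \<epsilon>" "\<And>n J. n \<le> J \<Longrightarrow> \<sigma> J \<le> A * 2 powr ((m - \<epsilon>) * real (J - n)) * \<sigma> n"
proof -
  obtain C where C: "1 \<le> C" "\<And>j k. \<sigma> (j + k) \<le> C ^ j * \<sigma> k" "\<And>j k. \<sigma> k \<le> C ^ j * \<sigma> (j + k)" "\<And>j. 0 < \<sigma> j"
    using admissible_ratio[OF adm] by blast
  let ?u = "upper_seq \<sigma>"
  have bdd: "bdd_above (range (\<lambda>k. \<sigma> (j + k) / \<sigma> k))" for j
    using C by (intro bdd_aboveI2[of _ _ "C ^ j"]) (simp add: pos_divide_le_eq)
  have up: "\<sigma> (j + k) / \<sigma> k \<le> ?u j" for j k
    unfolding upper_seq_def by (intro cSUP_upper bdd) simp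
  have ulow: "inverse (C ^ j) \<le> ?u j" for j
  proof -
    have "inverse (C ^ j) \<le> \<sigma> (j + 0) / \<sigma> 0"
      using C(3)[of 0 j] C(4)[of 0] C(1) by (simp add: field_simps)
    then show ?thesis using up[of j 0] by linarith
  qed
  have upos: "0 < ?u j" for j
    using ulow[of j] C(1) by (meson inverse_positive_iff_positive less_le_trans zero_less_one zero_less_power)
  have submult: "?u (i + j) \<le> ?u i * ?u j" for i j
    unfolding upper_seq_def[of _ "i + j"]
  proof (rule cSUP_least)
    fix k
    have "\<sigma> (i + j + k) / \<sigma> k = (\<sigma> (i + (j + k)) / \<sigma> (j + k)) * (\<sigma> (j + k) / \<sigma> k)"
      using C(4)[of "j + k"] by (simp add: add.assoc)
    also have "\<dots> \<le> ?u i * ?u j" using up C(4) upos less_imp_le by (intro mult_mono) (auto intro: less_imp_le)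
    finally show "\<sigma> (i + j + k) / \<sigma> k \<le> ?u i * ?u j" .
  qed simp
  have "convergent (\<lambda>j. log 2 (?u j) / real j)"
  proof (rule fekete[of _ "log 2 C"])
    fix i j
    have "log 2 (?u (i + j)) \<le> log 2 (?u i * ?u j)" using submult upos by (simp add: mult_pos_pos)
    then show "log 2 (?u (i + j)) \<le> log 2 (?u i) + log 2 (?u j)" using upos by (simp add: log_mult_pos)
  next
    fix j
    have "log 2 (inverse (C ^ j)) \<le> log 2 (?u j)" using ulow upos C(1) by simp
    then show "- log 2 C * real j \<le> log 2 (?u j)" using C(1) by (simp add: log_inverse log_nat_power mult.commute)
  qed
  then have lim: "(\<lambda>j. log 2 (?u j) / real j) \<longlonglongrightarrow> upper_Boyd \<sigma>"
    unfolding upper_Boyd_def by (simp add: convergent_LIMSEQ_iff)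
  define \<epsilon> where "\<epsilon> = (m - upper_Boyd \<sigma>) / 2"
  have \<epsilon>: "0 < \<epsilon>" "upper_Boyd \<sigma> < m - \<epsilon>" using m by (auto simp: \<epsilon>_def field_simps)
  obtain j0 where j0: "\<And>j. j0 \<le> j \<Longrightarrow> log 2 (?u j) / real j < m - \<epsilon>"
    using order_tendstoD(2)[OF lim \<epsilon>(2)] by (auto simp: eventually_sequentially)
  define A where "A = 1 + (\<Sum>j\<le>j0. ?u j / 2 powr ((m - \<epsilon>) * real j))"
  have A1: "1 \<le> A" unfolding A_def using upos by (simp add: sum_nonneg less_imp_le)
  have uA: "?u j \<le> A * 2 powr ((m - \<epsilon>) * real j)" for j
  proof (cases "j \<le> j0")
    case True
    have "?u j / 2 powr ((m - \<epsilon>) * real j) \<le> (\<Sum>j\<le>j0. ?u j / 2 powr ((m - \<epsilon>) * real j))"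
      using True upos by (intro member_le_sum) (auto intro: less_imp_le)
    then have "?u j / 2 powr ((m - \<epsilon>) * real j) \<le> A" by (simp add: A_def)
    then show ?thesis by (simp add: pos_divide_le_eq)
  next
    case False
    then have "log 2 (?u j) < (m - \<epsilon>) * real j" using j0[of j] by (simp add: pos_divide_less_eq)
    then have "?u j < 2 powr ((m - \<epsilon>) * real j)" using upos[of j] by (simp add: log_less_iff)
    also have "\<dots> \<le> A * 2 powr ((m - \<epsilon>) * real j)" using A1 by simp
    finally show ?thesis by simp
  qed
  show ?thesis
  proof (rule that[of A \<epsilon>])
    fix n J :: nat assume "n \<le> J"
    then have "\<sigma> J / \<sigma> n \<le> A * 2 powr ((m - \<epsilon>) * real (J - n))"
      using up[of "J - n" n] uA[of "J - n"] by simp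
    then show "\<sigma> J \<le> A * 2 powr ((m - \<epsilon>) * real (J - n)) * \<sigma> n"
      using C(4)[of n] by (simp add: pos_divide_le_eq)
  qed (use A1 \<epsilon> in auto)
qed

lemma upper_Boyd_less_diff_order: "upper_Boyd \<sigma> < real (diff_order \<sigma>)"
  unfolding diff_order_def by linarith

lemma diff_order_le: "upper_Boyd \<sigma> < real R \<Longrightarrow> diff_order \<sigma> \<le> R"
  unfolding diff_order_def by linarith

lemma admissible_exponential_bound:
  assumes "admissible \<sigma>"
  obtains A \<Gamma> where "0 < A" "0 < \<Gamma>" "\<And>J. 2 powr (real J * \<delta>) * \<sigma> J \<le> A * 2 powr (\<Gamma> * real J)"
proof -
  obtain C where C: "1 \<le> C" "\<And>j k. \<sigma> (j + k) \<le> C ^ j * \<sigma> k" "\<And>j k. \<sigma> k \<le> C ^ j * \<sigma> (j + k)" "\<And>j. 0 < \<sigma> j"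
    using admissible_ratio[OF assms] by blast
  define \<Gamma> where "\<Gamma> = \<bar>\<delta>\<bar> + log 2 C + 1"
  have "2 powr (real J * \<delta>) * \<sigma> J \<le> \<sigma> 0 * 2 powr (\<Gamma> * real J)" for J
  proof -
    have CJ: "C ^ J = 2 powr (log 2 C * real J)"
      using C(1) by (simp add: powr_powr[symmetric] powr_realpow)
    have "real J * \<delta> \<le> \<bar>\<delta>\<bar> * real J"
      using mult_right_mono[OF abs_ge_self[of \<delta>], of "real J"] by (simp add: mult.commute)
    then have "2 powr (real J * \<delta>) * \<sigma> J \<le> 2 powr (\<bar>\<delta>\<bar> * real J) * (C ^ J * \<sigma> 0)"
      using C(2)[of J 0] C(4)[of J] by (intro mult_mono) auto
    also have "\<dots> = \<sigma> 0 * 2 powr ((\<bar>\<delta>\<bar> + log 2 C) * real J)"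
      by (simp add: CJ powr_add distrib_right)
    also have "\<dots> \<le> \<sigma> 0 * 2 powr (\<Gamma> * real J)"
      using C(4)[of 0] by (intro mult_left_mono powr_mono mult_right_mono) (auto simp: \<Gamma>_def)
    finally show ?thesis .
  qed
  moreover have "0 < \<Gamma>" using C(1) by (simp add: \<Gamma>_def add_nonneg_pos zero_le_log_cancel_iff)
  ultimately show ?thesis using that C(4)[of 0] by blast
qed

text \<open>The hypothesis says that \<open>2 powr (j * \<delta>) * \<sigma> j\<close> grows at least geometrically with some ratio \<open>b > 1\<close>.
The logarithm is therefore large enough to compensate a number of layers proportional to \<open>J\<close>.\<close>

lemma logarithm_grows_linearly:
  assumes adm: "admissible \<sigma>" and low: "2 powr (- \<delta>) < lower_seq \<sigma> 1"
  obtains c J0 where "0 < c" "\<And>J. J0 \<le> J \<Longrightarrow>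
    c * real J \<le> \<bar>log 2 (2 powr (- real J * \<delta>) * inverse (\<sigma> J))\<bar>"
proof -
  have pos: "0 < \<sigma> j" for j using adm by (simp add: admissible_def)
  define b where "b = 2 powr \<delta> * lower_seq \<sigma> 1"
  have "2 powr \<delta> * 2 powr (- \<delta>) < b" unfolding b_def using low by (intro mult_strict_left_mono) auto
  then have b: "1 < b" by (simp flip: powr_add)
  have step: "lower_seq \<sigma> 1 * \<sigma> k \<le> \<sigma> (Suc k)" for k
  proof -
    have "lower_seq \<sigma> 1 \<le> \<sigma> (1 + k) / \<sigma> k" unfolding lower_seq_def
      using pos by (intro cINF_lower bdd_belowI2[of _ 0]) (auto intro: less_imp_le)
    then show ?thesis using pos[of k] by (simp add: pos_le_divide_eq)
  qed
  have lower: "\<sigma> 0 * b ^ J \<le> 2 powr (real J * \<delta>) * \<sigma> J" for J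
  proof (induction J)
    case 0
    then show ?case by simp
  next
    case (Suc J)
    have "\<sigma> 0 * b ^ Suc J \<le> b * (2 powr (real J * \<delta>) * \<sigma> J)"
      using mult_left_mono[OF Suc, of b] b by (simp add: mult_ac)
    also have "\<dots> = 2 powr (real (Suc J) * \<delta>) * (lower_seq \<sigma> 1 * \<sigma> J)"
    proof -
      have "2 powr (real (Suc J) * \<delta>) = 2 powr \<delta> * 2 powr (real J * \<delta>)"
        by (simp add: distrib_right flip: powr_add)
      then show ?thesis by (simp only: b_def mult_ac)
    qed
    also have "\<dots> \<le> 2 powr (real (Suc J) * \<delta>) * \<sigma> (Suc J)" by (intro mult_left_mono step) simp
    finally show ?case .
  qed
  define c where "c = log 2 b / 2"
  have c: "0 < c" using b by (simp add: c_def)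
  obtain J0 :: nat where J0: "\<bar>log 2 (\<sigma> 0)\<bar> / c < real J0" using reals_Archimedean2 by blast
  show ?thesis
  proof (rule that[OF c, of J0])
    fix J assume J: "J0 \<le> J"
    have "\<bar>log 2 (\<sigma> 0)\<bar> / c < real J" using J J0 by linarith
    then have J': "\<bar>log 2 (\<sigma> 0)\<bar> < c * real J" using c by (simp add: pos_divide_less_eq mult.commute)
    have "log 2 (\<sigma> 0 * b ^ J) \<le> log 2 (2 powr (real J * \<delta>) * \<sigma> J)"
      using lower[of J] pos b by simp
    then have "log 2 (\<sigma> 0) + 2 * c * real J \<le> log 2 (2 powr (real J * \<delta>) * \<sigma> J)"
      using pos[of 0] b by (simp add: log_mult_pos log_nat_power c_def mult.commute)
    then have ge: "c * real J \<le> log 2 (2 powr (real J * \<delta>) * \<sigma> J)" using J' by linarith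
    have "2 powr (- real J * \<delta>) * inverse (\<sigma> J) = inverse (2 powr (real J * \<delta>) * \<sigma> J)"
      by (simp add: powr_minus)
    then have "log 2 (2 powr (- real J * \<delta>) * inverse (\<sigma> J)) = - log 2 (2 powr (real J * \<delta>) * \<sigma> J)"
      by (simp only: log_inverse)
    then show "c * real J \<le> \<bar>log 2 (2 powr (- real J * \<delta>) * inverse (\<sigma> J))\<bar>" using ge by linarith
  qed
qed

section \<open>Wavelet sums\<close>

text \<open>At most \<open>(2 * r + 3) ^ d\<close> positions lie within \<open>r\<close> of \<open>y\<close>, and each of them carries at most
\<open>2 ^ d\<close> terms, where \<open>d\<close> is the dimension.\<close>

lemma local_sum_bound:
  fixes T :: "(int ^ 'd) \<times> (int ^ 'd) \<Rightarrow> complex" and y :: "real ^ 'd"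
  assumes S: "finite S" "S \<subseteq> wtypes \<times> UNIV" and M: "0 \<le> M" and r: "0 \<le> r"
    and bound: "\<And>i k. (i, k) \<in> S \<Longrightarrow> norm (T (i, k)) \<le> M"
    and zero: "\<And>i k. (i, k) \<in> S \<Longrightarrow> r \<le> norm (int_vec k - y) \<Longrightarrow> T (i, k) = 0"
  shows "norm (\<Sum>s\<in>S. T s) \<le> (4 * r + 6) ^ CARD('d) * M"
proof -
  let ?L = "{k :: int ^ 'd. norm (int_vec k - y) < r}"
  let ?S = "S \<inter> (wtypes \<times> ?L)"
  have fin: "finite ((wtypes :: (int ^ 'd) set) \<times> ?L)"
    by (intro finite_cartesian_product finite_wtypes finite_lattice_ball)
  have "(\<Sum>s\<in>S. T s) = (\<Sum>s\<in>?S. T s)"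
  proof (rule sum.mono_neutral_right[OF S(1)])
    show "\<forall>s\<in>S - ?S. T s = 0"
    proof
      fix s assume s: "s \<in> S - ?S"
      obtain i k where ik: "s = (i, k)" by (cases s)
      have "r \<le> norm (int_vec k - y)" using s ik S(2) by (auto simp: not_less)
      then show "T s = 0" using zero[of i k] s ik by simp
    qed
  qed simp
  also have "norm \<dots> \<le> (\<Sum>s\<in>?S. M)"
    using bound by (intro sum_norm_le) auto
  also have "\<dots> = real (card ?S) * M" by simp
  also have "\<dots> \<le> (4 * r + 6) ^ CARD('d) * M"
  proof (rule mult_right_mono[OF _ M])
    have "real (card ?S) \<le> real (card ((wtypes :: (int ^ 'd) set) \<times> ?L))"
      using card_mono[OF fin, of ?S] by simp
    also have "\<dots> = real (card (wtypes :: (int ^ 'd) set)) * real (card ?L)"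
      by (simp add: card_cartesian_product)
    also have "\<dots> \<le> real (2 ^ CARD('d)) * (2 * r + 3) ^ CARD('d)"
      using card_wtypes[where 'd = 'd] card_lattice_ball[OF r, of y]
      by (intro mult_mono) (simp_all only: of_nat_le_iff of_nat_0_le_iff)
    also have "\<dots> = (4 * r + 6) ^ CARD('d)" by (simp flip: power_mult_distrib)
    finally show "real (card ?S) \<le> (4 * r + 6) ^ CARD('d)" .
  qed
  finally show ?thesis .
qed

lemma emeasure_scaled_ball:
  assumes "0 < \<rho>" "0 < s"
  shows "emeasure lebesgue {x :: 'a::euclidean_space. norm (s *\<^sub>R x - y) < \<rho>}
    = ennreal (measure lebesgue (ball (0::'a) \<rho>) / s ^ DIM('a))"
proof -
  define A :: "'a set" where "A = {x. norm (s *\<^sub>R x - y) < \<rho>}"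
  have "open A" unfolding A_def by (intro open_Collect_less continuous_intros)
  then have A: "A \<in> sets lebesgue" using borel_open[of A] by (simp add: sets_completionI_sets)
  have b: "(\<lambda>x :: 'a. indicator (ball 0 \<rho>) x :: ennreal) \<in> borel_measurable lebesgue"
    by (intro borel_measurable_indicator) (simp add: sets_completionI_sets)
  have "emeasure lebesgue (ball (0::'a) \<rho>) = (\<integral>\<^sup>+x. indicator (ball (0::'a) \<rho>) x \<partial>lebesgue)"
    using nn_integral_indicator[of "ball 0 \<rho>" "lebesgue :: 'a measure"]
    by (simp add: sets_completionI_sets del: emeasure_completion)
  also have "\<dots> = ennreal (s ^ DIM('a)) * (\<integral>\<^sup>+x. indicator (ball 0 \<rho>) (- y + s *\<^sub>R x) \<partial>lebesgue)"
    using nn_integral_lebesgue_affine(1)[OF b, of s "- y"] assms by simp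
  also have "(\<integral>\<^sup>+x. indicator (ball 0 \<rho>) (- y + s *\<^sub>R x) \<partial>lebesgue) = (\<integral>\<^sup>+x. indicator A x \<partial>lebesgue)"
    by (intro nn_integral_cong) (auto simp: A_def indicator_def norm_minus_commute)
  also have "\<dots> = emeasure lebesgue A" using A by (rule nn_integral_indicator)
  finally have eq: "emeasure lebesgue (ball (0::'a) \<rho>) = ennreal (s ^ DIM('a)) * emeasure lebesgue A" .
  have m: "emeasure lebesgue (ball (0::'a) \<rho>) = ennreal (measure lebesgue (ball (0::'a) \<rho>))"
    using fmeasurableD2[OF lmeasurable_ball[of "0::'a" \<rho>]] by (rule emeasure_eq_ennreal_measure)
  have "ennreal (measure lebesgue (ball (0::'a) \<rho>) / s ^ DIM('a))
      = ennreal (1 / s ^ DIM('a)) * (ennreal (s ^ DIM('a)) * emeasure lebesgue A)"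
    unfolding eq[symmetric] m using assms by (simp flip: ennreal_mult)
  also have "\<dots> = emeasure lebesgue A"
  proof -
    have "ennreal (1 / s ^ DIM('a)) * ennreal (s ^ DIM('a)) = 1"
      using assms by (simp flip: ennreal_mult)
    then show ?thesis by (simp only: mult.assoc[symmetric] mult_1)
  qed
  finally show ?thesis by (simp add: A_def)
qed

lemma emeasure_ball_le:
  obtains V :: real where "0 < V" "\<And>(x0 :: 'a::euclidean_space) J :: nat.
    emeasure lebesgue (ball x0 (2 powr (- real J))) \<le> ennreal (V * 2 powr (- real J * real DIM('a)))"
proof -
  define V where "V = measure lebesgue (ball (0::'a) 1) + 1"
  have "emeasure lebesgue (ball x0 (2 powr (- real J))) \<le> ennreal (V * 2 powr (- real J * real DIM('a)))"
    for x0 :: 'a and J :: nat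
  proof -
    have "ball x0 (2 powr (- real J)) = {x. norm (2 ^ J *\<^sub>R x - 2 ^ J *\<^sub>R x0) < 1}"
    proof -
      have "norm (2 ^ J *\<^sub>R x - 2 ^ J *\<^sub>R x0) = 2 ^ J * dist x0 x" for x
        by (simp add: dist_norm norm_minus_commute flip: scaleR_diff_right)
      then show ?thesis by (auto simp: powr_minus powr_realpow field_simps)
    qed
    then have "emeasure lebesgue (ball x0 (2 powr (- real J)))
        = ennreal (measure lebesgue (ball (0::'a) 1) / (2 ^ J) ^ DIM('a))"
      using emeasure_scaled_ball[of 1 "2 ^ J" "2 ^ J *\<^sub>R x0"] by simp
    also have "(2 ^ J :: real) ^ DIM('a) = 2 powr (real J * real DIM('a))"
      by (simp add: powr_realpow[symmetric] powr_powr)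
    also have "ennreal (measure lebesgue (ball (0::'a) 1) / 2 powr (real J * real DIM('a)))
      \<le> ennreal (V * 2 powr (- real J * real DIM('a)))"
      by (intro ennreal_leI) (simp add: V_def powr_minus divide_inverse)
    finally show ?thesis .
  qed
  moreover have "0 < V" by (simp add: V_def add_nonneg_pos)
  ultimately show ?thesis using that by blast
qed

text \<open>At each point only boundedly many terms are different from \<open>0\<close>. Hence the value of the sum is at
most a constant times its largest term, whose power is at most the sum of the powers of all terms;
and, for finite \<open>p\<close>, each term lives on a set whose measure is proportional to \<open>2 powr (- j * d)\<close>.\<close>

lemma wavelet_sum_Lp_bound:
  fixes g :: "int ^ 'd \<Rightarrow> real ^ 'd \<Rightarrow> complex"
  assumes p: "1 \<le> p" and g: "\<And>i. i \<in> wtypes \<Longrightarrow> continuous_on UNIV (g i)"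
    and bound: "\<And>i x. i \<in> wtypes \<Longrightarrow> norm (g i x) \<le> K" and K: "0 < K"
    and supp: "\<And>i x. i \<in> wtypes \<Longrightarrow> \<rho> \<le> norm x \<Longrightarrow> g i x = 0" and \<rho>: "0 < \<rho>"
  obtains C :: real where "0 < C" "\<And>j (E :: (real ^ 'd) set) (S :: ((int ^ 'd) \<times> (int ^ 'd)) set) c. E \<in> sets lebesgue \<Longrightarrow> finite S \<Longrightarrow> S \<subseteq> wtypes \<times> UNIV \<Longrightarrow>
    Lp_norm p E (\<lambda>x. \<Sum>(i, k)\<in>S. c i k * g i (2 ^ j *\<^sub>R x - int_vec k))
      \<le> ennreal (C * 2 powr (- real j * dim_over TYPE('d) p)) * lp_norm p S (\<lambda>(i, k). ennreal (norm (c i k :: complex)))"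
proof -
  define N :: real where "N = (4 * \<rho> + 6) ^ CARD('d)"
  have N: "0 < N" using \<rho> by (simp add: N_def)
  define v where "v = measure lebesgue (ball (0 :: real ^ 'd) \<rho>)"
  have v: "0 \<le> v" by (simp add: v_def)
  define C where "C = N * K * (v + 1) powr (1 / enn2real p)"
  have C: "0 < C" using N K v by (simp add: C_def)
  show ?thesis
  proof (rule that[OF C])
    fix j :: nat and E :: "(real ^ 'd) set" and S :: "((int ^ 'd) \<times> (int ^ 'd)) set" and c :: "int ^ 'd \<Rightarrow> int ^ 'd \<Rightarrow> complex"
    assume E: "E \<in> sets lebesgue" and S: "finite S" "S \<subseteq> wtypes \<times> UNIV"
    define T where "T x = (\<lambda>(i, k). c i k * g i (2 ^ j *\<^sub>R x - int_vec k))" for x :: "real ^ 'd"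
    define G where "G x = (\<Sum>s\<in>S. T x s)" for x
    have Geq: "(\<lambda>x. \<Sum>(i, k)\<in>S. c i k * g i (2 ^ j *\<^sub>R x - int_vec k)) = G"
      by (simp add: G_def T_def fun_eq_iff)
    have Tcont: "continuous_on UNIV (\<lambda>x. T x s)" if "s \<in> S" for s
    proof -
      obtain i k where s: "s = (i, k)" by (cases s)
      have i: "i \<in> wtypes" using that S s by auto
      show ?thesis unfolding T_def s prod.case
        by (intro continuous_intros continuous_on_compose2[OF g[OF i]]) auto
    qed
    have Gm: "G \<in> borel_measurable lebesgue"
    proof -
      have "continuous_on UNIV G" unfolding G_def by (intro continuous_on_sum Tcont)
      then show ?thesis using borel_measurable_continuous_onI[of G] by (simp add: measurable_completion)
    qed
    have Tbound: "norm (T x (i, k)) \<le> K * norm (c i k)" if "(i, k) \<in> S" for x i k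
    proof -
      have "norm (g i (2 ^ j *\<^sub>R x - int_vec k)) \<le> K" using that S by (intro bound) auto
      then have "norm (g i (2 ^ j *\<^sub>R x - int_vec k)) * norm (c i k) \<le> K * norm (c i k)"
        by (rule mult_right_mono) simp
      then show ?thesis by (simp add: T_def norm_mult mult.commute)
    qed
    have Tzero: "T x (i, k) = 0" if "(i, k) \<in> S" "\<rho> \<le> norm (int_vec k - 2 ^ j *\<^sub>R x)" for x i k
    proof -
      have "g i (2 ^ j *\<^sub>R x - int_vec k) = 0"
        using that S by (intro supp) (auto simp: norm_minus_commute)
      then show ?thesis by (simp add: T_def)
    qed
    define l where "l = lp_norm p S (\<lambda>(i, k). ennreal (norm (c i k)))"
    have l: "lp_norm p S (\<lambda>(i, k). ennreal (norm (c i k))) \<le> l" by (simp add: l_def)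
    have "Lp_norm p E G \<le> ennreal (C * 2 powr (- real j * dim_over TYPE('d) p)) * l"
    proof (cases "l = \<infinity>")
      case True
      then show ?thesis using C by (simp add: ennreal_mult_top)
    next
      case False
      define t where "t = enn2real l"
      have lt: "l = ennreal t" "0 \<le> t" using False by (auto simp: t_def less_top)
      show ?thesis
      proof (cases "p = \<infinity>")
        case True
        have ct: "norm (c i k) \<le> t" if "(i, k) \<in> S" for i k
          using iffD1[OF lp_norm_le_iff[OF p] l] True that lt by auto
        have "norm (G x) \<le> C * t" for x
        proof -
          have "norm (G x) \<le> N * (K * t)" unfolding G_def N_def
          proof (rule local_sum_bound[where y = "2 ^ j *\<^sub>R x", OF S])
            show "0 \<le> \<rho>" using \<rho> by simp
            show "norm (T x (i, k)) \<le> K * t" if "(i, k) \<in> S" for i k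
            proof -
              have "K * norm (c i k) \<le> K * t" using ct[OF that] K by (intro mult_left_mono) auto
              then show ?thesis using Tbound[OF that, of x] by linarith
            qed
            show "0 \<le> K * t" using K lt by simp
          qed (rule Tzero)
          then show ?thesis using True v by (simp add: C_def mult.assoc)
        qed
        then show ?thesis using True C lt
          by (subst Lp_norm_le_iff[OF p E Gm]) (auto simp: dim_over_def intro!: ennreal_leI simp flip: ennreal_mult)
      next
        case False
        define r where "r = enn2real p"
        have r: "1 \<le> r" using enn2real_ge_1[OF p False] by (simp add: r_def)
        have sum_t: "(\<Sum>(i, k)\<in>S. norm (c i k) powr r) \<le> t powr r"
        proof -
          have "(\<Sum>s\<in>S. ennpowr (case s of (i, k) \<Rightarrow> ennreal (norm (c i k))) r) \<le> ennpowr l r"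
            using iffD1[OF lp_norm_le_iff[OF p] l] False S(1) by (auto simp: r_def)
          also have "(\<Sum>s\<in>S. ennpowr (case s of (i, k) \<Rightarrow> ennreal (norm (c i k))) r)
              = ennreal (\<Sum>(i, k)\<in>S. norm (c i k) powr r)"
            by (subst sum_ennreal[symmetric]) (auto simp: ennpowr_ennreal case_prod_unfold)
          finally show ?thesis using lt by (simp add: ennpowr_ennreal)
        qed
        define A where "A k = {x :: real ^ 'd. norm (2 ^ j *\<^sub>R x - int_vec k) < \<rho>}" for k
        have Am: "A k \<in> sets lebesgue" for k
        proof -
          have "open (A k)" unfolding A_def by (intro open_Collect_less continuous_intros)
          then show ?thesis using borel_open[of "A k"] by (simp add: sets_completionI_sets)
        qed
        have Ae: "emeasure lebesgue (A k) = ennreal (v / 2 powr (real j * real CARD('d)))" for k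
        proof -
          have "((2::real) ^ j) ^ CARD('d) = 2 powr (real j * real CARD('d))"
            by (simp add: powr_realpow[symmetric] powr_powr)
          then show ?thesis unfolding A_def v_def using \<rho> by (subst emeasure_scaled_ball) auto
        qed
        have pt: "norm (G x) powr r \<le> (\<Sum>(i, k)\<in>S. (N * K) powr r * norm (c i k) powr r * indicator (A k) x)" for x
        proof -
          define a where "a = (\<lambda>(i, k). K * norm (c i k) * indicator (A k) x :: real)"
          have a0: "0 \<le> a s" for s using K by (auto simp: a_def split: prod.split)
          have Ta: "norm (T x s) \<le> a s" if "s \<in> S" for s
            using Tbound[of "fst s" "snd s" x] Tzero[of "fst s" "snd s" x] that
            by (cases s) (auto simp: a_def A_def indicator_def norm_minus_commute)
          show ?thesis
          proof (cases "S = {}")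
            case True
            then show ?thesis using r by (simp add: G_def)
          next
            case ne: False
            define M where "M = Max (a ` S)"
            have M: "a s \<le> M" if "s \<in> S" for s unfolding M_def using S(1) that by (intro Max_ge) auto
            have "M \<in> a ` S" unfolding M_def using S(1) ne by (intro Max_in) auto
            then obtain s0 where s0: "s0 \<in> S" "M = a s0" by auto
            have M0: "0 \<le> M" using s0 a0 by simp
            have "norm (G x) \<le> N * M" unfolding G_def N_def
            proof (rule local_sum_bound[where y = "2 ^ j *\<^sub>R x", OF S M0])
              show "0 \<le> \<rho>" using \<rho> by simp
              show "norm (T x (i, k)) \<le> M" if "(i, k) \<in> S" for i k using Ta[OF that] M[OF that] by linarith
            qed (rule Tzero)
            then have "norm (G x) powr r \<le> (N * M) powr r" using r by (intro powr_mono2) auto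
            also have "\<dots> = N powr r * a s0 powr r" using N M0 s0 by (simp add: powr_mult)
            also have "a s0 powr r \<le> (\<Sum>s\<in>S. a s powr r)" using S(1) s0 by (intro member_le_sum) auto
            also have "N powr r * (\<Sum>s\<in>S. a s powr r)
                = (\<Sum>(i, k)\<in>S. (N * K) powr r * norm (c i k) powr r * indicator (A k) x)"
              unfolding sum_distrib_left
              using N K r by (intro sum.cong) (auto simp: a_def powr_mult indicator_def)
            finally show ?thesis using N by (simp add: mult_left_mono)
          qed
        qed
        have "(\<integral>\<^sup>+x. ennreal (norm (G x) powr r) * indicator E x \<partial>lebesgue)
            \<le> (\<integral>\<^sup>+x. (\<Sum>s\<in>S. ennreal ((N * K) powr r * norm (c (fst s) (snd s)) powr r) * indicator (A (snd s)) x) \<partial>lebesgue)"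
        proof (rule nn_integral_mono)
          fix x
          have "ennreal (norm (G x) powr r) * indicator E x \<le> ennreal (norm (G x) powr r)"
            by (auto simp: indicator_def)
          also have "\<dots> \<le> ennreal (\<Sum>(i, k)\<in>S. (N * K) powr r * norm (c i k) powr r * indicator (A k) x)"
            by (rule ennreal_leI[OF pt])
          also have "\<dots> = (\<Sum>s\<in>S. ennreal ((N * K) powr r * norm (c (fst s) (snd s)) powr r) * indicator (A (snd s)) x)"
            by (subst sum_ennreal[symmetric]) (auto simp: case_prod_unfold ennreal_mult ennreal_indicator intro!: sum.cong)
          finally show "ennreal (norm (G x) powr r) * indicator E x
            \<le> (\<Sum>s\<in>S. ennreal ((N * K) powr r * norm (c (fst s) (snd s)) powr r) * indicator (A (snd s)) x)" .
        qed
        also have "\<dots> = (\<Sum>s\<in>S. ennreal ((N * K) powr r * norm (c (fst s) (snd s)) powr r) * emeasure lebesgue (A (snd s)))"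
          using Am by (subst nn_integral_sum) (auto simp: nn_integral_cmult simp del: emeasure_completion)
        also have "\<dots> = ennreal (\<Sum>s\<in>S. (N * K) powr r * norm (c (fst s) (snd s)) powr r * (v / 2 powr (real j * real CARD('d))))"
          unfolding Ae using v by (subst sum_ennreal[symmetric]) (auto simp flip: ennreal_mult)
        also have "(\<Sum>s\<in>S. (N * K) powr r * norm (c (fst s) (snd s)) powr r * (v / 2 powr (real j * real CARD('d))))
            = (N * K) powr r * (v / 2 powr (real j * real CARD('d))) * (\<Sum>(i, k)\<in>S. norm (c i k) powr r)"
          unfolding sum_distrib_left by (intro sum.cong) (auto simp: mult_ac)
        also have "\<dots> \<le> (N * K) powr r * ((v + 1) / 2 powr (real j * real CARD('d))) * t powr r"
          using sum_t v by (intro mult_mono divide_right_mono sum_nonneg) auto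
        also have "\<dots> = (C * 2 powr (- real j * dim_over TYPE('d) p) * t) powr r"
        proof -
          have dr: "dim_over TYPE('d) p * r = real CARD('d)"
            using r by (simp add: dim_over_eq[OF p] r_def[symmetric])
          have "(2 powr (- real j * dim_over TYPE('d) p)) powr r = 2 powr (- (real j * (dim_over TYPE('d) p * r)))"
            by (simp add: powr_powr mult.assoc)
          then have 1: "(2 powr (- real j * dim_over TYPE('d) p)) powr r = 1 / 2 powr (real j * real CARD('d))"
            unfolding dr by (simp only: powr_minus_divide)
          have 2: "((v + 1) powr (1 / r)) powr r = v + 1" using v r by (simp add: powr_powr)
          have "(C * 2 powr (- real j * dim_over TYPE('d) p) * t) powr r
              = (N * K) powr r * ((v + 1) powr (1 / r)) powr r
                * (2 powr (- real j * dim_over TYPE('d) p)) powr r * t powr r"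
            unfolding C_def r_def[symmetric] using N K lt(2) by (simp only: powr_mult)
          then show ?thesis unfolding 1 2 by simp
        qed
        finally have "(\<integral>\<^sup>+x. ennreal (norm (G x) powr r) * indicator E x \<partial>lebesgue)
            \<le> ennreal ((C * 2 powr (- real j * dim_over TYPE('d) p) * t) powr r)"
          by (simp add: ennreal_leI)
        then show ?thesis using False C lt unfolding Lp_norm_le_iff[OF p E Gm]
          by (simp add: r_def[symmetric] ennpowr_ennreal flip: ennreal_mult)
      qed
    qed
    then show "Lp_norm p E (\<lambda>x. \<Sum>(i, k)\<in>S. c i k * g i (2 ^ j *\<^sub>R x - int_vec k))
      \<le> ennreal (C * 2 powr (- real j * dim_over TYPE('d) p)) * lp_norm p S (\<lambda>(i, k). ennreal (norm (c i k)))"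
      unfolding Geq l_def .
  qed
qed

section \<open>Local wavelet expansions\<close>

lemma compactly_supported_vanishes:
  fixes g :: "real ^ 'd \<Rightarrow> complex"
  assumes "compactly_supported g"
  shows "\<exists>r. \<forall>x. r \<le> norm x \<longrightarrow> g x = 0"
proof -
  have "bounded {x. g x \<noteq> 0}"
    using assms compact_imp_bounded bounded_subset[OF _ closure_subset]
    unfolding compactly_supported_def by blast
  then obtain r where "\<And>x. g x \<noteq> 0 \<Longrightarrow> norm x \<le> r" by (auto simp: bounded_iff)
  then have "g x = 0" if "r + 1 \<le> norm x" for x using that by fastforce
  then show ?thesis by blast
qed

lemma regular_wavelet_basis_support:
  fixes \<phi> :: "real ^ 'd \<Rightarrow> complex"
  assumes "regular_wavelet_basis R \<phi> \<psi>"
  obtains \<rho> where "0 < \<rho>" "\<And>x. \<rho> \<le> norm x \<Longrightarrow> \<phi> x = 0" "\<And>i x. i \<in> wtypes \<Longrightarrow> \<rho> \<le> norm x \<Longrightarrow> \<psi> i x = 0"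
proof -
  obtain r0 where r0: "\<And>x. r0 \<le> norm x \<Longrightarrow> \<phi> x = 0"
    using compactly_supported_vanishes[of \<phi>] assms by (auto simp: regular_wavelet_basis_def)
  have "\<forall>i\<in>wtypes. \<exists>r. \<forall>x. r \<le> norm x \<longrightarrow> \<psi> i x = 0"
    using compactly_supported_vanishes assms by (auto simp: regular_wavelet_basis_def)
  then obtain r where r: "\<And>i x. i \<in> wtypes \<Longrightarrow> r i \<le> norm x \<Longrightarrow> \<psi> i x = 0" by metis
  define \<rho> where "\<rho> = 1 + \<bar>r0\<bar> + (\<Sum>i\<in>(wtypes :: (int ^ 'd) set). \<bar>r i\<bar>)"
  have s: "0 \<le> (\<Sum>i\<in>(wtypes :: (int ^ 'd) set). \<bar>r i\<bar>)" by (intro sum_nonneg) auto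
  have ri: "r i \<le> \<rho>" if "i \<in> wtypes" for i
  proof -
    have "\<bar>r i\<bar> \<le> (\<Sum>i\<in>wtypes. \<bar>r i\<bar>)" using that by (intro member_le_sum) auto
    then show ?thesis unfolding \<rho>_def by linarith
  qed
  show ?thesis
  proof (rule that[of \<rho>])
    show "0 < \<rho>" using s unfolding \<rho>_def by linarith
    show "\<phi> x = 0" if "\<rho> \<le> norm x" for x using that s r0[of x] unfolding \<rho>_def by linarith
    show "\<psi> i x = 0" if "i \<in> wtypes" "\<rho> \<le> norm x" for i x
      using r[OF that(1), of x] ri[OF that(1)] that(2) by simp
  qed
qed

locale wavelet_expansion =
  fixes R :: nat and \<phi> :: "real ^ 'd \<Rightarrow> complex" and \<psi> :: "int ^ 'd \<Rightarrow> real ^ 'd \<Rightarrow> complex"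
    and \<rho> :: real and x0 :: "real ^ 'd" and r :: real
  assumes reg: "regular_wavelet_basis R \<phi> \<psi>"
    and \<rho>: "0 < \<rho>" and supp_\<phi>: "\<And>x. \<rho> \<le> norm x \<Longrightarrow> \<phi> x = 0"
    and supp_\<psi>: "\<And>i x. i \<in> wtypes \<Longrightarrow> \<rho> \<le> norm x \<Longrightarrow> \<psi> i x = 0"
    and r: "0 < r"
begin

text \<open>The wavelets of scale \<open>j\<close> outside this finite set vanish on \<open>ball x0 r\<close>; see \<open>active_near\<close>.\<close>

definition active :: "nat \<Rightarrow> ((int ^ 'd) \<times> (int ^ 'd)) set" where
  "active j = wtypes \<times> {k. norm (int_vec k - 2 ^ j *\<^sub>R x0) < 2 ^ j * r + \<rho>}"

text \<open>The scaling functions form the level \<open>0\<close>, so the wavelets of scale \<open>j\<close> form the level \<open>Suc j\<close>.\<close>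

fun level :: "nat \<Rightarrow> 'd windex set" where
  "level 0 = Scaling ` {k. norm (int_vec k - x0) < r + \<rho>}"
| "level (Suc j) = (\<lambda>(i, k). Wavelet i j k) ` active j"

lemma continuous_\<phi>: "continuous_on UNIV \<phi>"
  using reg class_C_continuous by (auto simp: regular_wavelet_basis_def)

lemma continuous_\<psi>: "i \<in> wtypes \<Longrightarrow> continuous_on UNIV (\<psi> i)"
  using reg class_C_continuous by (auto simp: regular_wavelet_basis_def)

lemma tame_dilate:
  fixes g :: "real ^ 'd \<Rightarrow> complex"
  assumes "continuous_on UNIV g" "\<And>x. \<rho> \<le> norm x \<Longrightarrow> g x = 0" "1 \<le> s"
  shows "tame (\<lambda>x. g (s *\<^sub>R x - y))"
proof (rule tame_continuous)
  show "continuous_on UNIV (\<lambda>x. g (s *\<^sub>R x - y))"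
    by (intro continuous_on_compose2[OF assms(1)] continuous_intros) auto
  fix x :: "real ^ 'd" assume x: "\<rho> + norm y \<le> norm x"
  have "norm x \<le> norm (s *\<^sub>R x)" using assms(3) mult_right_mono[of 1 s "norm x"] by simp
  then have "\<rho> \<le> norm (s *\<^sub>R x - y)" using x norm_triangle_ineq2[of "s *\<^sub>R x" y] by linarith
  then show "g (s *\<^sub>R x - y) = 0" by (rule assms(2))
qed

lemma tame_wfamily:
  assumes "a \<in> windices"
  shows "tame (wfamily \<phi> \<psi> a)"
proof (cases a)
  case (Scaling k)
  then show ?thesis using tame_dilate[OF continuous_\<phi> supp_\<phi>, of 1 "int_vec k"] by simp
next
  case (Wavelet i j k)
  then have "i \<in> wtypes" using assms by (auto simp: windices_def)
  then show ?thesis using tame_dilate[OF continuous_\<psi> supp_\<psi>, of i "2 ^ j" "int_vec k"] Wavelet by simp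
qed

lemma finite_active: "finite (active j)"
  unfolding active_def by (intro finite_cartesian_product finite_wtypes finite_lattice_ball)

lemma active_near:
  assumes "x \<in> ball x0 r" "norm (2 ^ j *\<^sub>R x - int_vec k) < \<rho>"
  shows "norm (int_vec k - 2 ^ j *\<^sub>R x0) < 2 ^ j * r + \<rho>"
proof -
  have "norm (2 ^ j *\<^sub>R x - 2 ^ j *\<^sub>R x0) = 2 ^ j * dist x0 x"
    by (simp add: dist_norm norm_minus_commute flip: scaleR_diff_right)
  also have "\<dots> \<le> 2 ^ j * r" using assms(1) by simp
  finally show ?thesis
    using assms(2) norm_triangle_ineq[of "int_vec k - 2 ^ j *\<^sub>R x" "2 ^ j *\<^sub>R x - 2 ^ j *\<^sub>R x0"]
    by (simp add: norm_minus_commute)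
qed

sublocale local_expansion windices "wfamily \<phi> \<psi>" level "ball x0 r"
proof
  show "orthogonal_basis_L2 windices (wfamily \<phi> \<psi>)"
    using reg by (auto simp: regular_wavelet_basis_def wavelet_basis_def)
  show "tame (wfamily \<phi> \<psi> a)" if "a \<in> windices" for a using that by (rule tame_wfamily)
  show "finite (level n)" for n
    by (cases n) (auto intro!: finite_imageI finite_lattice_ball finite_active)
  show "level n \<subseteq> windices" for n
    by (cases n) (auto simp: windices_def active_def)
  show "level m \<inter> level n = {}" if "m \<noteq> n" for m n
    using that by (cases m; cases n) auto
  show "\<exists>n. a \<in> level n" if a: "a \<in> windices" and x: "x \<in> ball x0 r" and nz: "wfamily \<phi> \<psi> a x \<noteq> 0" for a x
  proof (cases a)
    case (Scaling k)
    then have "norm (x - int_vec k) < \<rho>" using nz supp_\<phi> not_le by auto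
    then have "norm (int_vec k - x0) < r + \<rho>" using active_near[OF x, of 0 k] by simp
    then have "a \<in> level 0" using Scaling by auto
    then show ?thesis ..
  next
    case (Wavelet i j k)
    then have i: "i \<in> wtypes" using a by (auto simp: windices_def)
    then have "norm (2 ^ j *\<^sub>R x - int_vec k) < \<rho>" using nz Wavelet supp_\<psi>[OF i] not_le by auto
    then have "(i, k) \<in> active j" using active_near[OF x, of j k] i by (simp add: active_def)
    then have "a \<in> level (Suc j)" using Wavelet by force
    then show ?thesis ..
  qed
qed

text \<open>The basis is orthogonal but not necessarily normalised. Dividing by these numbers makes \<open>\<Psi>\<close> the
family that synthesises a function from its wavelet coefficients; see \<open>F_Suc\<close>.\<close>

definition nsq :: "int ^ 'd \<Rightarrow> real" where
  "nsq i = (LINT x|lebesgue. (norm (\<psi> i x))\<^sup>2)"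

definition \<Psi> :: "int ^ 'd \<Rightarrow> real ^ 'd \<Rightarrow> complex" where
  "\<Psi> i x = cnj (\<psi> i x) / nsq i"

lemma tame_\<psi>: "i \<in> wtypes \<Longrightarrow> tame (\<psi> i)"
  using tame_continuous[OF continuous_\<psi> supp_\<psi>] by blast

lemma real_integral_dilate:
  assumes g: "(\<lambda>x. complex_of_real (g x)) \<in> borel_measurable lebesgue"
  shows "(LINT x|lebesgue. g (2 ^ j *\<^sub>R x - int_vec k)) = (LINT x|lebesgue. g (x :: real ^ 'd)) / 2 ^ (CARD('d) * j)"
proof -
  have "complex_of_real (LINT x|lebesgue. g (2 ^ j *\<^sub>R x - int_vec k))
      = (1 / (2 ^ j) ^ DIM(real ^ 'd)) *\<^sub>R complex_of_real (LINT x|lebesgue. g x)"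
    using integral_lebesgue_affine[OF g, of "2 ^ j" "int_vec k"] by (simp add: integral_complex_of_real)
  then have "complex_of_real (LINT x|lebesgue. g (2 ^ j *\<^sub>R x - int_vec k))
      = complex_of_real ((LINT x|lebesgue. g x) / 2 ^ (CARD('d) * j))"
    by (simp add: scaleR_conv_of_real mult.commute flip: power_mult)
  then show ?thesis by (simp only: of_real_eq_iff)
qed

lemma \<nu>_Wavelet:
  assumes "i \<in> wtypes"
  shows "\<nu> (Wavelet i j k) = nsq i / 2 ^ (CARD('d) * j)"
proof -
  have "(\<lambda>x. complex_of_real ((norm (\<psi> i x))\<^sup>2)) \<in> borel_measurable lebesgue"
    using tame_measurable[OF tame_\<psi>[OF assms]] by measurable
  from real_integral_dilate[OF this] show ?thesis by (simp add: \<nu>_def nsq_def)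
qed

lemma nsq_pos: "i \<in> wtypes \<Longrightarrow> 0 < nsq i"
  using \<nu>_pos[of "Wavelet i 0 0"] \<nu>_Wavelet[of i 0 0] by (auto simp: windices_def)

lemma sum_level_Suc: "(\<Sum>a\<in>level (Suc j). G a) = (\<Sum>(i, k)\<in>active j. G (Wavelet i j k))"
  by (simp, subst sum.reindex) (auto simp: inj_on_def case_prod_unfold)

lemma F_Suc: "F f (Suc j) x = (\<Sum>(i, k)\<in>active j. wcoeff \<psi> f i j k * \<Psi> i (2 ^ j *\<^sub>R x - int_vec k))"
  unfolding F_def sum_level_Suc
proof (rule sum.cong[OF refl], clarify)
  fix i k assume "(i, k) \<in> active j"
  then have i: "i \<in> wtypes" by (simp add: active_def)
  show "(LINT y|lebesgue. f y * wfamily \<phi> \<psi> (Wavelet i j k) y) / of_real (\<nu> (Wavelet i j k)) * cnj (wfamily \<phi> \<psi> (Wavelet i j k) x)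
      = wcoeff \<psi> f i j k * \<Psi> i (2 ^ j *\<^sub>R x - int_vec k)"
    using nsq_pos[OF i] by (simp add: \<nu>_Wavelet[OF i] wcoeff_def \<Psi>_def)
qed

lemma continuous_\<Psi>: "i \<in> wtypes \<Longrightarrow> continuous_on UNIV (\<Psi> i)"
  unfolding \<Psi>_def using nsq_pos[of i] by (auto intro!: continuous_intros continuous_\<psi>)

lemma supp_\<Psi>: "i \<in> wtypes \<Longrightarrow> \<rho> \<le> norm x \<Longrightarrow> \<Psi> i x = 0"
  by (simp add: \<Psi>_def supp_\<psi>)

lemma \<psi>_bounded:
  obtains K where "0 < K" "\<And>i x. i \<in> wtypes \<Longrightarrow> norm (\<psi> i x) \<le> K"
    "\<And>i x. i \<in> wtypes \<Longrightarrow> norm (\<Psi> i x) \<le> K"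
proof -
  have "\<exists>K\<ge>0. \<forall>x. norm (\<psi> i x) \<le> K" if "i \<in> wtypes" for i
    using tameE[OF tame_\<psi>[OF that]] by metis
  then obtain K where K: "\<And>i. i \<in> wtypes \<Longrightarrow> 0 \<le> K i" "\<And>i x. i \<in> wtypes \<Longrightarrow> norm (\<psi> i x) \<le> K i"
    by metis
  define K' where "K' = 1 + (\<Sum>i\<in>wtypes. K i) + (\<Sum>i\<in>wtypes. K i / nsq i)"
  have p1: "0 \<le> (\<Sum>i\<in>wtypes. K i)" using K by (intro sum_nonneg)
  have p2: "0 \<le> (\<Sum>i\<in>wtypes. K i / nsq i)"
    using K nsq_pos by (intro sum_nonneg divide_nonneg_pos) auto
  have "norm (\<psi> i x) \<le> K' \<and> norm (\<Psi> i x) \<le> K'" if i: "i \<in> wtypes" for i x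
  proof -
    have "K i \<le> (\<Sum>i\<in>wtypes. K i)" using K i by (intro member_le_sum) auto
    moreover have "K i / nsq i \<le> (\<Sum>i\<in>wtypes. K i / nsq i)"
      using K i nsq_pos by (intro member_le_sum) (auto intro!: divide_nonneg_pos)
    moreover have "norm (\<Psi> i x) \<le> K i / nsq i"
      using K(2)[OF i, of x] nsq_pos[OF i] by (simp add: \<Psi>_def norm_divide divide_right_mono)
    ultimately show ?thesis using K(2)[OF i, of x] p1 p2 unfolding K'_def by linarith
  qed
  moreover have "0 < K'" using p1 p2 unfolding K'_def by linarith
  ultimately show ?thesis using that by blast
qed

lemma \<psi>_mean_zero: "i \<in> wtypes \<Longrightarrow> (LINT x|lebesgue. \<psi> i x) = 0"
proof -
  assume "i \<in> wtypes"
  then have "(\<Sum>a\<in>UNIV. (0 :: nat ^ 'd) $ a) \<le> R \<longrightarrow>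
    (LINT x|lebesgue. complex_of_real (\<Prod>a\<in>UNIV. (x $ a) ^ ((0 :: nat ^ 'd) $ a)) * \<psi> i x) = 0"
    using reg unfolding regular_wavelet_basis_def by blast
  then show ?thesis by simp
qed

text \<open>Since \<open>\<psi> i\<close> has mean zero, the value of \<open>w\<close> at the centre of the wavelet may be subtracted from
\<open>w\<close>; on the support of the wavelet the difference is at most \<open>L * \<rho> / 2 ^ j\<close>.\<close>

lemma test_coefficient_bound:
  assumes i: "i \<in> wtypes" and L: "0 \<le> L" and lip: "\<And>x y. \<bar>w x - w y\<bar> \<le> L * dist x y"
    and w: "tame (\<lambda>x. complex_of_real (w x))"
  shows "norm (LINT y|lebesgue. complex_of_real (w y) * cnj (\<psi> i (2 ^ j *\<^sub>R y - int_vec k)))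
    \<le> L * \<rho> / 2 ^ j * ((LINT x|lebesgue. norm (\<psi> i x)) / 2 ^ (CARD('d) * j))"
proof -
  define y0 :: "real ^ 'd" where "y0 = (1 / 2 ^ j) *\<^sub>R int_vec k"
  define g where "g y = cnj (\<psi> i (2 ^ j *\<^sub>R y - int_vec k))" for y :: "real ^ 'd"
  have g: "tame g" unfolding g_def
    using tame_dilate[OF continuous_\<psi>[OF i] supp_\<psi>[OF i]] by (intro tame_cnj) auto
  have g0: "(LINT y|lebesgue. g y) = 0"
  proof -
    have "(LINT y|lebesgue. g y) = cnj (LINT y|lebesgue. \<psi> i (2 ^ j *\<^sub>R y - int_vec k))"
      unfolding g_def using tame_integrable[OF tame_dilate[OF continuous_\<psi>[OF i] supp_\<psi>[OF i]]]
      by (subst Bochner_Integration.integral_cnj) auto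
    also have "(LINT y|lebesgue. \<psi> i (2 ^ j *\<^sub>R y - int_vec k)) = 0"
      using integral_lebesgue_affine[OF tame_measurable[OF tame_\<psi>[OF i]], of "2 ^ j" "int_vec k"]
      by (simp add: \<psi>_mean_zero[OF i])
    finally show ?thesis by simp
  qed
  have int: "integrable lebesgue (\<lambda>y. complex_of_real (w y) * g y)" "integrable lebesgue g"
    using w g by (auto intro!: tame_integrable tame_mult)
  have "(LINT y|lebesgue. complex_of_real (w y) * g y)
      = (LINT y|lebesgue. complex_of_real (w y) * g y - complex_of_real (w y0) * g y)"
    using int g0 by simp
  also have "norm \<dots> \<le> (LINT y|lebesgue. norm (complex_of_real (w y) * g y - complex_of_real (w y0) * g y))"
    by (rule integral_norm_bound)
  also have "\<dots> \<le> (LINT y|lebesgue. L * \<rho> / 2 ^ j * norm (g y))"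
  proof (rule integral_mono)
    show "norm (complex_of_real (w y) * g y - complex_of_real (w y0) * g y) \<le> L * \<rho> / 2 ^ j * norm (g y)" for y
    proof (cases "g y = 0")
      case True
      then show ?thesis by simp
    next
      case False
      then have near: "norm (2 ^ j *\<^sub>R y - int_vec k) < \<rho>"
        using supp_\<psi>[OF i] not_le unfolding g_def by force
      have "2 ^ j *\<^sub>R (y - y0) = 2 ^ j *\<^sub>R y - int_vec k" by (simp add: y0_def scaleR_diff_right)
      then have "2 ^ j * dist y y0 = norm (2 ^ j *\<^sub>R y - int_vec k)"
        by (metis abs_of_nonneg dist_norm norm_scaleR zero_le_numeral zero_le_power)
      then have "dist y y0 \<le> \<rho> / 2 ^ j" using near by (simp add: field_simps)
      then have "L * dist y y0 \<le> L * (\<rho> / 2 ^ j)" using L by (rule mult_left_mono)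
      then have "\<bar>w y - w y0\<bar> \<le> L * \<rho> / 2 ^ j" using lip[of y y0] by simp
      then have "\<bar>w y - w y0\<bar> * norm (g y) \<le> L * \<rho> / 2 ^ j * norm (g y)" by (rule mult_right_mono) simp
      then show ?thesis by (simp add: norm_mult flip: left_diff_distrib of_real_diff)
    qed
  qed (use int in auto)
  also have "\<dots> = L * \<rho> / 2 ^ j * (LINT y|lebesgue. norm (\<psi> i (2 ^ j *\<^sub>R y - int_vec k)))"
    by (simp add: g_def)
  also have "(LINT y|lebesgue. norm (\<psi> i (2 ^ j *\<^sub>R y - int_vec k))) = (LINT x|lebesgue. norm (\<psi> i x)) / 2 ^ (CARD('d) * j)"
    using tame_measurable[OF tame_\<psi>[OF i]] by (intro real_integral_dilate) measurable
  finally show ?thesis by (simp add: g_def)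
qed

end

lemma Lp_loc_imp_locally_integrable:
  fixes f :: "real ^ 'd \<Rightarrow> complex"
  assumes p: "1 \<le> p" and f: "f \<in> Lp_loc p"
  shows "locally_integrable f"
  unfolding locally_integrable_def
proof safe
  show fm: "f \<in> borel_measurable lebesgue" using f by (simp add: Lp_loc_def)
  fix r :: real
  have "Lp_norm p (ball 0 r) f \<le> Lp_norm p (cball 0 r) f"
    using fm by (intro Lp_norm_mono[OF p]) (auto simp: sets_completionI_sets)
  also have "\<dots> < \<infinity>" using f by (simp add: Lp_loc_def)
  finally show "integrable lebesgue (\<lambda>x. indicat_real (ball 0 r) x *\<^sub>R f x)"
    using fm by (intro Lp_norm_finite_imp_integrable[OF p]) auto
qed

context wavelet_expansion
begin

lemma Q_support:
  assumes "norm x0 + r + 2 * \<rho> \<le> norm x"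
  shows "Q w n x = 0"
proof -
  have far: "\<rho> \<le> norm (s *\<^sub>R x - int_vec k)"
    if "1 \<le> s" "norm (int_vec k - s *\<^sub>R x0) < s * r + \<rho>" for s k
  proof -
    have "r + 2 * \<rho> \<le> norm (x - x0)" using assms norm_triangle_ineq2[of x x0] by linarith
    then have "s * (r + 2 * \<rho>) \<le> s * norm (x - x0)" using that(1) by (intro mult_left_mono) auto
    also have "\<dots> = norm (s *\<^sub>R x - s *\<^sub>R x0)" using that(1) by (simp flip: scaleR_diff_right)
    also have "\<dots> \<le> norm (s *\<^sub>R x - int_vec k) + norm (int_vec k - s *\<^sub>R x0)"
      using norm_triangle_ineq[of "s *\<^sub>R x - int_vec k" "int_vec k - s *\<^sub>R x0"] by simp
    finally have "s * (2 * \<rho>) < norm (s *\<^sub>R x - int_vec k) + \<rho>"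
      using that(2) by (simp add: distrib_left)
    moreover have "1 * (2 * \<rho>) \<le> s * (2 * \<rho>)" using that(1) \<rho> by (intro mult_right_mono) auto
    ultimately show ?thesis by linarith
  qed
  have "wfamily \<phi> \<psi> a x = 0" if "a \<in> level n" for a
  proof (cases n)
    case 0
    then obtain k where "a = Scaling k" "norm (int_vec k - x0) < r + \<rho>" using \<open>a \<in> level n\<close> by auto
    then show ?thesis using far[of 1 k] supp_\<phi>[of "x - int_vec k"] by simp
  next
    case (Suc j)
    then obtain i k where "a = Wavelet i j k" "(i, k) \<in> active j" using \<open>a \<in> level n\<close> by auto
    then show ?thesis using far[of "2 ^ j" k] supp_\<psi>[of i "2 ^ j *\<^sub>R x - int_vec k"]
      by (simp add: active_def)
  qed
  then show ?thesis unfolding Q_def by simp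
qed

text \<open>The normalised coefficients of \<open>w\<close> at scale \<open>j\<close> are \<open>O(2 ^ (- j))\<close>, and only boundedly many
wavelets of this scale overlap at a point.\<close>

lemma Q_bound:
  assumes L: "0 \<le> L" and lip: "\<And>x y. \<bar>w x - w y\<bar> \<le> L * dist x y" and w0: "\<And>x. x \<notin> ball x0 r \<Longrightarrow> w x = 0"
  shows "\<exists>q. summable q \<and> (\<forall>n x. norm (Q (\<lambda>x. complex_of_real (w x)) n x) \<le> q n)"
proof -
  let ?w = "\<lambda>x. complex_of_real (w x)"
  have w: "tame ?w" by (rule tame_lipschitz[OF L lip w0 bounded_ball])
  define N :: real where "N = (4 * \<rho> + 6) ^ CARD('d)"
  have N: "0 < N" using \<rho> by (simp add: N_def)
  obtain K where K: "0 < K" "\<And>i x. i \<in> wtypes \<Longrightarrow> norm (\<psi> i x) \<le> K"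
    "\<And>i x. i \<in> wtypes \<Longrightarrow> norm (\<Psi> i x) \<le> K"
    using \<psi>_bounded by metis
  define l1 where "l1 i = (LINT x|lebesgue. norm (\<psi> i x))" for i
  have l1: "0 \<le> l1 i" for i by (simp add: l1_def)
  define H where "H = (\<Sum>i\<in>wtypes. l1 i / nsq i)"
  have H0: "0 \<le> H" unfolding H_def using l1 nsq_pos by (intro sum_nonneg divide_nonneg_pos) auto
  have H: "l1 i / nsq i \<le> H" if "i \<in> wtypes" for i
    unfolding H_def using that l1 nsq_pos by (intro member_le_sum) (auto intro!: divide_nonneg_pos)
  have "norm (Q ?w (Suc j) x) \<le> N * (L * \<rho> * H * K) * (1 / 2) ^ j" for j x
  proof -
    define c where "c i k = (LINT y|lebesgue. ?w y * cnj (wfamily \<phi> \<psi> (Wavelet i j k) y)) / \<nu> (Wavelet i j k)" for i k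
    have c: "norm (c i k) \<le> L * \<rho> / 2 ^ j * H" if i: "i \<in> wtypes" for i k
    proof -
      have "norm (c i k) \<le> (L * \<rho> / 2 ^ j * (l1 i / 2 ^ (CARD('d) * j))) / (nsq i / 2 ^ (CARD('d) * j))"
      proof -
        let ?I = "LINT y|lebesgue. ?w y * cnj (\<psi> i (2 ^ j *\<^sub>R y - int_vec k))"
        have n0: "0 < nsq i / 2 ^ (CARD('d) * j)" using nsq_pos[OF i] by simp
        have "c i k = ?I / complex_of_real (nsq i / 2 ^ (CARD('d) * j))"
          unfolding c_def \<nu>_Wavelet[OF i] wfamily.simps ..
        then have "norm (c i k) = norm ?I / (nsq i / 2 ^ (CARD('d) * j))"
          using n0 by (simp only: norm_divide norm_of_real abs_of_pos)
        also have "\<dots> \<le> (L * \<rho> / 2 ^ j * (l1 i / 2 ^ (CARD('d) * j))) / (nsq i / 2 ^ (CARD('d) * j))"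
          using test_coefficient_bound[OF i L lip w, of j k] n0 unfolding l1_def
          by (rule divide_right_mono[OF _ less_imp_le])
        finally show ?thesis .
      qed
      also have "\<dots> = L * \<rho> / 2 ^ j * (l1 i / nsq i)" by simp
      also have "\<dots> \<le> L * \<rho> / 2 ^ j * H" using H[OF i] L \<rho> by (intro mult_left_mono) auto
      finally show ?thesis .
    qed
    have "Q ?w (Suc j) x = (\<Sum>s\<in>active j. case s of (i, k) \<Rightarrow> c i k * \<psi> i (2 ^ j *\<^sub>R x - int_vec k))"
      unfolding Q_def sum_level_Suc c_def by (intro sum.cong) auto
    also have "norm \<dots> \<le> N * (L * \<rho> / 2 ^ j * H * K)"
      unfolding N_def
    proof (rule local_sum_bound[where y = "2 ^ j *\<^sub>R x", OF finite_active])
      show "0 \<le> \<rho>" using \<rho> by simp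
      show "active j \<subseteq> wtypes \<times> UNIV" by (auto simp: active_def)
      show "0 \<le> L * \<rho> / 2 ^ j * H * K" using L \<rho> H0 K by simp
      fix i k assume "(i, k) \<in> active j"
      then have i: "i \<in> wtypes" by (simp add: active_def)
      show "norm (case (i, k) of (i, k) \<Rightarrow> c i k * \<psi> i (2 ^ j *\<^sub>R x - int_vec k)) \<le> L * \<rho> / 2 ^ j * H * K"
        unfolding prod.case norm_mult using c[OF i, of k] K(2)[OF i] L \<rho> H0
        by (intro mult_mono) auto
      show "(case (i, k) of (i, k) \<Rightarrow> c i k * \<psi> i (2 ^ j *\<^sub>R x - int_vec k)) = 0"
        if "\<rho> \<le> norm (int_vec k - 2 ^ j *\<^sub>R x)"
        using that supp_\<psi>[OF i, of "2 ^ j *\<^sub>R x - int_vec k"] by (simp add: norm_minus_commute)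
    qed
    finally show ?thesis by (simp add: power_one_over)
  qed
  note tail = this
  obtain K0 where K0: "\<And>x. norm (Q ?w 0 x) \<le> K0" using tameE[OF tame_Q] by metis
  define q where "q n = (case n of 0 \<Rightarrow> K0 | Suc j \<Rightarrow> N * (L * \<rho> * H * K) * (1 / 2) ^ j)" for n
  have "summable (\<lambda>n. q (Suc n))" unfolding q_def nat.case by (intro summable_mult summable_geometric) simp
  then have "summable q" by (simp only: summable_Suc_iff)
  moreover have "norm (Q ?w n x) \<le> q n" for n x
    using K0 tail by (cases n) (auto simp: q_def)
  ultimately show ?thesis by blast
qed

lemma expansion_AE_of_summable_norms:
  assumes p: "1 \<le> p" and f: "locally_integrable f"
    and fin: "(\<Sum>n. Lp_norm p (ball x0 r) (F f n)) < \<infinity>"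
  shows "AE x in lebesgue. x \<in> ball x0 r \<longrightarrow> summable (\<lambda>n. norm (F f n x)) \<and> f x = (\<Sum>n. F f n x)"
proof (rule expansion_AE[OF open_ball bounded_ball f])
  let ?M = "lebesgue_on (ball x0 r)"
  let ?g = "\<lambda>x. \<Sum>n. ennreal (norm (F f n x))"
  have m: "(\<lambda>x. ennreal (norm (F f n x))) \<in> borel_measurable ?M" for n
    by (intro borel_measurable_ennreal_norm_on tame_measurable tame_F)
  have "Lnorm p ?M ?g \<le> (\<Sum>n. Lp_norm p (ball x0 r) (F f n))"
    unfolding Lp_norm_eq_Lnorm by (rule Lnorm_suminf_le[OF p m])
  also note fin
  finally have g: "Lnorm p ?M ?g < \<infinity>" .
  have "emeasure ?M (space ?M) < \<infinity>"
    using finite_measure.emeasure_finite[OF finite_measure_lebesgue_on[OF lmeasurable_ball[of x0 r]]]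
    by (simp add: less_top)
  then have "(\<integral>\<^sup>+x. ?g x \<partial>?M) < \<infinity>"
    using m by (intro Lnorm_finite_imp_nn_integral[OF p _ _ g] borel_measurable_suminf_order) auto
  then show "(\<integral>\<^sup>+x. ?g x * indicator (ball x0 r) x \<partial>lebesgue) < \<infinity>"
    by (subst (asm) nn_integral_restrict_space) (auto simp: sets_completionI_sets)
next
  fix w :: "real ^ 'd \<Rightarrow> real" and L :: real
  assume "0 \<le> L" "\<And>x y. \<bar>w x - w y\<bar> \<le> L * dist x y" "\<And>x. x \<notin> ball x0 r \<Longrightarrow> w x = 0"
  from Q_bound[OF this] obtain q where "summable q" "\<forall>n x. norm (Q (\<lambda>x. complex_of_real (w x)) n x) \<le> q n"
    by blast
  then show "\<exists>q \<rho>. summable q \<and> (\<forall>n x. norm (Q (\<lambda>x. complex_of_real (w x)) n x) \<le> q n) \<and>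
        (\<forall>n x. \<rho> \<le> norm x \<longrightarrow> Q (\<lambda>x. complex_of_real (w x)) n x = 0)"
    using Q_support by blast
qed

lemma class_C_bounds:
  assumes "m \<le> R"
  obtains C where "0 \<le> C" "\<And>h x. norm (finite_diff m h \<phi> x) \<le> C * norm h ^ m"
    "\<And>i h x. i \<in> wtypes \<Longrightarrow> norm (finite_diff m h (\<psi> i) x) \<le> C * norm h ^ m"
    "\<And>i h x. i \<in> wtypes \<Longrightarrow> norm (finite_diff m h (\<Psi> i) x) \<le> C * norm h ^ m"
proof -
  have "class_C m \<phi>" using reg assms class_C_mono by (auto simp: regular_wavelet_basis_def)
  from finite_diff_bound[OF this supp_\<phi>] obtain C0 where C0: "0 \<le> C0" "\<And>h x. norm (finite_diff m h \<phi> x) \<le> C0 * norm h ^ m"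
    by metis
  have "\<exists>C\<ge>0. \<forall>h x. norm (finite_diff m h (\<psi> i) x) \<le> C * norm h ^ m" if "i \<in> wtypes" for i
  proof (rule finite_diff_bound)
    show "class_C m (\<psi> i)" using reg assms that class_C_mono by (auto simp: regular_wavelet_basis_def)
  qed (use supp_\<psi>[OF that] in auto)
  then obtain C where C: "\<And>i. i \<in> wtypes \<Longrightarrow> 0 \<le> C i"
    "\<And>i h x. i \<in> wtypes \<Longrightarrow> norm (finite_diff m h (\<psi> i) x) \<le> C i * norm h ^ m"
    by metis
  have \<Psi>_diff: "norm (finite_diff m h (\<Psi> i) x) \<le> C i / nsq i * norm h ^ m" if i: "i \<in> wtypes" for i h x
  proof -
    have "\<Psi> i = (\<lambda>x. \<Sum>a\<in>{i}. (1 / complex_of_real (nsq a)) * cnj (\<psi> a x))" by (simp add: \<Psi>_def fun_eq_iff)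
    then have "finite_diff m h (\<Psi> i) x = (1 / complex_of_real (nsq i)) * cnj (finite_diff m h (\<psi> i) x)"
      by (simp only: finite_diff_sum finite_diff_cnj) simp
    then have "norm (finite_diff m h (\<Psi> i) x) = norm (finite_diff m h (\<psi> i) x) / nsq i"
      using nsq_pos[OF i] by (simp add: norm_mult norm_divide)
    also have "\<dots> \<le> C i * norm h ^ m / nsq i"
      using C(2)[OF i] nsq_pos[OF i] by (intro divide_right_mono) auto
    finally show ?thesis by simp
  qed
  define C' where "C' = C0 + (\<Sum>i\<in>wtypes. C i) + (\<Sum>i\<in>wtypes. C i / nsq i)"
  have p1: "0 \<le> (\<Sum>i\<in>wtypes. C i)" using C by (intro sum_nonneg)
  have p2: "0 \<le> (\<Sum>i\<in>wtypes. C i / nsq i)"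
    using C nsq_pos by (intro sum_nonneg divide_nonneg_pos) auto
  have le: "C i \<le> C'" "C i / nsq i \<le> C'" if i: "i \<in> wtypes" for i
  proof -
    have "C i \<le> (\<Sum>i\<in>wtypes. C i)" using C i by (intro member_le_sum) auto
    moreover have "C i / nsq i \<le> (\<Sum>i\<in>wtypes. C i / nsq i)"
      using C i nsq_pos by (intro member_le_sum) (auto intro!: divide_nonneg_pos)
    ultimately show "C i \<le> C'" "C i / nsq i \<le> C'" using p1 p2 C0(1) unfolding C'_def by linarith+
  qed
  have scale: "a * norm h ^ m \<le> C' * norm h ^ m" if "a \<le> C'" for a and h :: "real ^ 'd"
    using that by (intro mult_right_mono) auto
  show ?thesis
  proof (rule that[of C'])
    show "0 \<le> C'" using C0(1) p1 p2 by (simp add: C'_def)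
    have "C0 \<le> C'" using p1 p2 by (simp add: C'_def)
    then show "norm (finite_diff m h \<phi> x) \<le> C' * norm h ^ m" for h x
      using C0(2)[of h x] scale[of C0 h] by linarith
    show "norm (finite_diff m h (\<psi> i) x) \<le> C' * norm h ^ m" if "i \<in> wtypes" for i h x
      using C(2)[OF that, of h x] scale[OF le(1)[OF that], of h] by linarith
    show "norm (finite_diff m h (\<Psi> i) x) \<le> C' * norm h ^ m" if "i \<in> wtypes" for i h x
      using \<Psi>_diff[OF that, of h x] scale[OF le(2)[OF that], of h] by linarith
  qed
qed

text \<open>This serves for the finitely many coarsest layers, where the constant may depend on \<open>f\<close> and on the
layer.\<close>

lemma coarse_difference_bound:
  assumes m: "m \<le> R"
  shows "\<exists>C\<ge>0. \<forall>h x. norm (finite_diff m h (F f n) x) \<le> C * norm h ^ m"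
proof -
  obtain C where C: "0 \<le> C" "\<And>h x. norm (finite_diff m h \<phi> x) \<le> C * norm h ^ m"
    "\<And>i h x. i \<in> wtypes \<Longrightarrow> norm (finite_diff m h (\<psi> i) x) \<le> C * norm h ^ m"
    "\<And>i h x. i \<in> wtypes \<Longrightarrow> norm (finite_diff m h (\<Psi> i) x) \<le> C * norm h ^ m"
    using class_C_bounds[OF m] by metis
  have e: "\<exists>C\<ge>0. \<forall>h x. norm (finite_diff m h (wfamily \<phi> \<psi> a) x) \<le> C * norm h ^ m" if a: "a \<in> windices" for a
  proof (cases a)
    case (Scaling k)
    have "finite_diff m h (wfamily \<phi> \<psi> a) x = finite_diff m h \<phi> (x - int_vec k)" for h x
      using finite_diff_affine[of m h \<phi> 1 "int_vec k" x] Scaling by simp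
    then show ?thesis using C(1,2) by auto
  next
    case (Wavelet i j k)
    then have i: "i \<in> wtypes" using a by (auto simp: windices_def)
    have "norm (finite_diff m h (wfamily \<phi> \<psi> a) x) \<le> C * (2 ^ j) ^ m * norm h ^ m" for h x
      using finite_diff_affine[of m h "\<psi> i" "2 ^ j" "int_vec k" x] Wavelet
        C(3)[OF i, of "2 ^ j *\<^sub>R h" "2 ^ j *\<^sub>R x - int_vec k"] by (simp add: power_mult_distrib mult.assoc)
    then show ?thesis using C(1) by (intro exI[of _ "C * (2 ^ j) ^ m"]) auto
  qed
  have "\<forall>a\<in>level n. \<exists>C\<ge>0. \<forall>h x. norm (finite_diff m h (wfamily \<phi> \<psi> a) x) \<le> C * norm h ^ m"
    using e sub by blast
  then obtain K where K: "\<And>a. a \<in> level n \<Longrightarrow> 0 \<le> K a"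
    "\<And>a h x. a \<in> level n \<Longrightarrow> norm (finite_diff m h (wfamily \<phi> \<psi> a) x) \<le> K a * norm h ^ m" by metis
  define b where "b a = (LINT y|lebesgue. f y * wfamily \<phi> \<psi> a y) / complex_of_real (\<nu> a)" for a
  have "norm (finite_diff m h (F f n) x) \<le> (\<Sum>a\<in>level n. norm (b a) * K a) * norm h ^ m" for h x
  proof -
    have "finite_diff m h (F f n) x = (\<Sum>a\<in>level n. b a * cnj (finite_diff m h (wfamily \<phi> \<psi> a) x))"
      unfolding F_def[abs_def] b_def finite_diff_sum finite_diff_cnj ..
    also have "norm \<dots> \<le> (\<Sum>a\<in>level n. norm (b a) * K a * norm h ^ m)"
    proof (rule sum_norm_le)
      fix a assume "a \<in> level n"
      then show "norm (b a * cnj (finite_diff m h (wfamily \<phi> \<psi> a) x)) \<le> norm (b a) * K a * norm h ^ m"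
        using K(2)[of a h x] by (simp add: norm_mult mult.assoc mult_left_mono)
    qed
    finally show ?thesis by (simp add: sum_distrib_right)
  qed
  moreover have "0 \<le> (\<Sum>a\<in>level n. norm (b a) * K a)" using K by (intro sum_nonneg) auto
  ultimately show ?thesis by blast
qed

end

section \<open>Norms of the frequency layers\<close>

context wavelet_expansion
begin

lemma active_subset: "active j \<subseteq> wtypes \<times> UNIV"
  by (auto simp: active_def)

text \<open>Only the coefficients in \<open>S\<close> are visible on \<open>E\<close>.\<close>

lemma layer_Lp_bound:
  assumes p: "1 \<le> p"
  obtains C :: real where "0 < C" "\<And>f j E S. E \<in> sets lebesgue \<Longrightarrow> S \<subseteq> active j \<Longrightarrow>
    (\<And>i k x. (i, k) \<in> active j - S \<Longrightarrow> x \<in> E \<Longrightarrow> \<rho> \<le> norm (2 ^ j *\<^sub>R x - int_vec k)) \<Longrightarrow>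
    Lp_norm p E (F f (Suc j)) \<le> ennreal (C * 2 powr (- real j * dim_over TYPE('d) p))
      * lp_norm p S (\<lambda>(i, k). ennreal (norm (wcoeff \<psi> f i j k)))"
proof -
  obtain K where K: "0 < K" "\<And>i x. i \<in> wtypes \<Longrightarrow> norm (\<psi> i x) \<le> K"
    "\<And>i x. i \<in> wtypes \<Longrightarrow> norm (\<Psi> i x) \<le> K"
    using \<psi>_bounded by metis
  obtain C :: real where C: "0 < C" "\<And>j (E :: (real ^ 'd) set) (S :: ((int ^ 'd) \<times> (int ^ 'd)) set) c.
    E \<in> sets lebesgue \<Longrightarrow> finite S \<Longrightarrow> S \<subseteq> wtypes \<times> UNIV \<Longrightarrow>
    Lp_norm p E (\<lambda>x. \<Sum>(i, k)\<in>S. c i k * \<Psi> i (2 ^ j *\<^sub>R x - int_vec k))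
      \<le> ennreal (C * 2 powr (- real j * dim_over TYPE('d) p)) * lp_norm p S (\<lambda>(i, k). ennreal (norm (c i k :: complex)))"
  proof (rule wavelet_sum_Lp_bound[OF p continuous_\<Psi> K(3) K(1) supp_\<Psi> \<rho>])
    fix C :: real assume "0 < C" "\<And>j (E :: (real ^ 'd) set) (S :: ((int ^ 'd) \<times> (int ^ 'd)) set) c.
      E \<in> sets lebesgue \<Longrightarrow> finite S \<Longrightarrow> S \<subseteq> wtypes \<times> UNIV \<Longrightarrow>
      Lp_norm p E (\<lambda>x. \<Sum>(i, k)\<in>S. c i k * \<Psi> i (2 ^ j *\<^sub>R x - int_vec k))
        \<le> ennreal (C * 2 powr (- real j * dim_over TYPE('d) p)) * lp_norm p S (\<lambda>(i, k). ennreal (norm (c i k :: complex)))"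
    then show thesis by (rule that)
  qed
  show ?thesis
  proof (rule that[OF C(1)])
    fix f :: "real ^ 'd \<Rightarrow> complex" and j and E :: "(real ^ 'd) set" and S
    assume E: "E \<in> sets lebesgue" and S: "S \<subseteq> active j"
      and far: "\<And>i k x. (i, k) \<in> active j - S \<Longrightarrow> x \<in> E \<Longrightarrow> \<rho> \<le> norm (2 ^ j *\<^sub>R x - int_vec k)"
    let ?G = "\<lambda>x. \<Sum>(i, k)\<in>S. wcoeff \<psi> f i j k * \<Psi> i (2 ^ j *\<^sub>R x - int_vec k)"
    have fin: "finite S" and sub': "S \<subseteq> wtypes \<times> UNIV"
      using S finite_active finite_subset active_subset by blast+
    have tame_G: "tame ?G"
    proof -
      have "tame (\<lambda>x. \<Sum>s\<in>S. wcoeff \<psi> f (fst s) j (snd s) * \<Psi> (fst s) (2 ^ j *\<^sub>R x - int_vec (snd s)))"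
        using sub' by (intro tame_sum tame_cmult tame_dilate continuous_\<Psi> supp_\<Psi>) auto
      then show ?thesis by (simp add: case_prod_unfold)
    qed
    have "F f (Suc j) x = ?G x" if "x \<in> E" for x
      unfolding F_Suc
    proof (rule sum.mono_neutral_right[OF finite_active S], safe)
      fix i k assume ik: "(i, k) \<in> active j" "(i, k) \<notin> S"
      then have "\<Psi> i (2 ^ j *\<^sub>R x - int_vec k) = 0"
        using far[of i k x] that by (intro supp_\<Psi>) (auto simp: active_def)
      then show "wcoeff \<psi> f i j k * \<Psi> i (2 ^ j *\<^sub>R x - int_vec k) = 0" by simp
    qed
    then have "Lp_norm p E (F f (Suc j)) \<le> Lp_norm p E ?G"
      using tame_measurable[OF tame_F] tame_measurable[OF tame_G] E by (intro Lp_norm_mono[OF p]) auto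
    also have "\<dots> \<le> ennreal (C * 2 powr (- real j * dim_over TYPE('d) p))
      * lp_norm p S (\<lambda>(i, k). ennreal (norm (wcoeff \<psi> f i j k)))"
      by (rule C(2)[OF E fin sub'])
    finally show "Lp_norm p E (F f (Suc j)) \<le> ennreal (C * 2 powr (- real j * dim_over TYPE('d) p))
      * lp_norm p S (\<lambda>(i, k). ennreal (norm (wcoeff \<psi> f i j k)))" .
  qed
qed

lemma dist_scaled: "norm (2 ^ j *\<^sub>R x - 2 ^ j *\<^sub>R y) = 2 ^ j * dist x (y :: real ^ 'd)"
  by (simp add: dist_norm flip: scaleR_diff_right)

text \<open>The ball of radius \<open>2 powr (- J)\<close> only sees wavelets of scale \<open>j \<ge> J\<close> positioned within
\<open>(\<rho> + 1) * 2 powr (- J)\<close> of its centre. Passing to the coarser scale \<open>J - c0\<close>, with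
\<open>\<rho> + 1 \<le> 2 ^ c0\<close>, makes them part of the cubes around \<open>x0\<close>. The bound is the same for all these
\<open>j\<close>.\<close>

lemma fine_layer_bound:
  assumes p: "1 \<le> p" and c0: "\<rho> + 1 \<le> 2 ^ c0"
  obtains C :: real where "0 < C" "\<And>f J j. c0 \<le> J \<Longrightarrow> J \<le> j \<Longrightarrow>
    Lp_norm p (ball x0 (2 powr (- real J))) (F f (Suc j))
      \<le> ennreal (C * 2 powr (- real J * dim_over TYPE('d) p)) * leader_at \<psi> p f x0 (J - c0)"
proof -
  let ?\<delta> = "dim_over TYPE('d) p"
  obtain C where C: "0 < C" "\<And>f j E S. E \<in> sets lebesgue \<Longrightarrow> S \<subseteq> active j \<Longrightarrow>
    (\<And>i k x. (i, k) \<in> active j - S \<Longrightarrow> x \<in> E \<Longrightarrow> \<rho> \<le> norm (2 ^ j *\<^sub>R x - int_vec k)) \<Longrightarrow>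
    Lp_norm p E (F f (Suc j)) \<le> ennreal (C * 2 powr (- real j * ?\<delta>))
      * lp_norm p S (\<lambda>(i, k). ennreal (norm (wcoeff \<psi> f i j k)))"
    using layer_Lp_bound[OF p] by metis
  define C' where "C' = C * 2 powr (real c0 * ?\<delta>) * 3 ^ CARD('d)"
  show ?thesis
  proof (rule that[of C'])
    show "0 < C'" using C by (simp add: C'_def)
    fix f :: "real ^ 'd \<Rightarrow> complex" and J j assume J: "c0 \<le> J" "J \<le> j"
    define S where "S = {(i, k). (i, k) \<in> active j \<and> norm (int_vec k - 2 ^ j *\<^sub>R x0) \<le> 2 ^ (j - (J - c0))}"
    have S: "S \<subseteq> active j" by (auto simp: S_def)
    have pw: "2 ^ (j - (J - c0)) = (2::real) ^ (j - J) * 2 ^ c0" using J by (simp flip: power_add)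
    have pw': "2 ^ j * 2 powr (- real J) = (2::real) ^ (j - J)"
      using J by (simp add: powr_minus powr_realpow power_diff divide_inverse)
    have "Lp_norm p (ball x0 (2 powr (- real J))) (F f (Suc j))
        \<le> ennreal (C * 2 powr (- real j * ?\<delta>)) * lp_norm p S (\<lambda>(i, k). ennreal (norm (wcoeff \<psi> f i j k)))"
    proof (rule C(2)[OF _ S])
      show "ball x0 (2 powr (- real J)) \<in> sets lebesgue" by (simp add: sets_completionI_sets)
      fix i k x assume ik: "(i, k) \<in> active j - S" and x: "x \<in> ball x0 (2 powr (- real J))"
      have "2 ^ j * dist x0 x \<le> 2 ^ j * 2 powr (- real J)" using x by (intro mult_left_mono) auto
      then have d: "norm (2 ^ j *\<^sub>R x0 - 2 ^ j *\<^sub>R x) \<le> 2 ^ (j - J)" unfolding dist_scaled pw' .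
      have "2 ^ (j - (J - c0)) < norm (int_vec k - 2 ^ j *\<^sub>R x0)" using ik by (auto simp: S_def)
      moreover have "(2::real) ^ (j - J) * (\<rho> + 1) \<le> 2 ^ (j - J) * 2 ^ c0" using c0 by (intro mult_left_mono) auto
      moreover have "1 * \<rho> \<le> 2 ^ (j - J) * \<rho>" using \<rho> by (intro mult_right_mono) auto
      moreover have "norm (int_vec k - 2 ^ j *\<^sub>R x0)
          \<le> norm (2 ^ j *\<^sub>R x - int_vec k) + norm (2 ^ j *\<^sub>R x0 - 2 ^ j *\<^sub>R x)"
        using norm_triangle_ineq4[of "int_vec k - 2 ^ j *\<^sub>R x" "2 ^ j *\<^sub>R x0 - 2 ^ j *\<^sub>R x"]
        by (simp add: norm_minus_commute)
      ultimately show "\<rho> \<le> norm (2 ^ j *\<^sub>R x - int_vec k)" using d unfolding pw distrib_left by linarith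
    qed
    also have "lp_norm p S (\<lambda>(i, k). ennreal (norm (wcoeff \<psi> f i j k)))
        \<le> ennreal (2 powr (real (j - (J - c0)) * ?\<delta>)) * (ennreal (3 ^ CARD('d)) * leader_at \<psi> p f x0 (J - c0))"
    proof -
      let ?e = "(real (J - c0) - real j) * ?\<delta>"
      have e: "real (j - (J - c0)) * ?\<delta> = - ?e" using J by (simp add: of_nat_diff algebra_simps)
      have "(\<lambda>(i, k). ennreal (norm (wcoeff \<psi> f i j k)))
          = (\<lambda>s. ennreal (2 powr (- ?e)) * (case s of (i, k) \<Rightarrow> ennreal (2 powr ?e * norm (wcoeff \<psi> f i j k))))"
        by (auto simp: fun_eq_iff mult.assoc[symmetric] simp flip: ennreal_mult powr_add)
      then have "lp_norm p S (\<lambda>(i, k). ennreal (norm (wcoeff \<psi> f i j k)))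
          \<le> ennreal (2 powr (- ?e)) * lp_norm p S (\<lambda>(i, k). ennreal (2 powr ?e * norm (wcoeff \<psi> f i j k)))"
        using lp_norm_cmult_le[OF p] by simp
      also have "\<dots> \<le> ennreal (2 powr (- ?e)) * (ennreal (3 ^ CARD('d)) * leader_at \<psi> p f x0 (J - c0))"
      proof (intro mult_left_mono lp_norm_near_coefficients_le_leader_at[OF p])
        show "J - c0 \<le> j" using J by simp
        show "finite S" using S finite_active finite_subset by blast
        show "S \<subseteq> {(i, k). i \<in> wtypes \<and> norm (int_vec k - 2 ^ j *\<^sub>R x0) \<le> 2 ^ (j - (J - c0))}"
          by (auto simp: S_def active_def)
      qed simp
      finally show ?thesis unfolding e .
    qed
    also have "ennreal (C * 2 powr (- real j * ?\<delta>)) * (ennreal (2 powr (real (j - (J - c0)) * ?\<delta>)) * (ennreal (3 ^ CARD('d)) * leader_at \<psi> p f x0 (J - c0)))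
        = ennreal (C * 2 powr (- real j * ?\<delta>) * 2 powr (real (j - (J - c0)) * ?\<delta>) * 3 ^ CARD('d)) * leader_at \<psi> p f x0 (J - c0)"
      using C(1) by (simp add: ennreal_mult mult.assoc)
    also have "C * 2 powr (- real j * ?\<delta>) * 2 powr (real (j - (J - c0)) * ?\<delta>) * 3 ^ CARD('d) = C' * 2 powr (- real J * ?\<delta>)"
    proof -
      have "- real j * ?\<delta> + real (j - (J - c0)) * ?\<delta> = real c0 * ?\<delta> + - real J * ?\<delta>"
        using J by (simp add: of_nat_diff algebra_simps)
      then have "2 powr (- real j * ?\<delta>) * 2 powr (real (j - (J - c0)) * ?\<delta>) = 2 powr (real c0 * ?\<delta>) * 2 powr (- real J * ?\<delta>)"
        by (simp only: powr_add[symmetric])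
      then show ?thesis by (simp only: C'_def mult_ac) 
    qed
    finally show "Lp_norm p (ball x0 (2 powr (- real J))) (F f (Suc j))
      \<le> ennreal (C' * 2 powr (- real J * ?\<delta>)) * leader_at \<psi> p f x0 (J - c0)"
      by (simp add: mult_left_mono)
  qed
qed

text \<open>For \<open>j \<le> J\<close> the wavelets seen from the small ball are within \<open>(\<rho> + 1) * 2 powr (- j)\<close> of its
centre, so each of the boundedly many coefficients is controlled by the leader of scale \<open>j - c0\<close>.
The smoothness of the wavelets turns the difference into a power of the rescaled step
\<open>2 ^ j * norm h\<close>.\<close>

lemma coarse_layer_bound:
  assumes p: "1 \<le> p" and c0: "\<rho> + 1 \<le> 2 ^ c0" and m: "m \<le> R"
  obtains C :: real where "0 < C" "\<And>f J j h x D. c0 \<le> j \<Longrightarrow> j \<le> J \<Longrightarrow>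
    x \<in> inner_ball m h x0 (2 powr (- real J)) \<Longrightarrow> 0 \<le> D \<Longrightarrow> leader_at \<psi> p f x0 (j - c0) = ennreal D \<Longrightarrow>
    norm (finite_diff m h (F f (Suc j)) x) \<le> C * (2 ^ j * norm h) ^ m * D"
proof -
  let ?\<delta> = "dim_over TYPE('d) p"
  define N :: real where "N = (4 * (\<rho> + 1) + 6) ^ CARD('d)"
  have N: "0 < N" using \<rho> by (simp add: N_def)
  obtain B where B: "0 \<le> B" "\<And>h x. norm (finite_diff m h \<phi> x) \<le> B * norm h ^ m"
    "\<And>i h x. i \<in> wtypes \<Longrightarrow> norm (finite_diff m h (\<psi> i) x) \<le> B * norm h ^ m"
    "\<And>i h x. i \<in> wtypes \<Longrightarrow> norm (finite_diff m h (\<Psi> i) x) \<le> B * norm h ^ m"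
    using class_C_bounds[OF m] by metis
  define C where "C = N * (2 powr (real c0 * ?\<delta>) * 3 ^ CARD('d) * (B + 1))"
  show ?thesis
  proof (rule that[of C])
    show "0 < C" using N B(1) by (simp add: C_def)
    fix f :: "real ^ 'd \<Rightarrow> complex" and J j h x D
    assume j: "c0 \<le> j" "j \<le> J" and x: "x \<in> inner_ball m h x0 (2 powr (- real J))"
      and D: "0 \<le> D" "leader_at \<psi> p f x0 (j - c0) = ennreal D"
    define T where "T = (\<lambda>(i, k). wcoeff \<psi> f i j k * finite_diff m (2 ^ j *\<^sub>R h) (\<Psi> i) (2 ^ j *\<^sub>R x - int_vec k))"
    have "F f (Suc j) = (\<lambda>x. \<Sum>s\<in>active j. wcoeff \<psi> f (fst s) j (snd s) * \<Psi> (fst s) (2 ^ j *\<^sub>R x - int_vec (snd s)))"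
      by (simp add: fun_eq_iff F_Suc case_prod_unfold)
    then have eq: "finite_diff m h (F f (Suc j)) x = (\<Sum>s\<in>active j. T s)"
      by (simp add: finite_diff_sum finite_diff_affine T_def case_prod_unfold)
    have zero: "T (i, k) = 0" if ik: "(i, k) \<in> active j" and far: "\<rho> + 1 \<le> norm (int_vec k - 2 ^ j *\<^sub>R x0)" for i k
    proof -
      have i: "i \<in> wtypes" using ik by (simp add: active_def)
      have "finite_diff m (2 ^ j *\<^sub>R h) (\<Psi> i) (2 ^ j *\<^sub>R x - int_vec k)
          = finite_diff m (2 ^ j *\<^sub>R h) (\<lambda>_. 0) (2 ^ j *\<^sub>R x - int_vec k)"
      proof (rule finite_diff_cong)
        fix l assume l: "l \<le> m"
        define y where "y = x + real l *\<^sub>R h"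
        have "y \<in> ball x0 (2 powr (- real J))" unfolding y_def by (rule inner_ball_step[OF x l])
        then have "2 ^ j * dist x0 y \<le> 2 ^ j * 2 powr (- real J)" by (intro mult_left_mono) auto
        also have "\<dots> \<le> 2 ^ j * 2 powr (- real j)" using j by (intro mult_left_mono powr_mono) auto
        also have "\<dots> = 1" by (simp add: powr_minus powr_realpow)
        finally have d: "norm (2 ^ j *\<^sub>R x0 - 2 ^ j *\<^sub>R y) \<le> 1" unfolding dist_scaled .
        have "norm (int_vec k - 2 ^ j *\<^sub>R x0)
          \<le> norm (2 ^ j *\<^sub>R y - int_vec k) + norm (2 ^ j *\<^sub>R x0 - 2 ^ j *\<^sub>R y)"
          using norm_triangle_ineq4[of "int_vec k - 2 ^ j *\<^sub>R y" "2 ^ j *\<^sub>R x0 - 2 ^ j *\<^sub>R y"]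
          by (simp add: norm_minus_commute)
        then have "\<rho> \<le> norm (2 ^ j *\<^sub>R y - int_vec k)" using d far by linarith
        then have "\<Psi> i (2 ^ j *\<^sub>R y - int_vec k) = 0" by (rule supp_\<Psi>[OF i])
        moreover have "2 ^ j *\<^sub>R x - int_vec k + real l *\<^sub>R (2 ^ j *\<^sub>R h) = 2 ^ j *\<^sub>R y - int_vec k"
          by (simp add: y_def algebra_simps)
        ultimately show "\<Psi> i (2 ^ j *\<^sub>R x - int_vec k + real l *\<^sub>R (2 ^ j *\<^sub>R h)) = 0"
          by (simp only:)
      qed
      then show ?thesis by (simp add: T_def)
    qed
    define M where "M = (2 powr (real c0 * ?\<delta>) * 3 ^ CARD('d) * D) * (B * (2 ^ j * norm h) ^ m)"
    have M0: "0 \<le> M" using B D by (simp add: M_def)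
    have bound: "norm (T (i, k)) \<le> M" if ik: "(i, k) \<in> active j" for i k
    proof (cases "\<rho> + 1 \<le> norm (int_vec k - 2 ^ j *\<^sub>R x0)")
      case True
      then show ?thesis using zero[OF ik] M0 by simp
    next
      case False
      have i: "i \<in> wtypes" using ik by (simp add: active_def)
      let ?e = "(real (j - c0) - real j) * ?\<delta>"
      have e: "?e = - (real c0 * ?\<delta>)" using j by (simp add: of_nat_diff)
      have "ennreal (2 powr ?e * norm (wcoeff \<psi> f i j k))
          \<le> lp_norm p {(i, k)} (\<lambda>(i, k). ennreal (2 powr ?e * norm (wcoeff \<psi> f i j k)))"
        using lp_norm_elem[OF p, of "(i, k)" "{(i, k)}" "\<lambda>(i, k). ennreal (2 powr ?e * norm (wcoeff \<psi> f i j k))"] by simp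
      also have "\<dots> \<le> ennreal (3 ^ CARD('d)) * leader_at \<psi> p f x0 (j - c0)"
        using False c0 j i by (intro lp_norm_near_coefficients_le_leader_at[OF p]) auto
      also have "\<dots> = ennreal (3 ^ CARD('d) * D)" using D by (simp add: ennreal_mult)
      finally have "2 powr ?e * norm (wcoeff \<psi> f i j k) \<le> 3 ^ CARD('d) * D" using D by simp
      then have "2 powr (real c0 * ?\<delta>) * (2 powr ?e * norm (wcoeff \<psi> f i j k)) \<le> 2 powr (real c0 * ?\<delta>) * (3 ^ CARD('d) * D)"
        by (intro mult_left_mono) auto
      then have wc: "norm (wcoeff \<psi> f i j k) \<le> 2 powr (real c0 * ?\<delta>) * 3 ^ CARD('d) * D"
        unfolding e by (simp add: mult.assoc[symmetric] flip: powr_add)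
      show ?thesis unfolding T_def M_def prod.case norm_mult
      proof (rule mult_mono[OF wc])
        show "norm (finite_diff m (2 ^ j *\<^sub>R h) (\<Psi> i) (2 ^ j *\<^sub>R x - int_vec k)) \<le> B * (2 ^ j * norm h) ^ m"
          using B(4)[OF i, of "2 ^ j *\<^sub>R h" "2 ^ j *\<^sub>R x - int_vec k"] by simp
      qed (use D in auto)
    qed
    have "norm (finite_diff m h (F f (Suc j)) x) \<le> N * M"
      unfolding eq N_def using \<rho>
      by (intro local_sum_bound[where S = "active j" and T = T and y = "2 ^ j *\<^sub>R x0" and M = M,
        OF finite_active active_subset M0 _ bound zero]) auto
    also have "\<dots> = N * (2 powr (real c0 * ?\<delta>) * 3 ^ CARD('d)) * (2 ^ j * norm h) ^ m * D * B"
      by (simp add: M_def mult_ac)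
    also have "\<dots> \<le> N * (2 powr (real c0 * ?\<delta>) * 3 ^ CARD('d)) * (2 ^ j * norm h) ^ m * D * (B + 1)"
      using N D B by (intro mult_left_mono) auto
    also have "\<dots> = C * (2 ^ j * norm h) ^ m * D" by (simp add: C_def mult_ac)
    finally show "norm (finite_diff m h (F f (Suc j)) x) \<le> C * (2 ^ j * norm h) ^ m * D" .
  qed
qed

text \<open>Membership in the Xu space bounds the layers from the scale on at which the active positions
lie in the ball of radius \<open>C0 * 2 ^ j\<close>: every entry of the defining sequence is at most its norm.
The constant absorbs the finitely many coarser layers, which are bounded functions.\<close>

lemma Xu_layer_decay:
  assumes p: "1 \<le> p" and q: "1 \<le> q" and C0: "r < C0"
    and xu: "lp_norm q UNIV (\<lambda>j. lp_norm p {(i, k). i \<in> wtypes \<and> norm (int_vec k - 2 ^ j *\<^sub>R x0) < C0 * 2 ^ j}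
         (\<lambda>(i, k). ennreal (2 powr ((\<eta> - dim_over TYPE('d) p) * real j) * norm (wcoeff \<psi> f i j k)))) < \<infinity>"
  obtains M where "0 < M" "\<And>n. Lp_norm p (ball x0 r) (F f n) \<le> ennreal (M * 2 powr (- \<eta> * real n))"
proof -
  let ?\<delta> = "dim_over TYPE('d) p"
  define X where "X j = lp_norm p {(i, k). i \<in> wtypes \<and> norm (int_vec k - 2 ^ j *\<^sub>R x0) < C0 * 2 ^ j}
         (\<lambda>(i, k). ennreal (2 powr ((\<eta> - ?\<delta>) * real j) * norm (wcoeff \<psi> f i j k)))" for j
  obtain M1 where M1: "0 \<le> M1" "\<And>j. X j \<le> ennreal M1"
  proof -
    have "X j \<le> lp_norm q UNIV X" for j by (rule lp_norm_elem[OF q]) simp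
    moreover have "lp_norm q UNIV X < \<infinity>" using xu by (simp add: X_def[abs_def])
    ultimately show ?thesis using that[of "enn2real (lp_norm q UNIV X)"] by (auto simp: less_top)
  qed
  obtain C where C: "0 < C" "\<And>f j E S. E \<in> sets lebesgue \<Longrightarrow> S \<subseteq> active j \<Longrightarrow>
    (\<And>i k x. (i, k) \<in> active j - S \<Longrightarrow> x \<in> E \<Longrightarrow> \<rho> \<le> norm (2 ^ j *\<^sub>R x - int_vec k)) \<Longrightarrow>
    Lp_norm p E (F f (Suc j)) \<le> ennreal (C * 2 powr (- real j * ?\<delta>))
      * lp_norm p S (\<lambda>(i, k). ennreal (norm (wcoeff \<psi> f i j k)))"
    using layer_Lp_bound[OF p] by metis
  have Bm: "ball x0 r \<in> sets lebesgue" by (simp add: sets_completionI_sets)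
  obtain j0 :: nat where j0: "\<rho> / (C0 - r) < 2 ^ j0"
    using real_arch_pow[of 2 "\<rho> / (C0 - r)"] by auto
  have tail: "Lp_norm p (ball x0 r) (F f (Suc j)) \<le> ennreal (C * M1 * 2 powr \<eta> * 2 powr (- \<eta> * real (Suc j)))"
    if j: "j0 \<le> j" for j
  proof -
    have "(2::real) ^ j0 \<le> 2 ^ j" using j by (intro power_increasing) auto
    then have "\<rho> / (C0 - r) < 2 ^ j" using j0 by linarith
    then have "\<rho> < 2 ^ j * (C0 - r)" using C0 by (simp add: pos_divide_less_eq)
    then have big: "2 ^ j * r + \<rho> \<le> C0 * 2 ^ j" by (simp add: algebra_simps)
    let ?e = "(\<eta> - ?\<delta>) * real j"
    have "Lp_norm p (ball x0 r) (F f (Suc j))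
        \<le> ennreal (C * 2 powr (- real j * ?\<delta>)) * lp_norm p (active j) (\<lambda>(i, k). ennreal (norm (wcoeff \<psi> f i j k)))"
      by (rule C(2)[OF Bm]) auto
    also have "lp_norm p (active j) (\<lambda>(i, k). ennreal (norm (wcoeff \<psi> f i j k))) \<le> ennreal (2 powr (- ?e)) * ennreal M1"
    proof -
      have "(\<lambda>(i, k). ennreal (norm (wcoeff \<psi> f i j k)))
          = (\<lambda>s. ennreal (2 powr (- ?e)) * (case s of (i, k) \<Rightarrow> ennreal (2 powr ?e * norm (wcoeff \<psi> f i j k))))"
        by (auto simp: fun_eq_iff mult.assoc[symmetric] simp flip: ennreal_mult powr_add)
      then have "lp_norm p (active j) (\<lambda>(i, k). ennreal (norm (wcoeff \<psi> f i j k)))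
          \<le> ennreal (2 powr (- ?e)) * lp_norm p (active j) (\<lambda>(i, k). ennreal (2 powr ?e * norm (wcoeff \<psi> f i j k)))"
        using lp_norm_cmult_le[OF p] by simp
      also have "\<dots> \<le> ennreal (2 powr (- ?e)) * X j"
        unfolding X_def using big by (intro mult_left_mono lp_norm_mono[OF p]) (auto simp: active_def)
      also have "\<dots> \<le> ennreal (2 powr (- ?e)) * ennreal M1" by (intro mult_left_mono M1) simp
      finally show ?thesis .
    qed
    also have "ennreal (C * 2 powr (- real j * ?\<delta>)) * (ennreal (2 powr (- ?e)) * ennreal M1)
        = ennreal (C * 2 powr (- real j * ?\<delta>) * 2 powr (- ?e) * M1)"
      using C(1) M1(1) by (simp add: ennreal_mult mult.assoc)
    also have "C * 2 powr (- real j * ?\<delta>) * 2 powr (- ?e) * M1 = C * M1 * 2 powr \<eta> * 2 powr (- \<eta> * real (Suc j))"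
    proof -
      have "- real j * ?\<delta> + - ?e = \<eta> + - \<eta> * real (Suc j)" by (simp add: algebra_simps)
      then have "2 powr (- real j * ?\<delta>) * 2 powr (- ?e) = 2 powr \<eta> * 2 powr (- \<eta> * real (Suc j))"
        by (simp only: powr_add[symmetric])
      then show ?thesis by (simp only: mult_ac)
    qed
    finally show ?thesis by (simp add: mult_left_mono)
  qed
  define l where "l n = enn2real (Lp_norm p (ball x0 r) (F f n))" for n
  have fin: "Lp_norm p (ball x0 r) (F f n) = ennreal (l n)" for n
  proof -
    obtain K where K: "0 \<le> K" "\<And>x. norm (F f n x) \<le> K" using tameE[OF tame_F] by metis
    obtain v where v: "emeasure lebesgue (ball x0 r) \<le> ennreal v" "0 < v"
    proof -
      have "emeasure lebesgue (ball x0 r) = ennreal (measure lebesgue (ball x0 r))"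
        using fmeasurableD2[OF lmeasurable_ball[of x0 r]] by (rule emeasure_eq_ennreal_measure)
      then have "emeasure lebesgue (ball x0 r) \<le> ennreal (measure lebesgue (ball x0 r) + 1)"
        by (simp add: ennreal_leI del: emeasure_completion)
      then show ?thesis by (rule that) (simp add: add_nonneg_pos)
    qed
    have "Lp_norm p (ball x0 r) (F f n) < \<infinity>"
      using Lp_norm_bounded[OF p Bm tame_measurable[OF tame_F] K(2) v K(1)] by (rule le_less_trans) simp
    then show ?thesis by (simp add: l_def less_top)
  qed
  define M where "M = 1 + C * M1 * 2 powr \<eta> + (\<Sum>n\<le>j0. l n * 2 powr (\<eta> * real n))"
  have s0: "0 \<le> (\<Sum>n\<le>j0. l n * 2 powr (\<eta> * real n))" by (intro sum_nonneg) (simp add: l_def)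
  have c0: "0 \<le> C * M1 * 2 powr \<eta>" using C(1) M1(1) by simp
  show ?thesis
  proof (rule that[of M])
    show "0 < M" using s0 c0 unfolding M_def by linarith
    fix n
    show "Lp_norm p (ball x0 r) (F f n) \<le> ennreal (M * 2 powr (- \<eta> * real n))"
    proof (cases "n \<le> j0")
      case True
      have "l n * 2 powr (\<eta> * real n) \<le> (\<Sum>n\<le>j0. l n * 2 powr (\<eta> * real n))"
        using True by (intro member_le_sum) (auto simp: l_def)
      then have "l n * 2 powr (\<eta> * real n) \<le> M" using c0 unfolding M_def by linarith
      then have "l n * 2 powr (\<eta> * real n) * 2 powr (- \<eta> * real n) \<le> M * 2 powr (- \<eta> * real n)"
        by (intro mult_right_mono) auto
      then have "l n \<le> M * 2 powr (- \<eta> * real n)" by (simp add: mult.assoc flip: powr_add)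
      then show ?thesis unfolding fin by (rule ennreal_leI)
    next
      case False
      then obtain j where j: "n = Suc j" "j0 \<le> j" by (cases n) auto
      have "C * M1 * 2 powr \<eta> \<le> M" using s0 unfolding M_def by linarith
      then have "ennreal (C * M1 * 2 powr \<eta> * 2 powr (- \<eta> * real (Suc j))) \<le> ennreal (M * 2 powr (- \<eta> * real (Suc j)))"
        by (intro ennreal_leI mult_right_mono) auto
      then show ?thesis using tail[OF j(2)] unfolding j(1) by (rule order_trans[rotated])
    qed
  qed
qed

end

section \<open>Differences on small balls\<close>

text \<open>An upper bound, up to a constant, for the norm of the difference on the ball of radius
\<open>2 powr (- J)\<close>. Inside the inner parentheses stand the contributions of the finitely many coarsest
layers, of the other layers coarser than the ball, and of at most \<open>K * J\<close> finer ones, each of which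
is controlled by one and the same leader; the last summand is the tail of the series of layers.\<close>

definition difference_majorant :: "real \<Rightarrow> real \<Rightarrow> real \<Rightarrow> nat \<Rightarrow> (nat \<Rightarrow> real) \<Rightarrow> nat \<Rightarrow> nat \<Rightarrow> real" where
  "difference_majorant \<delta> \<theta> m c0 D K J =
     2 powr (- real J * \<delta>) *
       (2 powr (- real J * m) + (\<Sum>n<J - c0. 2 powr (- real (J - n) * m) * D n) + real (K * J) * D (J - c0))
     + 2 powr (- \<theta> * real (K * J))"

context wavelet_expansion
begin

text \<open>Near \<open>x0\<close>, the function is the sum of its layers. The layers up to \<open>J\<close> are estimated pointwise
through the smoothness of the wavelets, the finer ones in norm: by leaders as long as \<open>n \<le> K * J\<close>,
and by their geometric decay afterwards.\<close>

lemma difference_Lp_bound: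
  assumes p: "1 \<le> p" and f: "f \<in> Lp_loc p" and m: "m \<le> R" and c0: "\<rho> + 1 \<le> 2 ^ c0"
    and \<eta>: "0 < \<eta>" and M: "0 < M" "\<And>n. Lp_norm p (ball x0 r) (F f n) \<le> ennreal (M * 2 powr (- \<eta> * real n))"
    and D: "\<And>n. 0 \<le> D n" "\<And>n. leader_at \<psi> p f x0 n = ennreal (D n)"
  obtains C where "0 < C" "\<And>J K h. c0 \<le> J \<Longrightarrow> 2 powr (- real J) \<le> r \<Longrightarrow> norm h \<le> 2 powr (- real J) \<Longrightarrow>
    Lp_norm p (inner_ball m h x0 (2 powr (- real J))) (finite_diff m h f)
      \<le> ennreal (C * difference_majorant (dim_over TYPE('d) p) (\<eta> / 2) (real m) c0 D K J)"
proof -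
  let ?\<delta> = "dim_over TYPE('d) p"
  have fm: "f \<in> borel_measurable lebesgue" using f by (simp add: Lp_loc_def)
  have Fm: "F f n \<in> borel_measurable lebesgue" for n by (intro tame_measurable tame_F)
  obtain Cl where Cl: "0 < Cl" "\<And>f J j h x D. c0 \<le> j \<Longrightarrow> j \<le> J \<Longrightarrow>
    x \<in> inner_ball m h x0 (2 powr (- real J)) \<Longrightarrow> 0 \<le> D \<Longrightarrow> leader_at \<psi> p f x0 (j - c0) = ennreal D \<Longrightarrow>
    norm (finite_diff m h (F f (Suc j)) x) \<le> Cl * (2 ^ j * norm h) ^ m * D"
    using coarse_layer_bound[OF p c0 m] by metis
  obtain Ch where Ch: "0 < Ch" "\<And>f J j. c0 \<le> J \<Longrightarrow> J \<le> j \<Longrightarrow>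
    Lp_norm p (ball x0 (2 powr (- real J))) (F f (Suc j))
      \<le> ennreal (Ch * 2 powr (- real J * ?\<delta>)) * leader_at \<psi> p f x0 (J - c0)"
    using fine_layer_bound[OF p c0] by metis
  obtain V where V: "0 < V" "\<And>(x0 :: real ^ 'd) J :: nat.
    emeasure lebesgue (ball x0 (2 powr (- real J))) \<le> ennreal (V * 2 powr (- real J * real DIM(real ^ 'd)))"
    using emeasure_ball_le by metis
  have "\<forall>n. \<exists>C\<ge>0. \<forall>h x. norm (finite_diff m h (F f n) x) \<le> C * norm h ^ m"
    using coarse_difference_bound[OF m] by blast
  then obtain B where B: "\<And>n. 0 \<le> B n" "\<And>n h x. norm (finite_diff m h (F f n) x) \<le> B n * norm h ^ m"
    by metis
  define Bs where "Bs = (\<Sum>n\<le>c0. B n)"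
  have Bs: "0 \<le> Bs" unfolding Bs_def using B by (intro sum_nonneg)
  define G where "G = (\<Sum>n. 2 powr (- \<eta> / 2 * real n))"
  have geo: "summable (\<lambda>n. 2 powr (- t * real n))" if "0 < t" for t :: real
  proof -
    have "2 powr (- t) < 2 powr 0" using that by (subst powr_less_cancel_iff) auto
    then have "summable (\<lambda>n. (2 powr (- t)) ^ n)" by (intro summable_geometric) simp
    moreover have "(2 powr (- t)) ^ n = 2 powr (- t * real n)" for n
      by (simp add: powr_realpow[symmetric] powr_powr)
    ultimately show ?thesis by (simp only:)
  qed
  have G: "summable (\<lambda>n. 2 powr (- \<eta> / 2 * real n))" "0 \<le> G"
    using geo[of "\<eta> / 2"] \<eta> by (auto simp: G_def intro!: suminf_nonneg)
  have expansion: "AE x in lebesgue. x \<in> ball x0 r \<longrightarrow> summable (\<lambda>n. norm (F f n x)) \<and> f x = (\<Sum>n. F f n x)"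
  proof (rule expansion_AE_of_summable_norms[OF p Lp_loc_imp_locally_integrable[OF p f]])
    have "(\<Sum>n. Lp_norm p (ball x0 r) (F f n)) \<le> (\<Sum>n. ennreal (M * 2 powr (- \<eta> * real n)))"
      by (rule suminf_le[OF M(2)]) simp_all
    also have "\<dots> < \<infinity>"
    proof -
      have "(\<Sum>n. ennreal (M * 2 powr (- \<eta> * real n))) \<noteq> top"
      proof (rule ennreal_suminf_neq_top)
        show "summable (\<lambda>n. M * 2 powr (- \<eta> * real n))" by (rule summable_mult[OF geo[OF \<eta>]])
        show "0 \<le> M * 2 powr (- \<eta> * real n)" for n using M(1) by simp
      qed
      then show ?thesis by (simp only: less_top infinity_ennreal_def)
    qed
    finally show "(\<Sum>n. Lp_norm p (ball x0 r) (F f n)) < \<infinity>" .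
  qed
  define W where "W = V powr (1 / enn2real p)"
  have W: "0 < W" using V by (simp add: W_def)
  define E1 where "E1 = W * (Bs + Cl * 2 powr (real c0 * real m))"
  define E2 where "E2 = 2 ^ m * Ch"
  define E3 where "E3 = 2 ^ m * (M * G)"
  have E: "0 \<le> E1" "0 \<le> E2" "0 \<le> E3" using W Bs Cl Ch M G by (auto simp: E1_def E2_def E3_def)
  show ?thesis
  proof (rule that[of "1 + E1 + E2 + E3"])
    show "0 < 1 + E1 + E2 + E3" using E by linarith
    fix J K :: nat and h :: "real ^ 'd"
    assume J: "c0 \<le> J" and Jr: "2 powr (- real J) \<le> r" and h: "norm h \<le> 2 powr (- real J)"
    let ?s = "\<Sum>n<J - c0. 2 powr (- real (J - n) * real m) * D n"
    let ?d = "2 powr (- real J * ?\<delta>)" and ?h = "2 powr (- real J * real m)" and ?t = "2 powr (- \<eta> / 2 * real (K * J))"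
    let ?I = "inner_ball m h x0 (2 powr (- real J))" and ?B = "ball x0 (2 powr (- real J))"
    have Bm: "?B \<in> sets lebesgue" by (simp add: sets_completionI_sets)
    have Brm: "ball x0 r \<in> sets lebesgue" by (simp add: sets_completionI_sets)
    have BB: "?B \<subseteq> ball x0 r" using Jr by (rule subset_ball)
    define low where "low x = (\<Sum>n\<le>J. 1 * F f n x)" for x
    define high where "high x = f x - low x" for x
    have lowm: "low \<in> borel_measurable lebesgue" unfolding low_def using Fm by measurable
    have highm: "high \<in> borel_measurable lebesgue" unfolding high_def using fm lowm by measurable
    have dm: "finite_diff m h g \<in> borel_measurable lebesgue" if "g \<in> borel_measurable lebesgue" for g :: "real ^ 'd \<Rightarrow> complex"
      using finite_diff_Lp_bound[OF p that] by blast
    have split: "finite_diff m h high x = finite_diff m h f x - finite_diff m h low x" for x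
      unfolding high_def by (rule finite_diff_diff)
    have "Lp_norm p ?I (finite_diff m h f) \<le> Lp_norm p ?I (finite_diff m h low) + Lp_norm p ?I (finite_diff m h high)"
    proof (rule Lp_norm_add_le[OF p sets_inner_ball dm[OF fm] dm[OF lowm] dm[OF highm]])
      show "norm (finite_diff m h f x) \<le> norm (finite_diff m h low x) + norm (finite_diff m h high x)" for x
        unfolding split using norm_triangle_ineq[of "finite_diff m h low x" "finite_diff m h f x - finite_diff m h low x"]
        by simp
    qed
    also have "Lp_norm p ?I (finite_diff m h low)
      \<le> ennreal (E1 * (?d * (?h + ?s)))"
    proof -
      define b where "b = Bs * ?h + Cl * 2 powr (real c0 * real m) * ?s"
      have sD: "0 \<le> ?s" using D by (intro sum_nonneg) auto
      have b0: "0 \<le> b" unfolding b_def using Bs Cl sD by (intro add_nonneg_nonneg mult_nonneg_nonneg) auto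
      have hm: "norm h ^ m \<le> ?h"
      proof -
        have "norm h ^ m \<le> (2 powr (- real J)) ^ m" using h by (intro power_mono) auto
        also have "\<dots> = ?h" by (simp add: powr_realpow[symmetric] powr_powr)
        finally show ?thesis .
      qed
      have pt: "norm (finite_diff m h low x) \<le> b" if x: "x \<in> ?I" for x
      proof -
        have "finite_diff m h low x = (\<Sum>n\<le>J. finite_diff m h (F f n) x)"
          unfolding low_def[abs_def] finite_diff_sum by simp
        also have "\<dots> = (\<Sum>n\<le>c0. finite_diff m h (F f n) x) + (\<Sum>j\<in>{c0..<J}. finite_diff m h (F f (Suc j)) x)"
        proof -
          have "{..J} = {..c0} \<union> Suc ` {c0..<J}"
          proof -
            have "Suc ` {c0..<J} = {Suc c0..J}" by (simp add: image_Suc_atLeastLessThan atLeastLessThanSuc_atLeastAtMost)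
            then show ?thesis using J by auto
          qed
          moreover have "{..c0} \<inter> Suc ` {c0..<J} = {}" by auto
          ultimately have "(\<Sum>n\<le>J. finite_diff m h (F f n) x)
              = (\<Sum>n\<le>c0. finite_diff m h (F f n) x) + (\<Sum>n\<in>Suc ` {c0..<J}. finite_diff m h (F f n) x)"
            by (simp only:) (rule sum.union_disjoint, auto)
          also have "(\<Sum>n\<in>Suc ` {c0..<J}. finite_diff m h (F f n) x) = (\<Sum>j\<in>{c0..<J}. finite_diff m h (F f (Suc j)) x)"
            by (subst sum.reindex) auto
          finally show ?thesis .
        qed
        also have "norm \<dots> \<le> (\<Sum>n\<le>c0. B n * norm h ^ m) + (\<Sum>j\<in>{c0..<J}. Cl * (2 ^ j * norm h) ^ m * D (j - c0))"
          using B(2) Cl(2)[OF _ _ x D(1) D(2)]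
          by (intro order_trans[OF norm_triangle_ineq] add_mono sum_norm_le) auto
        also have "(\<Sum>n\<le>c0. B n * norm h ^ m) \<le> Bs * ?h"
          unfolding Bs_def sum_distrib_right using B(1) hm by (intro sum_mono mult_left_mono)
        also have "(\<Sum>j\<in>{c0..<J}. Cl * (2 ^ j * norm h) ^ m * D (j - c0))
            \<le> (\<Sum>j\<in>{c0..<J}. Cl * 2 powr (real c0 * real m) * (2 powr (- real (J - (j - c0)) * real m) * D (j - c0)))"
        proof (rule sum_mono)
          fix j assume j: "j \<in> {c0..<J}"
          have "(2 ^ j * norm h) ^ m = 2 powr (real j * real m) * norm h ^ m"
            by (simp add: power_mult_distrib powr_realpow[symmetric] powr_powr)
          also have "\<dots> \<le> 2 powr (real j * real m) * ?h"
            using hm by (intro mult_left_mono) auto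
          also have "\<dots> = 2 powr (real c0 * real m) * 2 powr (- real (J - (j - c0)) * real m)"
          proof -
            have "real j * real m + - real J * real m = real c0 * real m + - real (J - (j - c0)) * real m"
              using j by (simp add: of_nat_diff algebra_simps)
            then show ?thesis by (simp only: powr_add[symmetric])
          qed
          finally have "(2 ^ j * norm h) ^ m \<le> 2 powr (real c0 * real m) * 2 powr (- real (J - (j - c0)) * real m)" .
          then have "Cl * (2 ^ j * norm h) ^ m * D (j - c0)
              \<le> Cl * (2 powr (real c0 * real m) * 2 powr (- real (J - (j - c0)) * real m)) * D (j - c0)"
            using Cl(1) D(1) by (intro mult_right_mono mult_left_mono) auto
          then show "Cl * (2 ^ j * norm h) ^ m * D (j - c0)
              \<le> Cl * 2 powr (real c0 * real m) * (2 powr (- real (J - (j - c0)) * real m) * D (j - c0))"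
            by (simp only: mult.assoc)
        qed
        also have "(\<Sum>j\<in>{c0..<J}. Cl * 2 powr (real c0 * real m) * (2 powr (- real (J - (j - c0)) * real m) * D (j - c0)))
            = Cl * 2 powr (real c0 * real m) * ?s"
          unfolding sum_distrib_left
          by (rule sum.reindex_bij_witness[of _ "\<lambda>n. n + c0" "\<lambda>j. j - c0"]) auto
        finally show ?thesis by (simp add: b_def)
      qed
      have "emeasure lebesgue ?I \<le> emeasure lebesgue ?B"
        using Bm inner_ball_subset by (rule emeasure_mono[rotated])
      also have "\<dots> \<le> ennreal (V * 2 powr (- real J * real CARD('d)))" using V(2)[of x0 J] by simp
      finally have vol: "emeasure lebesgue ?I \<le> ennreal (V * 2 powr (- real J * real CARD('d)))" .
      have "Lp_norm p ?I (finite_diff m h low) \<le> ennreal (b * (V * 2 powr (- real J * real CARD('d))) powr (1 / enn2real p))"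
        using V(1) by (intro Lp_norm_bounded[OF p sets_inner_ball dm[OF lowm] pt vol _ b0]) auto
      also have "(V * 2 powr (- real J * real CARD('d))) powr (1 / enn2real p) = W * ?d"
        by (simp add: W_def powr_mult powr_powr dim_over_eq[OF p])
      also have "b * (W * ?d) \<le> E1 * (?d * (?h + ?s))"
      proof -
        have "b \<le> (Bs + Cl * 2 powr (real c0 * real m)) * (?h + ?s)"
          unfolding b_def distrib_left distrib_right using Bs Cl(1) sD by simp
        then have "b * (W * ?d) \<le> ((Bs + Cl * 2 powr (real c0 * real m)) * (?h + ?s)) * (W * ?d)"
          using W by (intro mult_right_mono) auto
        then show ?thesis unfolding E1_def by (simp only: mult_ac)
      qed
      finally show ?thesis by (simp add: ennreal_leI)
    qed
    also have "Lp_norm p ?I (finite_diff m h high)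
      \<le> ennreal (E2 * (?d * (real (K * J) * D (J - c0))) + E3 * ?t)"
    proof -
      define a where "a = Ch * ?d * D (J - c0)"
      have a: "0 \<le> a" using Ch D by (simp add: a_def)
      define g where "g n x = (if n \<le> J then 0 else F f n x)" for n x
      have gm: "g n \<in> borel_measurable lebesgue" for n using Fm[of n] by (cases "n \<le> J") (simp_all add: g_def[abs_def])
      have "AE x in lebesgue. x \<in> ?B \<longrightarrow> ennreal (norm (high x)) \<le> (\<Sum>n. ennreal (norm (g n x)))"
        using expansion
      proof eventually_elim
        case (elim x)
        show ?case
        proof
          assume "x \<in> ?B"
          then have x: "summable (\<lambda>n. norm (F f n x))" "f x = (\<Sum>n. F f n x)" using elim BB by auto
          have sg: "summable (\<lambda>n. norm (g n x))"
            by (rule summable_comparison_test'[OF x(1)]) (auto simp: g_def)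
          have fin: "(\<lambda>n. if n \<le> J then F f n x else 0) sums low x"
            using sums_If_finite_set[of "{..J}" "\<lambda>n. F f n x"] by (simp add: low_def)
          have "(\<lambda>n. F f n x - (if n \<le> J then F f n x else 0)) sums (f x - low x)"
            using summable_sums[OF summable_norm_cancel[OF x(1)]] unfolding x(2)[symmetric] by (rule sums_diff[OF _ fin])
          moreover have "(\<lambda>n. F f n x - (if n \<le> J then F f n x else 0)) = (\<lambda>n. g n x)" by (auto simp: g_def)
          ultimately have "high x = (\<Sum>n. g n x)" unfolding high_def by (simp add: sums_iff)
          then have "norm (high x) \<le> (\<Sum>n. norm (g n x))" using summable_norm[OF sg] by simp
          then have "ennreal (norm (high x)) \<le> ennreal (\<Sum>n. norm (g n x))" by (rule ennreal_leI)
          also have "\<dots> = (\<Sum>n. ennreal (norm (g n x)))" using sg by (simp add: suminf_ennreal2)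
          finally show "ennreal (norm (high x)) \<le> (\<Sum>n. ennreal (norm (g n x)))" .
        qed
      qed
      then have "Lp_norm p ?B high \<le> (\<Sum>n. Lp_norm p ?B (g n))"
        by (intro Lp_norm_le_suminf[OF p Bm highm gm])
      also have "\<dots> \<le> (\<Sum>n. ennreal (if n \<in> {J<..K * J} then a else 0) + ennreal (M * ?t * 2 powr (- \<eta> / 2 * real n)))"
      proof (rule suminf_le)
        fix n
        have nn: "0 \<le> M * ?t * 2 powr (- \<eta> / 2 * real n)" using M(1) by simp
        show "Lp_norm p ?B (g n) \<le> ennreal (if n \<in> {J<..K * J} then a else 0) + ennreal (M * ?t * 2 powr (- \<eta> / 2 * real n))"
        proof (cases "n \<le> J")
          case True
          then have "g n = (\<lambda>x. 0)" by (simp add: g_def fun_eq_iff)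
          then have "Lp_norm p ?B (g n) \<le> 0" using p Bm by (simp only:) (subst Lp_norm_le_iff, auto)
          then show ?thesis by simp
        next
          case False
          then have gn: "g n = F f n" by (simp add: g_def fun_eq_iff)
          obtain j where j: "n = Suc j" "J \<le> j" using False by (cases n) auto
          show ?thesis
          proof (cases "n \<le> K * J")
            case True
            have "Lp_norm p ?B (g n) \<le> ennreal (Ch * ?d) * leader_at \<psi> p f x0 (J - c0)"
              using Ch(2)[OF J j(2), of f] unfolding gn by (simp only: j(1))
            also have "\<dots> = ennreal a" using Ch(1) D by (simp add: a_def ennreal_mult)
            finally show ?thesis using True False by (simp add: add_increasing2)
          next
            case F: False
            \<comment> \<open>half of the exponent gives the decay in \<open>K * J\<close>, the other half the summability in
              \<open>n\<close>\<close>
            have "Lp_norm p ?B (g n) \<le> Lp_norm p (ball x0 r) (F f n)"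
              unfolding gn by (intro Lp_norm_mono[OF p Bm Brm BB Fm Fm]) auto
            also have "\<dots> \<le> ennreal (M * 2 powr (- \<eta> * real n))" by (rule M(2))
            also have "\<dots> \<le> ennreal (M * ?t * 2 powr (- \<eta> / 2 * real n))"
            proof (rule ennreal_leI)
              have "\<eta> / 2 * real (K * J) \<le> \<eta> / 2 * real n" using F \<eta> by (intro mult_left_mono) (auto simp del: of_nat_mult)
              then have "2 powr (- \<eta> * real n) \<le> 2 powr (- \<eta> / 2 * real (K * J) + - \<eta> / 2 * real n)"
                by (intro powr_mono) (auto simp del: of_nat_mult)
              then have "M * 2 powr (- \<eta> * real n) \<le> M * 2 powr (- \<eta> / 2 * real (K * J) + - \<eta> / 2 * real n)"
                using M(1) by (intro mult_left_mono) auto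
              then show "M * 2 powr (- \<eta> * real n) \<le> M * ?t * 2 powr (- \<eta> / 2 * real n)"
                by (simp only: powr_add mult.assoc)
            qed
            finally show ?thesis by (rule order_trans) (rule add_increasing, simp_all)
          qed
        qed
      qed auto
      also have "\<dots> = (\<Sum>n. ennreal (if n \<in> {J<..K * J} then a else 0)) + (\<Sum>n. ennreal (M * ?t * 2 powr (- \<eta> / 2 * real n)))"
        by (rule suminf_add[symmetric]) auto
      also have "(\<Sum>n. ennreal (if n \<in> {J<..K * J} then a else 0)) \<le> ennreal (real (K * J) * a)"
      proof -
        have "(\<Sum>n. ennreal (if n \<in> {J<..K * J} then a else 0)) = (\<Sum>n\<in>{J<..K * J}. ennreal (if n \<in> {J<..K * J} then a else 0))"
          by (rule suminf_finite) auto
        also have "\<dots> = ennreal (\<Sum>n\<in>{J<..K * J}. a)" using a by (subst sum_ennreal[symmetric]) auto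
        also have "\<dots> \<le> ennreal (real (K * J) * a)" using a by (intro ennreal_leI) (auto intro!: mult_right_mono simp del: of_nat_mult)
        finally show ?thesis .
      qed
      also have "(\<Sum>n. ennreal (M * ?t * 2 powr (- \<eta> / 2 * real n))) = ennreal (M * ?t * G)"
        unfolding G_def suminf_mult[OF G(1), symmetric]
        by (rule suminf_ennreal2[OF _ summable_mult[OF G(1)]]) (intro mult_nonneg_nonneg powr_ge_zero less_imp_le[OF M(1)])
      also have "ennreal (real (K * J) * a) + ennreal (M * ?t * G)
          = ennreal (real (K * J) * a + M * ?t * G)"
        using a M(1) G(2) by simp
      finally have hb: "Lp_norm p ?B high \<le> ennreal (real (K * J) * a + M * ?t * G)"
        by (simp add: add_right_mono)
      have "Lp_norm p ?I (finite_diff m h high) \<le> 2 ^ m * Lp_norm p ?B high"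
        using finite_diff_Lp_bound[OF p highm] by blast
      also have "\<dots> \<le> ennreal (2 ^ m) * ennreal (real (K * J) * a + M * ?t * G)"
        using hb by (simp add: mult_left_mono ennreal_power[symmetric] del: of_nat_mult)
      also have "\<dots> = ennreal (2 ^ m * (real (K * J) * a + M * ?t * G))"
        by (rule ennreal_mult'[symmetric]) simp
      also have "2 ^ m * (real (K * J) * a + M * ?t * G)
          = E2 * (?d * (real (K * J) * D (J - c0))) + E3 * ?t"
        by (simp only: a_def E2_def E3_def distrib_left mult_ac)
      finally show ?thesis .
    qed
    finally have total: "Lp_norm p ?I (finite_diff m h f)
        \<le> ennreal (E1 * (?d * (?h + ?s)))
        + ennreal (E2 * (?d * (real (K * J) * D (J - c0))) + E3 * ?t)"
      by (simp add: add_mono)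
    define u where "u = ?d * (?h + ?s)"
    define v where "v = ?d * (real (K * J) * D (J - c0))"
    define w where "w = ?t"
    have uvw: "0 \<le> u" "0 \<le> v" "0 \<le> w"
      unfolding u_def v_def w_def using D
      by (auto intro!: mult_nonneg_nonneg add_nonneg_nonneg sum_nonneg)
    have a1: "E1 * u + (E2 * v + E3 * w) \<le> (1 + E1 + E2 + E3) * (u + v + w)"
    proof -
      have "(1 + E1 + E2 + E3) * (u + v + w) = E1 * u + (E2 * v + E3 * w) + ((u + v + w) + E1 * (v + w) + E2 * (u + w) + E3 * (u + v))"
        by (simp add: algebra_simps)
      moreover have "0 \<le> (u + v + w) + E1 * (v + w) + E2 * (u + w) + E3 * (u + v)"
        using uvw E by (intro add_nonneg_nonneg mult_nonneg_nonneg) auto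
      ultimately show ?thesis by linarith
    qed
    have a2: "u + v + w = difference_majorant ?\<delta> (\<eta> / 2) (real m) c0 D K J"
      by (simp only: u_def v_def w_def difference_majorant_def distrib_left minus_divide_left)
    have a3: "ennreal (E1 * u) + ennreal (E2 * v + E3 * w) = ennreal (E1 * u + (E2 * v + E3 * w))"
      using uvw E by simp
    have "Lp_norm p ?I (finite_diff m h f) \<le> ennreal (E1 * u + (E2 * v + E3 * w))"
      using total unfolding u_def[symmetric] v_def[symmetric] w_def[symmetric] a3 .
    also have "\<dots> \<le> ennreal ((1 + E1 + E2 + E3) * (u + v + w))" by (rule ennreal_leI[OF a1])
    finally show "Lp_norm p ?I (finite_diff m h f)
      \<le> ennreal ((1 + E1 + E2 + E3) * difference_majorant ?\<delta> (\<eta> / 2) (real m) c0 D K J)"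
      unfolding a2 .
  qed
qed

end

section \<open>Summation over the scales\<close>

text \<open>Multiplied by \<open>2 powr (J * \<delta>) * \<sigma> J\<close>, the contribution of the leader of scale \<open>n\<close> is dominated by
\<open>\<sigma> n * D n\<close> with the factor \<open>2 powr (- \<epsilon> * (J - n))\<close>, because passing from \<open>\<sigma> J\<close> to \<open>\<sigma> n\<close> costs
at most \<open>2 powr ((m - \<epsilon>) * (J - n))\<close>. The number \<open>K * J\<close> of layers is cancelled by the logarithm
\<open>l\<close>. The unit added to the convolved sequence at \<open>n = 0\<close> absorbs the terms that do not contain
leaders and are \<open>O(2 powr (- \<epsilon> * J))\<close>.\<close>

lemma convolution_dominates:
  fixes \<sigma> D :: "nat \<Rightarrow> real"
  assumes pos: "\<And>n. 0 < \<sigma> n" and D: "\<And>n. 0 \<le> D n"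
    and A: "0 < A" "\<And>n J. n \<le> J \<Longrightarrow> \<sigma> J \<le> A * 2 powr ((m - \<epsilon>) * real (J - n)) * \<sigma> n"
    and A': "0 < A'" "\<And>J. 2 powr (real J * \<delta>) * \<sigma> J \<le> A' * 2 powr (\<Gamma> * real J)"
    and K: "\<Gamma> + \<epsilon> \<le> \<theta> * real K" and c: "0 < c" "c * real J \<le> l" and J: "1 \<le> J" "c0 \<le> J" and C: "0 \<le> C"
  shows "2 powr (real J * \<delta>) * \<sigma> J / l *
      (C * difference_majorant \<delta> \<theta> m c0 D K J)
    \<le> C / c * (A * \<sigma> 0 + A + real K * (A * 2 powr (m * real c0)) + A') *
      (\<Sum>n\<le>J. 2 powr (- \<epsilon> * real (J - n)) * (\<sigma> n * D n + (if n = 0 then 1 else 0)))"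
    (is "?lhs \<le> C / c * ?E * ?s")
proof -
  define \<tau> where "\<tau> n = \<sigma> n * D n + (if n = 0 then 1 else 0)" for n
  define \<kappa> where "\<kappa> n = 2 powr (- \<epsilon> * real (J - n))" for n
  have \<tau>0: "0 \<le> \<tau> n" "\<sigma> n * D n \<le> \<tau> n" for n
    using pos[of n] D[of n] by (auto simp: \<tau>_def intro: add_nonneg_nonneg)
  have s: "?s = (\<Sum>n\<le>J. \<kappa> n * \<tau> n)" by (simp add: \<tau>_def \<kappa>_def)
  have single: "\<kappa> n * \<tau> n \<le> ?s" if "n \<le> J" for n
    unfolding s using that \<tau>0 by (intro member_le_sum) (auto simp: \<kappa>_def)
  have "\<kappa> 0 * 1 \<le> \<kappa> 0 * \<tau> 0" using pos[of 0] D[of 0] by (intro mult_left_mono) (auto simp: \<tau>_def \<kappa>_def)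
  moreover have "\<kappa> 0 * \<tau> 0 \<le> ?s" by (rule single) simp
  ultimately have "\<kappa> 0 \<le> ?s" by linarith
  moreover have "\<kappa> 0 = 2 powr (- \<epsilon> * real J)" by (simp add: \<kappa>_def)
  ultimately have decay: "2 powr (- \<epsilon> * real J) \<le> ?s" by (simp only:)
  have s0: "0 \<le> ?s" using decay by (rule order_trans[rotated]) simp
  have transfer: "\<sigma> J * 2 powr (- real (J - n) * m) \<le> A * \<kappa> n * \<sigma> n" if "n \<le> J" for n
  proof -
    have "\<sigma> J * 2 powr (- real (J - n) * m) \<le> A * 2 powr ((m - \<epsilon>) * real (J - n)) * \<sigma> n * 2 powr (- real (J - n) * m)"
      using A(2)[OF that] by (intro mult_right_mono) auto
    also have "\<dots> = A * (2 powr ((m - \<epsilon>) * real (J - n)) * 2 powr (- real (J - n) * m)) * \<sigma> n" by (simp only: mult_ac)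
    also have "2 powr ((m - \<epsilon>) * real (J - n)) * 2 powr (- real (J - n) * m) = \<kappa> n"
    proof -
      have "(m - \<epsilon>) * real (J - n) + - real (J - n) * m = - \<epsilon> * real (J - n)" by (simp add: algebra_simps)
      then show ?thesis unfolding \<kappa>_def by (simp only: powr_add[symmetric])
    qed
    finally show ?thesis .
  qed
  have t1: "\<sigma> J * 2 powr (- real J * m) \<le> A * \<sigma> 0 * ?s"
  proof -
    have "\<sigma> J * 2 powr (- real J * m) \<le> A * \<sigma> 0 * 2 powr (- \<epsilon> * real J)"
      using transfer[of 0] by (simp add: \<kappa>_def mult_ac)
    also have "\<dots> \<le> A * \<sigma> 0 * ?s" using decay A(1) pos[of 0] by (intro mult_left_mono) auto
    finally show ?thesis .
  qed
  have t2: "\<sigma> J * (\<Sum>n<J - c0. 2 powr (- real (J - n) * m) * D n) \<le> A * ?s"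
  proof -
    have "\<sigma> J * (\<Sum>n<J - c0. 2 powr (- real (J - n) * m) * D n)
        = (\<Sum>n<J - c0. \<sigma> J * 2 powr (- real (J - n) * m) * D n)" by (simp add: sum_distrib_left mult.assoc)
    also have "\<dots> \<le> (\<Sum>n<J - c0. A * (\<kappa> n * \<tau> n))"
    proof (rule sum_mono)
      fix n assume "n \<in> {..<J - c0}"
      then have "\<sigma> J * 2 powr (- real (J - n) * m) * D n \<le> A * \<kappa> n * \<sigma> n * D n"
        using D by (intro mult_right_mono transfer) auto
      also have "\<dots> = A * \<kappa> n * (\<sigma> n * D n)" by (simp only: mult.assoc)
      also have "\<dots> \<le> A * \<kappa> n * \<tau> n" using A(1) \<tau>0 by (intro mult_left_mono) (auto simp: \<kappa>_def)
      finally show "\<sigma> J * 2 powr (- real (J - n) * m) * D n \<le> A * (\<kappa> n * \<tau> n)" by (simp only: mult.assoc)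
    qed
    also have "\<dots> \<le> (\<Sum>n\<le>J. A * (\<kappa> n * \<tau> n))"
      using A(1) \<tau>0 by (intro sum_mono2) (auto simp: \<kappa>_def)
    also have "\<dots> = A * ?s" unfolding s by (rule sum_distrib_left[symmetric])
    finally show ?thesis .
  qed
  have t3: "\<sigma> J * D (J - c0) \<le> A * 2 powr (m * real c0) * ?s"
  proof -
    let ?n = "J - c0"
    have Jn: "J - ?n = c0" using J by simp
    have "\<sigma> J * 2 powr (- real c0 * m) * D ?n \<le> A * \<kappa> ?n * \<sigma> ?n * D ?n"
      using transfer[of ?n] D unfolding Jn by (intro mult_right_mono) auto
    also have "\<dots> = A * (\<kappa> ?n * (\<sigma> ?n * D ?n))" by (simp only: mult.assoc)
    also have "\<dots> \<le> A * (\<kappa> ?n * \<tau> ?n)" using A(1) \<tau>0 by (intro mult_left_mono) (auto simp: \<kappa>_def)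
    also have "\<dots> \<le> A * ?s" using single[of ?n] A(1) by (intro mult_left_mono) auto
    finally have "2 powr (m * real c0) * (\<sigma> J * 2 powr (- real c0 * m) * D ?n) \<le> 2 powr (m * real c0) * (A * ?s)"
      by (intro mult_left_mono) auto
    moreover have "2 powr (m * real c0) * (\<sigma> J * 2 powr (- real c0 * m) * D ?n) = \<sigma> J * D ?n"
    proof -
      have "2 powr (m * real c0) * 2 powr (- real c0 * m) = 1" by (simp add: mult.commute flip: powr_add)
      then show ?thesis by (metis mult.assoc mult.commute mult.right_neutral)
    qed
    ultimately show ?thesis by (simp only: mult_ac)
  qed
  have t4: "2 powr (real J * \<delta>) * \<sigma> J * 2 powr (- \<theta> * real (K * J)) \<le> A' * ?s"
  proof -
    have "2 powr (real J * \<delta>) * \<sigma> J * 2 powr (- \<theta> * real (K * J)) \<le> A' * 2 powr (\<Gamma> * real J) * 2 powr (- \<theta> * real (K * J))"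
      by (intro mult_right_mono A') simp
    also have "\<dots> = A' * 2 powr (\<Gamma> * real J - \<theta> * real (K * J))"
      by (simp add: mult.assoc del: of_nat_mult flip: powr_add)
    also have "\<dots> \<le> A' * 2 powr (- \<epsilon> * real J)"
    proof -
      have "(\<Gamma> + \<epsilon>) * real J \<le> \<theta> * real K * real J" using K by (intro mult_right_mono) auto
      then have "\<Gamma> * real J - \<theta> * real (K * J) \<le> - \<epsilon> * real J" by (simp add: algebra_simps)
      then show ?thesis using A'(1) by (intro mult_left_mono powr_mono) auto
    qed
    also have "\<dots> \<le> A' * ?s" using decay A'(1) by (intro mult_left_mono) auto
    finally show ?thesis .
  qed
  have cJ: "0 < c * real J" using c J by simp
  then have l: "0 < l" using c by linarith
  define P where "P = \<sigma> J * 2 powr (- real J * m) + \<sigma> J * (\<Sum>n<J - c0. 2 powr (- real (J - n) * m) * D n)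
    + real (K * J) * (\<sigma> J * D (J - c0)) + 2 powr (real J * \<delta>) * \<sigma> J * 2 powr (- \<theta> * real (K * J))"
  have P0: "0 \<le> P" unfolding P_def using pos[of J] D
    by (intro add_nonneg_nonneg mult_nonneg_nonneg sum_nonneg) (auto intro: less_imp_le)
  have "?lhs = C * (P / l)"
  proof -
    have "2 powr (real J * \<delta>) * 2 powr (- real J * \<delta>) = 1" by (simp flip: powr_add)
    then have one: "2 powr (real J * \<delta>) * (2 powr (- real J * \<delta>) * y) = y" for y
      by (simp only: mult.assoc[symmetric] mult_1)
    have "2 powr (real J * \<delta>) * \<sigma> J * difference_majorant \<delta> \<theta> m c0 D K J
      = \<sigma> J * (2 powr (real J * \<delta>) * (2 powr (- real J * \<delta>) *
            (2 powr (- real J * m) + (\<Sum>n<J - c0. 2 powr (- real (J - n) * m) * D n) + real (K * J) * D (J - c0))))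
          + 2 powr (real J * \<delta>) * \<sigma> J * 2 powr (- \<theta> * real (K * J))"
      by (simp only: difference_majorant_def distrib_left mult_ac)
    also have "\<dots> = P" unfolding one P_def by (simp only: distrib_left mult_ac)
    finally show ?thesis by (simp add: mult.commute mult.left_commute)
  qed
  also have "P / l \<le> P / (c * real J)" using c cJ P0 l by (intro divide_left_mono) auto
  also have "P \<le> (?E * ?s) * real J"
  proof -
    have J1: "y \<le> y * real J" if "0 \<le> y" for y using mult_left_mono[of 1 "real J" y] J that by simp
    have "real (K * J) * (\<sigma> J * D (J - c0)) \<le> real (K * J) * (A * 2 powr (m * real c0) * ?s)"
      by (intro mult_left_mono t3) simp
    also have "\<dots> = real K * (A * 2 powr (m * real c0)) * ?s * real J" by (simp add: mult_ac)
    finally have "P \<le> A * \<sigma> 0 * ?s + A * ?s + real K * (A * 2 powr (m * real c0)) * ?s * real J + A' * ?s"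
      unfolding P_def using t1 t2 t4 by linarith
    also have "\<dots> \<le> A * \<sigma> 0 * ?s * real J + A * ?s * real J + real K * (A * 2 powr (m * real c0)) * ?s * real J + A' * ?s * real J"
      using A(1) A'(1) pos[of 0] s0 by (intro add_mono J1 mult_nonneg_nonneg order_refl) auto
    also have "\<dots> = (?E * ?s) * real J" by (simp only: distrib_right)
    finally show ?thesis .
  qed
  finally have "?lhs \<le> C * ((?E * ?s) * real J / (c * real J))"
    using C cJ by (simp add: mult_left_mono divide_right_mono)
  also have "\<dots> = C / c * ?E * ?s" using J by simp
  finally show ?thesis .
qed

theorem theorem3p6:
  fixes p q :: ennreal
    and x0 :: "real ^ 'd"
    and f :: "real ^ 'd \<Rightarrow> complex"
    and \<sigma> :: "nat \<Rightarrow> real"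
    and R :: nat
    and \<phi> :: "real ^ 'd \<Rightarrow> complex"
    and \<psi> :: "int ^ 'd \<Rightarrow> real ^ 'd \<Rightarrow> complex"
    and \<eta> :: real
  assumes "1 \<le> p" and "1 \<le> q"
    and "f \<in> Lp_loc p"
    and "admissible \<sigma>"
    and "(\<lambda>j. 2 powr (- real j * dim_over TYPE('d) p) * inverse (\<sigma> j)) \<longlonglongrightarrow> 0"
    and "lower_seq \<sigma> 1 > 2 powr (- dim_over TYPE('d) p)"
    and "regular_wavelet_basis R \<phi> \<psi>" and "real R > upper_Boyd \<sigma>"
    and "\<eta> > 0" and "f \<in> Xu_space \<psi> \<eta> p q x0"
    and "lp_norm q UNIV (\<lambda>j. ennreal (\<sigma> j) * leader_at \<psi> p f x0 j) < \<infinity>"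
  shows "f \<in> T_log \<sigma> p q x0"
proof -
  let ?\<delta> = "dim_over TYPE('d) p"
  note p = assms(1) and q = assms(2) and f = assms(3) and adm = assms(4) and \<eta> = assms(9)
  define m where "m = diff_order \<sigma>"
  have pos: "0 < \<sigma> n" for n using adm by (simp add: admissible_def)
  obtain C0 where C0: "0 < C0" and xu: "lp_norm q UNIV (\<lambda>j. lp_norm p
      {(i, k). i \<in> wtypes \<and> norm (int_vec k - 2 ^ j *\<^sub>R x0) < C0 * 2 ^ j}
         (\<lambda>(i, k). ennreal (2 powr ((\<eta> - ?\<delta>) * real j) * norm (wcoeff \<psi> f i j k)))) < \<infinity>"
    using assms(10) unfolding Xu_space_def by blast
  obtain \<rho> where \<rho>: "0 < \<rho>" "\<And>x. \<rho> \<le> norm x \<Longrightarrow> \<phi> x = 0" "\<And>i x. i \<in> wtypes \<Longrightarrow> \<rho> \<le> norm x \<Longrightarrow> \<psi> i x = 0"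
    using regular_wavelet_basis_support[OF assms(7)] by metis
  \<comment> \<open>strictly smaller than \<open>C0\<close>, so that the wavelets meeting \<open>ball x0 r\<close>
    satisfy the position constraint of the Xu space at all fine scales\<close>
  define r where "r = C0 / 2"
  have r_pos: "0 < r" and r_less: "r < C0" using C0 by (simp_all add: r_def)
  interpret wavelet_expansion R \<phi> \<psi> \<rho> x0 r
    by standard (use assms(7) \<rho> r_pos in auto)
  obtain c0 :: nat where c0: "\<rho> + 1 < 2 ^ c0" using real_arch_pow[of 2 "\<rho> + 1"] by auto
  obtain M where M: "0 < M" "\<And>n. Lp_norm p (ball x0 r) (F f n) \<le> ennreal (M * 2 powr (- \<eta> * real n))"
    using Xu_layer_decay[OF p q r_less xu] by metis
  define D where "D n = enn2real (leader_at \<psi> p f x0 n)" for n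
  have D: "0 \<le> D n" "leader_at \<psi> p f x0 n = ennreal (D n)" for n
  proof -
    show "0 \<le> D n" by (simp add: D_def)
    have "ennreal (\<sigma> n) * leader_at \<psi> p f x0 n \<le> lp_norm q UNIV (\<lambda>j. ennreal (\<sigma> j) * leader_at \<psi> p f x0 j)"
      by (rule lp_norm_elem[OF q]) simp
    then have "ennreal (\<sigma> n) * leader_at \<psi> p f x0 n < \<infinity>" using assms(11) by (rule le_less_trans)
    then have "leader_at \<psi> p f x0 n < \<infinity>" using pos[of n] by (auto simp: ennreal_mult_less_top)
    then show "leader_at \<psi> p f x0 n = ennreal (D n)" by (simp add: D_def less_top)
  qed
  have mR: "m \<le> R" unfolding m_def using assms(8) by (rule diff_order_le)
  obtain A \<epsilon> where A: "0 < A" "0 < \<epsilon>" "\<And>n J. n \<le> J \<Longrightarrow> \<sigma> J \<le> A * 2 powr ((real m - \<epsilon>) * real (J - n)) * \<sigma> n"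
    using admissible_growth[OF adm upper_Boyd_less_diff_order] unfolding m_def by metis
  obtain A' \<Gamma> where A': "0 < A'" "0 < \<Gamma>" "\<And>J. 2 powr (real J * ?\<delta>) * \<sigma> J \<le> A' * 2 powr (\<Gamma> * real J)"
    using admissible_exponential_bound[OF adm] by metis
  obtain c J0 where c: "0 < c" "\<And>J. J0 \<le> J \<Longrightarrow>
    c * real J \<le> \<bar>log 2 (2 powr (- real J * ?\<delta>) * inverse (\<sigma> J))\<bar>"
    using logarithm_grows_linearly[OF adm assms(6)] by metis
  \<comment> \<open>so many layers that the remaining tail outweighs the exponential growth of
    \<open>2 powr (J * ?\<delta>) * \<sigma> J\<close>\<close>
  obtain K :: nat where "(\<Gamma> + \<epsilon>) / (\<eta> / 2) < real K" using reals_Archimedean2 by blast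
  then have K: "\<Gamma> + \<epsilon> \<le> \<eta> / 2 * real K" using \<eta> by (simp add: field_simps)
  obtain C where C: "0 < C" "\<And>J K h. c0 \<le> J \<Longrightarrow> 2 powr (- real J) \<le> r \<Longrightarrow> norm h \<le> 2 powr (- real J) \<Longrightarrow>
    Lp_norm p (inner_ball m h x0 (2 powr (- real J))) (finite_diff m h f)
      \<le> ennreal (C * difference_majorant ?\<delta> (\<eta> / 2) (real m) c0 D K J)"
  proof (rule difference_Lp_bound[OF p f mR less_imp_le[OF c0] \<eta> M D])
    fix C assume "0 < C" "\<And>J K h. c0 \<le> J \<Longrightarrow> 2 powr (- real J) \<le> r \<Longrightarrow> norm h \<le> 2 powr (- real J) \<Longrightarrow>
      Lp_norm p (inner_ball m h x0 (2 powr (- real J))) (finite_diff m h f)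
        \<le> ennreal (C * difference_majorant ?\<delta> (\<eta> / 2) (real m) c0 D K J)"
    then show thesis by (rule that)
  qed
  obtain J2 :: nat where J2: "1 / r < 2 ^ J2" using real_arch_pow[of 2 "1 / r"] by auto
  define J1 where "J1 = max (max J0 J2) (max 1 c0)"
  define E where "E = C / c * (A * \<sigma> 0 + A + real K * (A * 2 powr (real m * real c0)) + A')"
  have E: "0 \<le> E" unfolding E_def using C(1) c(1) A A' pos[of 0]
    by (intro mult_nonneg_nonneg add_nonneg_nonneg) (auto intro: less_imp_le)
  define \<kappa> where "\<kappa> n = ennreal (2 powr (- \<epsilon> * real n))" for n
  define \<tau> where "\<tau> n = ennreal (\<sigma> n) * leader_at \<psi> p f x0 n + (if n = 0 then 1 else 0)" for n
  have bound: "ennreal \<bar>2 powr (real J * ?\<delta>) * \<sigma> J / log 2 (2 powr (- real J * ?\<delta>) * inverse (\<sigma> J))\<bar> *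
       (SUP h\<in>{h. norm h \<le> 2 powr (- real J)}.
          Lp_norm p (inner_ball m h x0 (2 powr (- real J))) (finite_diff m h f))
     \<le> ennreal E * (\<Sum>n\<le>J. \<kappa> (J - n) * \<tau> n)" if J: "J1 \<le> J" for J
  proof -
    have JJ: "J0 \<le> J" "J2 \<le> J" "1 \<le> J" "c0 \<le> J" using J by (auto simp: J1_def)
    have Jr: "2 powr (- real J) \<le> r"
    proof -
      have "(2::real) ^ J2 \<le> 2 ^ J" using JJ by (intro power_increasing) auto
      then have "1 / r < 2 ^ J" using J2 by linarith
      then show ?thesis using r_pos by (simp add: powr_minus powr_realpow field_simps)
    qed
    define l where "l = \<bar>log 2 (2 powr (- real J * ?\<delta>) * inverse (\<sigma> J))\<bar>"
    define X where "X = C * difference_majorant ?\<delta> (\<eta> / 2) (real m) c0 D K J"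
    have "(SUP h\<in>{h. norm h \<le> 2 powr (- real J)}.
          Lp_norm p (inner_ball m h x0 (2 powr (- real J))) (finite_diff m h f)) \<le> ennreal X"
      unfolding X_def using C(2)[OF JJ(4) Jr] by (intro SUP_least) simp
    moreover have "\<bar>2 powr (real J * ?\<delta>) * \<sigma> J / log 2 (2 powr (- real J * ?\<delta>) * inverse (\<sigma> J))\<bar>
        = 2 powr (real J * ?\<delta>) * \<sigma> J / l"
      using pos[of J] by (simp add: l_def abs_mult)
    ultimately have "ennreal \<bar>2 powr (real J * ?\<delta>) * \<sigma> J / log 2 (2 powr (- real J * ?\<delta>) * inverse (\<sigma> J))\<bar> *
       (SUP h\<in>{h. norm h \<le> 2 powr (- real J)}.
          Lp_norm p (inner_ball m h x0 (2 powr (- real J))) (finite_diff m h f))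
      \<le> ennreal (2 powr (real J * ?\<delta>) * \<sigma> J / l) * ennreal X"
      by (simp only:) (rule mult_left_mono, simp_all)
    also have "\<dots> = ennreal (2 powr (real J * ?\<delta>) * \<sigma> J / l * X)"
      using pos[of J] by (intro ennreal_mult'[symmetric]) (auto simp: l_def intro!: divide_nonneg_nonneg)
    also have "\<dots> \<le> ennreal (E * (\<Sum>n\<le>J. 2 powr (- \<epsilon> * real (J - n)) * (\<sigma> n * D n + (if n = 0 then 1 else 0))))"
      unfolding X_def E_def l_def
      by (intro ennreal_leI convolution_dominates[OF pos D(1) A(1,3) A'(1,3) K c(1) c(2)[OF JJ(1)] JJ(3,4)]
          less_imp_le[OF C(1)])
    also have "\<dots> = ennreal E * (\<Sum>n\<le>J. \<kappa> (J - n) * \<tau> n)"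
    proof -
      have nn: "0 \<le> \<sigma> n * D n + (if n = 0 then 1 else 0)" for n
        using less_imp_le[OF pos[of n]] D(1)[of n] by simp
      have \<tau>_eq: "\<tau> n = ennreal (\<sigma> n * D n + (if n = 0 then 1 else 0))" for n
        using pos[of n] D[of n] by (simp add: \<tau>_def ennreal_mult)
      have "(\<Sum>n\<le>J. \<kappa> (J - n) * \<tau> n)
          = (\<Sum>n\<le>J. ennreal (2 powr (- \<epsilon> * real (J - n)) * (\<sigma> n * D n + (if n = 0 then 1 else 0))))"
        unfolding \<tau>_eq \<kappa>_def by (intro sum.cong refl ennreal_mult[symmetric] nn) simp
      also have "\<dots> = ennreal (\<Sum>n\<le>J. 2 powr (- \<epsilon> * real (J - n)) * (\<sigma> n * D n + (if n = 0 then 1 else 0)))"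
        by (intro sum_ennreal mult_nonneg_nonneg nn) simp
      finally show ?thesis using E by (simp only: ennreal_mult')
    qed
    finally show ?thesis .
  qed
  have "lp_norm q {J1..} (\<lambda>J.
       ennreal \<bar>2 powr (real J * ?\<delta>) * \<sigma> J / log 2 (2 powr (- real J * ?\<delta>) * inverse (\<sigma> J))\<bar> *
       (SUP h\<in>{h. norm h \<le> 2 powr (- real J)}.
          Lp_norm p (inner_ball m h x0 (2 powr (- real J))) (finite_diff m h f)))
      \<le> lp_norm q UNIV (\<lambda>J. ennreal E * (\<Sum>n\<le>J. \<kappa> (J - n) * \<tau> n))"
    using bound by (intro lp_norm_mono[OF q]) auto
  also have "\<dots> \<le> ennreal E * lp_norm q UNIV (\<lambda>J. \<Sum>n\<le>J. \<kappa> (J - n) * \<tau> n)"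
    by (rule lp_norm_cmult_le[OF q])
  also have "\<dots> \<le> ennreal E * ((\<Sum>n. \<kappa> n) * lp_norm q UNIV \<tau>)"
    by (intro mult_left_mono lp_norm_convolution_le[OF q]) simp
  also have "\<dots> < \<infinity>"
  proof -
    have "lp_norm q UNIV \<tau> \<le> lp_norm q UNIV (\<lambda>j. ennreal (\<sigma> j) * leader_at \<psi> p f x0 j) + lp_norm q UNIV (\<lambda>j::nat. if j = 0 then 1 else 0)"
      unfolding \<tau>_def by (rule lp_norm_add_le[OF q])
    also have "\<dots> \<le> lp_norm q UNIV (\<lambda>j. ennreal (\<sigma> j) * leader_at \<psi> p f x0 j) + 1"
      by (intro add_left_mono lp_norm_unit_le[OF q])
    also have "\<dots> < \<infinity>" using assms(11) by simp
    finally have \<tau>fin: "lp_norm q UNIV \<tau> < \<infinity>" .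
    have "2 powr (- \<epsilon>) < 2 powr 0" using A(2) by (subst powr_less_cancel_iff) auto
    then have "summable (\<lambda>n. (2 powr (- \<epsilon>)) ^ n)" by (intro summable_geometric) simp
    moreover have "(2 powr (- \<epsilon>)) ^ n = 2 powr (- \<epsilon> * real n)" for n
      by (simp add: powr_realpow[symmetric] powr_powr)
    ultimately have "summable (\<lambda>n. 2 powr (- \<epsilon> * real n))" by (simp only:)
    then have "(\<Sum>n. \<kappa> n) \<noteq> top" unfolding \<kappa>_def by (rule ennreal_suminf_neq_top) simp
    then show ?thesis using \<tau>fin by (simp add: ennreal_mult_less_top less_top)
  qed
  finally show ?thesis using f unfolding T_log_def m_def by blast
qed

end
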